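(* Let $\alpha\ge 3$ be a computable ordinal which is the successor of a successor ordinal. Then the directed graph $H_\alpha$ on $\mathbb{Y}_\alpha$ does not have a countable $\boldsymbol{\Sigma}^0_\alpha$ colouring.
   Context: The tree. $\alpha$ is identified with a computable well-ordering of a computable subset of $\mathbb{N}$ whose successor relation and set of limit points are computable; this gives, uniformly for each limit $\delta\le\alpha$, a computable increasing sequence $(\delta_k)$ cofinal in $\delta$. For $\beta<\alpha$, $a_\beta\in\mathbb{N}$ is the least upper bound, in this well-ordering, of its initial segment of type $\beta$. $T_\alpha\subset \mathbb{N}^{<\omega}$ is the computable well-founded tree, with rank function $\mathrm{rk}$, defined as follows: the root $\langle\rangle$ is in $T_\alpha$ and has rank $\alpha$; if $\sigma\in T_\alpha$ has limit rank $\delta$ then for all $k$, $\sigma^\frown k\in T_\alpha$ has rank $\delta_k$; if $\sigma\in T_\alpha$ has rank $\beta+1$ then for all $k$, $\sigma^\frown k\in T_\alpha$ has rank $\beta$; nodes of rank $0$ are leaves; $\mathcal{L}_\alpha$ is the set of leaves. Put $\alpha^*=\alpha-2$ (so $\alpha^*\ge1$ and the nodes of rank $<\alpha^*$ are exactly those of length $\ge 3$). For $x\in 2^{\mathcal{L}_\alpha}$, $T^x\colon T_\alpha\to\{0,1\}$: $T^x(\sigma)=x(\sigma)$ for leaves; for non-leaves, $T^x(\sigma)=0$ iff $T^x(\sigma^\frown k)=1$ for some $k$. Write $T^x(m,k)=T^x(\langle m,k\rangle)$ etc. Let $n^x=\sup\{n:(\forall m<n)\ T^x(m)=0\}\in\omega\cup\{\omega\}$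 and for $m<n^x$ let $k^x(m)$ be the least $k$ with $T^x(m,k)=1$. Finite approximations. For each $\beta<\alpha$ fix, uniformly, a computable $\omega$-ordering $<^*_\beta$ of the nodes of $T_\alpha$ of rank $\beta$, such that $\sigma^\frown k<^*_\beta\sigma^\frown k'$ whenever these siblings both have rank $\beta$ and $k<k'$. $2^{<\mathcal{L}_\alpha}$ is the set of finite partial functions $\mathcal{L}_\alpha\to\{0,1\}$ whose domain is an initial segment of $(\mathcal{L}_\alpha,<^*_0)$; $2^{\le\mathcal{L}_\alpha}=2^{<\mathcal{L}_\alpha}\cup 2^{\mathcal{L}_\alpha}$; $|t|$ is the size of $\mathrm{dom}\,t$; $s\preceq t$ means $t$ extends $s$ as a function, $\prec$ is its strict version. For $t\in2^{<\mathcal{L}_\alpha}$ define a partial labelling $T^t$ of the nodes of rank $<\alpha$ by $\{0,1\}$, by recursion on $|t|$ and then on the rank $\beta$; $T^t_\beta$ denotes the restriction of $T^t$ to nodes of rank $<\beta$ (similarly $T^x_\beta$). If $t=\langle\rangle$ then $T^t$ is empty. If $t\neq\langle\rangle$: on leaves, $T^t=t$. For $0<\beta<\alpha$: if there are at most $a_\beta$ many $s\prec t$ with $T^s_\beta\subseteq T^t_\beta$, then $T^t(\sigma)$ is undefined for all $\sigma$ of rank $\beta$. Otherwise let $s$ be the longest $s\prec t$ with $T^s_\beta\subseteq T^t_\beta$, and let $\tau$ be the $<^*_\beta$-least node such that either $T^s(\tau)$ is undefined, or $T^s(\tau)=1$ and $T^t(\tau^\frown k)=1$ for some $k$; for $\sigma<^*_\beta\tau$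 put $T^t(\sigma)=T^s(\sigma)$, for $\sigma>^*_\beta\tau$ leave $T^t(\sigma)$ undefined, and put $T^t(\tau)=0$ if $T^t(\tau^\frown k)=1$ for some $k$, $T^t(\tau)=1$ otherwise. For $s,t\in2^{\le\mathcal{L}_\alpha}$ write $s\preceq_{\alpha^*}t$ if $T^s_{\alpha^*}\subseteq T^t_{\alpha^*}$ ($\prec_{\alpha^*}$ is the strict version). For $t\in 2^{<\mathcal{L}_\alpha}$ define $n^t$, and $k^t(m)$ for $m<n^t$, by recursion on $|t|$: $n^{\langle\rangle}=0$. If $t\ne\langle\rangle$ let $s$ be the longest with $s\prec_{\alpha^*}t$. If there are $m<n^s$ and $a$ with $T^t(m,k^s(m),a)=1$, let $n^t$ be the least such $m$; otherwise $n^t=n^s+1$. For $m<n^t$, $k^t(m)$ is the least $k$ for which there is no $a$ with $T^t(m,k,a)=1$. For $r,s\in2^{\le\mathcal{L}_\alpha}$, $r\sqsubseteq_m s$ means: $r\preceq_{\alpha^*}s$, $m\le\min\{n^r,n^s\}$, and $k^r(\ell)=k^s(\ell)$ for all $\ell<m$. For $t\in2^{\le\mathcal{L}_\alpha}$ and finite $m\le n^t$, $c^t(m)=\min\{|s|: s\sqsubseteq_m t\}$. Coding. $(M_k)$ is a fixed uniformly computable dense list of elements of $2^\omega$; $k$ codes a finite binary string $\zeta$ if $\zeta$ is an initial segment of $M_k$. The graph. $\mathbb{X}_\alpha=2^{\mathcal{L}_\alpha}\times\mathcal{P}(\mathbb{N})$ (Cantor topologies; subsets of $\mathbb{N}$ identified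 with characteristic functions). $\mathbb{Y}_\alpha$ is the set of $(x,y)\in\mathbb{X}_\alpha$ such that for all $m<n^x$, $k^x(m)$ codes $y\restriction(c^x(m)+1)$, with the subspace topology. $H_\alpha$ is the directed graph on $\mathbb{Y}_\alpha$ with an edge from $(x,y)$ to $(x',y')$ iff $x=x'$, $n^x<\omega$, $y\bigtriangleup y'=\{c^x(n^x)\}$ and $c^x(n^x)\notin y$. A countable $\boldsymbol{\Sigma}^0_\alpha$ colouring of a directed graph is a partition of the space into countably many $\boldsymbol{\Sigma}^0_\alpha$ sets, none of which contains both endpoints of an edge. *)

theory Defs
  imports "HOL-Analysis.Analysis" "HOL-Library.Nat_Bijection" "HOL-Library.Disjoint_Sets"
    "HOL-Library.Extended_Nat"
begin

section \<open>Computable functions and relations\<close>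

text \<open>
  The total recursive functions of \<open>n\<close> arguments, given as functions on argument lists of length
  \<open>n\<close>; values on lists of other lengths are irrelevant. Restricting minimisation to the regular case
  yields exactly the total computable functions, by the normal form theorem.
\<close>

inductive recfn :: "nat \<Rightarrow> (nat list \<Rightarrow> nat) \<Rightarrow> bool" where
  zero: "recfn n (\<lambda>xs. 0)"
| succ: "recfn 1 (\<lambda>xs. Suc (hd xs))"
| proj: "i < n \<Longrightarrow> recfn n (\<lambda>xs. xs ! i)"
| comp: "recfn (length gs) f \<Longrightarrow> (\<And>g. g \<in> set gs \<Longrightarrow> recfn n g) \<Longrightarrow>
    recfn n (\<lambda>xs. f (map (\<lambda>g. g xs) gs))"
| prec: "recfn n f \<Longrightarrow> recfn (n + 2) g \<Longrightarrow>
    recfn (Suc n) (\<lambda>xs. rec_nat (f (tl xs)) (\<lambda>y r. g (y # r # tl xs)) (hd xs))"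
| mu: "recfn (Suc n) f \<Longrightarrow> (\<And>xs. length xs = n \<Longrightarrow> \<exists>y. f (y # xs) = 0) \<Longrightarrow>
    recfn n (\<lambda>xs. LEAST y. f (y # xs) = 0)"

definition computable_rel :: "nat \<Rightarrow> (nat list \<Rightarrow> bool) \<Rightarrow> bool" where
  "computable_rel n P \<longleftrightarrow>
    (\<exists>g. recfn n g \<and> (\<forall>xs. length xs = n \<longrightarrow> g xs = (if P xs then 1 else 0)))"

section \<open>The presentation of the ordinal and its tree\<close>

text \<open>
  A countable ordinal \<open>\<alpha>\<close> is given by a (reflexive) well-order \<open>R\<close> of type \<open>\<alpha>\<close> on a set of natural
  numbers. An ordinal \<open>\<beta> < \<alpha>\<close> is represented by the element \<open>b\<close> of \<open>Field R\<close> for which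
  \<open>underS R b\<close> has type \<open>\<beta>\<close>; the ordinal \<open>\<alpha>\<close> itself is represented by \<open>R\<close>.
\<close>

definition imm_succ :: "nat rel \<Rightarrow> nat \<Rightarrow> nat \<Rightarrow> bool" where
  "imm_succ R b c \<longleftrightarrow> (b, c) \<in> R \<and> b \<noteq> c \<and> (\<forall>a. (b, a) \<in> R \<and> (a, c) \<in> R \<longrightarrow> a = b \<or> a = c)"

definition limit_point :: "nat rel \<Rightarrow> nat \<Rightarrow> bool" where
  "limit_point R d \<longleftrightarrow> d \<in> Field R \<and> underS R d \<noteq> {} \<and> \<not> (\<exists>b. imm_succ R b d)"

definition is_top :: "nat rel \<Rightarrow> nat \<Rightarrow> bool" where
  "is_top R c \<longleftrightarrow> c \<in> Field R \<and> (\<forall>a \<in> Field R. (a, c) \<in> R)"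

definition computable_presentation :: "nat rel \<Rightarrow> bool" where
  "computable_presentation R \<longleftrightarrow> Well_order R \<and>
    computable_rel 1 (\<lambda>xs. xs ! 0 \<in> Field R) \<and>
    computable_rel 2 (\<lambda>xs. (xs ! 0, xs ! 1) \<in> R) \<and>
    computable_rel 2 (\<lambda>xs. imm_succ R (xs ! 0) (xs ! 1)) \<and>
    computable_rel 1 (\<lambda>xs. limit_point R (xs ! 0))"

definition succ_of_succ :: "nat rel \<Rightarrow> bool" where
  "succ_of_succ R \<longleftrightarrow> (\<exists>b c. imm_succ R b c \<and> is_top R c)"

definition fundamental_sequences :: "nat rel \<Rightarrow> (nat \<Rightarrow> nat \<Rightarrow> nat) \<Rightarrow> bool" where
  "fundamental_sequences R fs \<longleftrightarrow>
    (\<exists>g. recfn 2 g \<and> (\<forall>d k. limit_point R d \<longrightarrow> g [d, k] = fs d k)) \<and>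
    (\<forall>d. limit_point R d \<longrightarrow>
      (\<forall>k. fs d k \<in> underS R d) \<and>
      (\<forall>k l. k < l \<longrightarrow> fs d k \<in> underS R (fs d l)) \<and>
      (\<forall>b \<in> underS R d. \<exists>k. (b, fs d k) \<in> R))"

text \<open>
  \<open>node R fs \<sigma> b\<close>: \<open>\<sigma>\<close> is a node of the tree of rank \<open>b\<close>, where \<open>b < \<alpha>\<close>. The only node not covered
  is the root, of rank \<open>\<alpha>\<close>. Only successor ordinals \<open>\<alpha>\<close> are considered, so the children of the root
  all have as rank the predecessor of \<open>\<alpha>\<close>, that is, the greatest element of \<open>R\<close>.
\<close>

inductive node :: "nat rel \<Rightarrow> (nat \<Rightarrow> nat \<Rightarrow> nat) \<Rightarrow> nat list \<Rightarrow> nat \<Rightarrow> bool" for R fs where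
  root_child: "is_top R c \<Longrightarrow> node R fs [k] c"
| succ_child: "node R fs \<sigma> c \<Longrightarrow> imm_succ R b c \<Longrightarrow> node R fs (\<sigma> @ [k]) b"
| limit_child: "node R fs \<sigma> d \<Longrightarrow> limit_point R d \<Longrightarrow> node R fs (\<sigma> @ [k]) (fs d k)"

text \<open>\<open>lo b\<close> is the (reflexive) ordering \<open>\<le>\<^sup>*\<close> of type \<open>\<omega>\<close> on the nodes of rank \<open>b\<close>.\<close>

definition node_orders ::
  "nat rel \<Rightarrow> (nat \<Rightarrow> nat \<Rightarrow> nat) \<Rightarrow> (nat \<Rightarrow> nat list rel) \<Rightarrow> bool" where
  "node_orders R fs lo \<longleftrightarrow>
    computable_rel 3 (\<lambda>xs. xs ! 0 \<in> Field R \<and> (list_decode (xs ! 1), list_decode (xs ! 2)) \<in> lo (xs ! 0)) \<and>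
    (\<forall>b \<in> Field R. Field (lo b) = {\<sigma>. node R fs \<sigma> b} \<and> (lo b, natLeq) \<in> ordIso \<and>
      (\<forall>\<sigma> k l. node R fs (\<sigma> @ [k]) b \<and> node R fs (\<sigma> @ [l]) b \<and> k < l \<longrightarrow>
        (\<sigma> @ [k], \<sigma> @ [l]) \<in> lo b))"

abbreviation cantor_topology :: "'i set \<Rightarrow> ('i \<Rightarrow> bool) topology" where
  "cantor_topology I \<equiv> product_topology (\<lambda>_. discrete_topology UNIV) I"

definition computable_dense_list :: "(nat \<Rightarrow> nat \<Rightarrow> bool) \<Rightarrow> bool" where
  "computable_dense_list M \<longleftrightarrow> computable_rel 2 (\<lambda>xs. M (xs ! 0) (xs ! 1)) \<and>
    cantor_topology UNIV closure_of (range M) = topspace (cantor_topology UNIV)"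

lemma underS_iff: "a \<in> underS R b \<longleftrightarrow> a \<noteq> b \<and> (a, b) \<in> R"
  by (auto simp: underS_def)

definition longest :: "('a \<rightharpoonup> 'b) set \<Rightarrow> ('a \<rightharpoonup> 'b)" where
  "longest S = arg_max_on (\<lambda>s. card (dom s)) S"

lemma longest_in:
  assumes "finite S" "S \<noteq> {}" shows "longest S \<in> S"
proof -
  obtain s where s: "s \<in> S" using assms by blast
  let ?f = "\<lambda>s. card (dom s)"
  have "\<forall>y. y \<in> S \<longrightarrow> ?f y \<le> Max (?f ` S)" using assms by auto
  then have "\<forall>y. y \<in> S \<longrightarrow> ?f y < Suc (Max (?f ` S))" by (simp add: less_Suc_eq_le)
  from arg_max_natI[where P="\<lambda>s. s \<in> S" and f="?f", OF s this]
  show ?thesis by (simp add: longest_def arg_max_on_def)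
qed

lemma finite_submaps:
  assumes "finite (dom t)" shows "finite {s. s \<subseteq>\<^sub>m t}"
proof (rule finite_subset)
  show "{s. s \<subseteq>\<^sub>m t} \<subseteq> (\<lambda>D. t |` D) ` Pow (dom t)"
  proof
    fix s assume "s \<in> {s. s \<subseteq>\<^sub>m t}"
    then have le: "s \<subseteq>\<^sub>m t" by simp
    then have "s = t |` dom s"
      by (auto simp: map_le_def restrict_map_def fun_eq_iff domIff)
    moreover have "dom s \<subseteq> dom t" using le by (rule map_le_implies_dom_le)
    ultimately show "s \<in> (\<lambda>D. t |` D) ` Pow (dom t)" by blast
  qed
qed (use assms in simp)

lemma card_dom_less:
  assumes "finite (dom t)" "s \<subseteq>\<^sub>m t" "s \<noteq> t" shows "card (dom s) < card (dom t)"
proof (rule psubset_card_mono[OF assms(1)])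
  have "dom s \<noteq> dom t"
    using assms by (metis map_le_antisym map_le_def)
  then show "dom s \<subset> dom t" using map_le_implies_dom_le[OF assms(2)] by blast
qed

section \<open>Labellings, approximations and the graph\<close>

locale alpha_tree =
  fixes R :: "nat rel" and fs :: "nat \<Rightarrow> nat \<Rightarrow> nat" and lo :: "nat \<Rightarrow> nat list rel"
    and M :: "nat \<Rightarrow> nat \<Rightarrow> bool"
  assumes presentation: "computable_presentation R"
    and ge3: "(natLeq_on 3, R) \<in> ordLeq"
    and succ_succ: "succ_of_succ R"
    and fund: "fundamental_sequences R fs"
    and orders: "node_orders R fs lo"
    and dense_list: "computable_dense_list M"
begin

definition tree :: "nat list set" where
  "tree = insert [] {\<sigma>. \<exists>b. node R fs \<sigma> b}"

definition rk :: "nat list \<Rightarrow> nat" where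
  "rk \<sigma> = (THE b. node R fs \<sigma> b)"

definition least_elt :: nat where
  "least_elt = wo_rel.minim R (Field R)"

definition leaves :: "nat list set" where
  "leaves = {\<sigma>. node R fs \<sigma> least_elt}"

text \<open>The representative of \<open>\<alpha> - 2\<close>.\<close>

definition astar :: nat where
  "astar = (THE b. \<exists>c. imm_succ R b c \<and> is_top R c)"

text \<open>
  The number \<open>a\<^sub>\<beta>\<close>. The least upper bound is not strict: it is \<open>b\<close> itself if \<open>b\<close> is a limit point
  or least, but the predecessor of \<open>b\<close> otherwise.
\<close>

definition a_lub :: "nat \<Rightarrow> nat" where
  "a_lub b = wo_rel.supr R (underS R b)"

definition nodes_below :: "nat \<Rightarrow> nat list set" where
  "nodes_below b = {\<sigma>. \<exists>c \<in> underS R b. node R fs \<sigma> c}"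

abbreviation node_less :: "nat \<Rightarrow> nat list \<Rightarrow> nat list \<Rightarrow> bool" where
  "node_less b \<sigma> \<tau> \<equiv> \<sigma> \<in> underS (lo b) \<tau>"

text \<open>
  Binary labellings of leaves and of nodes are partial maps into \<open>bool\<close>, with \<open>True\<close> for \<open>1\<close>.
  \<open>full x\<close> is the graph of the labelling \<open>T\<^sup>x\<close>.
\<close>

inductive full :: "(nat list \<rightharpoonup> bool) \<Rightarrow> nat list \<Rightarrow> bool \<Rightarrow> bool" for x where
  leaf: "\<sigma> \<in> leaves \<Longrightarrow> x \<sigma> = Some i \<Longrightarrow> full x \<sigma> i"
| label0: "\<sigma> \<in> tree - leaves \<Longrightarrow> full x (\<sigma> @ [k]) True \<Longrightarrow> full x \<sigma> False"
| label1: "\<sigma> \<in> tree - leaves \<Longrightarrow> (\<And>k. full x (\<sigma> @ [k]) False) \<Longrightarrow> full x \<sigma> True"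

definition fin_strings :: "(nat list \<rightharpoonup> bool) set" where
  "fin_strings = {t. finite (dom t) \<and> ofilter (lo least_elt) (dom t)}"

abbreviation prec :: "(nat list \<rightharpoonup> bool) \<Rightarrow> (nat list \<rightharpoonup> bool) \<Rightarrow> bool" where
  "prec s t \<equiv> s \<subseteq>\<^sub>m t \<and> s \<noteq> t"

lemma wo: "Well_order R"
  using presentation by (simp add: computable_presentation_def)

lemma wo_rel: "wo_rel R"
  using wo by (simp add: wo_rel_def)

lemma imm_succ_unique: "imm_succ R b c \<Longrightarrow> imm_succ R b' c \<Longrightarrow> b = b'"
  using wo_rel.TOTALS[OF wo_rel] unfolding imm_succ_def
  by (metis FieldI1)

lemma is_top_unique: "is_top R c \<Longrightarrow> is_top R c' \<Longrightarrow> c = c'"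
  using wo_rel.ANTISYM[OF wo_rel] unfolding is_top_def by (metis antisymD)

lemma node_nonempty: "node R fs \<sigma> b \<Longrightarrow> \<sigma> \<noteq> []"
  by (cases rule: node.cases) auto

lemma node_unique: "node R fs \<sigma> b \<Longrightarrow> node R fs \<sigma> b' \<Longrightarrow> b = b'"
proof (induction arbitrary: b' rule: node.induct)
  case (root_child c k)
  from root_child(2) show ?case
    by (cases rule: node.cases)
      (use root_child is_top_unique node_nonempty in \<open>auto\<close>)
next
  case (succ_child \<sigma> c b k)
  from succ_child(4) show ?case
  proof (cases rule: node.cases)
    case (root_child k')
    then show ?thesis using node_nonempty succ_child(1) by auto
  next
    case (succ_child \<sigma>' c' k')
    then show ?thesis using succ_child.hyps succ_child.IH imm_succ_unique by auto
  next
    case (limit_child \<sigma>' d k')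
    then show ?thesis using succ_child.hyps succ_child.IH by (auto simp: limit_point_def)
  qed
next
  case (limit_child \<sigma> d k)
  from limit_child(4) show ?case
  proof (cases rule: node.cases)
    case (root_child k')
    then show ?thesis using node_nonempty limit_child(1) by auto
  next
    case (succ_child \<sigma>' c' k')
    then show ?thesis using limit_child.hyps limit_child.IH by (auto simp: limit_point_def)
  next
    case (limit_child \<sigma>' d k')
    then show ?thesis using limit_child.hyps limit_child.IH by auto
  qed
qed

lemma rk_eq: "node R fs \<sigma> b \<Longrightarrow> rk \<sigma> = b"
  unfolding rk_def using node_unique by blast

lemma wf_R: "wf (R - Id)"
  using wo by (simp add: well_order_on_def)

definition lab_order :: "(((nat list \<rightharpoonup> bool) \<times> nat list) rel)" where
  "lab_order = inv_image (less_than <*lex*> (R - Id)) (\<lambda>(t, \<sigma>). (card (dom t), rk \<sigma>))"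

lemma wf_lab_order: "wf lab_order"
  unfolding lab_order_def using wf_R by auto

lemma lab_order_smaller:
  "t \<in> fin_strings \<Longrightarrow> s \<in> fin_strings \<and> prec s t \<Longrightarrow> ((s, \<rho>), (t, \<sigma>)) \<in> lab_order"
  using card_dom_less[of t s] by (auto simp: lab_order_def fin_strings_def)

lemma lab_order_below: "\<rho> \<in> nodes_below (rk \<sigma>) \<Longrightarrow> ((t, \<rho>), (t, \<sigma>)) \<in> lab_order"
  by (auto simp: lab_order_def nodes_below_def underS_iff rk_eq)

lemma longest_prec:
  assumes "\<not> card S \<le> n" "S \<subseteq> {s \<in> fin_strings. prec s t}"
  shows "longest S \<in> fin_strings \<and> prec (longest S) t"
proof -
  have "card S > 0" using assms(1) by linarith
  then have "longest S \<in> S" by (intro longest_in) (auto simp: card_gt_0_iff)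
  then show ?thesis using assms(2) by blast
qed

lemma children_below:
  assumes "node R fs \<tau> b" "b \<noteq> least_elt"
  shows "\<tau> @ [k] \<in> nodes_below b"
proof (cases "limit_point R b")
  case True
  then have "fs b k \<in> underS R b" using fund by (simp add: fundamental_sequences_def)
  then show ?thesis using assms True node.limit_child unfolding nodes_below_def by blast
next
  case False
  have bF: "b \<in> Field R" using assms(1)
    by (cases rule: node.cases)
      (use fund in \<open>auto simp: is_top_def imm_succ_def fundamental_sequences_def underS_iff
        intro: FieldI1\<close>)
  then have "least_elt \<in> underS R b"
    using wo_rel.minim_least[OF wo_rel, of "Field R" b] assms(2)
    by (auto simp: least_elt_def underS_iff)
  then obtain c where "imm_succ R c b" using False bF by (auto simp: limit_point_def)
  then show ?thesis using assms(1) node.succ_child[of R fs \<tau> b c k]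
    by (auto simp: nodes_below_def underS_iff imm_succ_def)
qed

text \<open>
  The recursive step: \<open>lab_step L t \<sigma>\<close> is \<open>T\<^sup>t(\<sigma>)\<close> if \<open>L s\<close> and \<open>L t\<close> are the labellings \<open>T\<^sup>s\<close>, for
  \<open>s \<prec> t\<close>, and \<open>T\<^sup>t\<close> on the ranks below that of \<open>\<sigma>\<close>.
\<close>

definition lab_step ::
  "((nat list \<rightharpoonup> bool) \<Rightarrow> (nat list \<rightharpoonup> bool)) \<Rightarrow> (nat list \<rightharpoonup> bool) \<Rightarrow> (nat list \<rightharpoonup> bool)" where
  "lab_step L t \<sigma> =
    (if t \<notin> fin_strings \<or> t = Map.empty \<or> \<sigma> \<notin> tree - {[]} then None
     else if \<sigma> \<in> leaves then t \<sigma>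
     else let b = rk \<sigma>;
              S = {s \<in> fin_strings. prec s t \<and> L s |` nodes_below b \<subseteq>\<^sub>m L t |` nodes_below b}
          in if card S \<le> a_lub b then None
             else let s = longest S;
                      \<tau> = wo_rel.minim (lo b)
                        {\<tau>. node R fs \<tau> b \<and>
                            (L s \<tau> = None \<or>
                             L s \<tau> = Some True \<and> (\<exists>k. L t (\<tau> @ [k]) = Some True))}
                  in if node_less b \<sigma> \<tau> then L s \<sigma>
                     else if \<sigma> = \<tau> then Some (\<not> (\<exists>k. L t (\<tau> @ [k]) = Some True))
                     else None)"

lemma lab_step_cong:
  assumes eq: "\<And>s \<rho>. ((s, \<rho>), (t, \<sigma>)) \<in> lab_order \<Longrightarrow> L s \<rho> = L' s \<rho>"
  shows "lab_step L t \<sigma> = lab_step L' t \<sigma>"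
proof (cases "t \<notin> fin_strings \<or> t = Map.empty \<or> \<sigma> \<notin> tree - {[]} \<or> \<sigma> \<in> leaves")
  case True
  then show ?thesis by (auto simp: lab_step_def)
next
  case False
  define b where "b = rk \<sigma>"
  obtain b' where "node R fs \<sigma> b'" using False by (auto simp: tree_def)
  then have \<sigma>: "node R fs \<sigma> b" by (simp add: b_def rk_eq)
  then have b: "b \<noteq> least_elt" using False by (auto simp: leaves_def)
  have eqs: "L s = L' s" if "s \<in> fin_strings \<and> prec s t" for s
    using eq lab_order_smaller that False by blast
  have eqt: "L t |` nodes_below b = L' t |` nodes_below b"
    using eq[OF lab_order_below] by (auto simp: restrict_map_def b_def fun_eq_iff)
  have eqc: "L t (\<tau> @ [k]) = L' t (\<tau> @ [k])" if "node R fs \<tau> b" for \<tau> k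
    using eq[OF lab_order_below] children_below[OF that b] by (simp add: b_def)
  define S where "S L = {s \<in> fin_strings. prec s t \<and> L s |` nodes_below b \<subseteq>\<^sub>m L t |` nodes_below b}"
    for L :: "(nat list \<rightharpoonup> bool) \<Rightarrow> (nat list \<rightharpoonup> bool)"
  define T where "T L s = {\<tau>. node R fs \<tau> b \<and>
      (L s \<tau> = None \<or> L s \<tau> = Some True \<and> (\<exists>k. L t (\<tau> @ [k]) = Some True))}"
    for L :: "(nat list \<rightharpoonup> bool) \<Rightarrow> (nat list \<rightharpoonup> bool)" and s
  have step: "lab_step L t \<sigma> =
      (if card (S L) \<le> a_lub b then None
       else if node_less b \<sigma> (wo_rel.minim (lo b) (T L (longest (S L)))) then L (longest (S L)) \<sigma>
       else if \<sigma> = wo_rel.minim (lo b) (T L (longest (S L)))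
       then Some (\<not> (\<exists>k. L t (\<sigma> @ [k]) = Some True)) else None)" for L
    using False unfolding lab_step_def S_def T_def b_def Let_def by simp
  have SS: "S L = S L'" unfolding S_def using eqs eqt by auto
  show ?thesis
  proof (cases "card (S L) \<le> a_lub b")
    case True
    then show ?thesis using SS by (simp add: step)
  next
    case nle: False
    have s: "longest (S L) \<in> fin_strings \<and> prec (longest (S L)) t"
      using nle by (rule longest_prec) (auto simp: S_def)
    have TT: "T L (longest (S L)) = T L' (longest (S L))"
      unfolding T_def using eqs[OF s] eqc by auto
    show ?thesis
      unfolding step[of L] step[of L'] SS[symmetric] TT[symmetric] eqs[OF s] eqc[OF \<sigma>] ..
  qed
qed

text \<open>\<open>lab t\<close> is the labelling \<open>T\<^sup>t\<close> for finite \<open>t\<close>; the recursion is expressed by \<open>lab_unfold\<close>.\<close>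

definition lab :: "(nat list \<rightharpoonup> bool) \<Rightarrow> (nat list \<rightharpoonup> bool)" where
  "lab t \<sigma> = wfrec lab_order (\<lambda>F (t, \<sigma>). lab_step (\<lambda>s \<rho>. F (s, \<rho>)) t \<sigma>) (t, \<sigma>)"

lemma lab_unfold: "lab t \<sigma> = lab_step lab t \<sigma>"
proof -
  have "lab t \<sigma> = lab_step (\<lambda>s \<rho>. cut (\<lambda>(t, \<sigma>). lab t \<sigma>) lab_order (t, \<sigma>) (s, \<rho>)) t \<sigma>"
    unfolding lab_def by (subst wfrec[OF wf_lab_order]) (simp add: case_prod_beta')
  also have "\<dots> = lab_step lab t \<sigma>"
    by (rule lab_step_cong) (simp add: cut_apply)
  finally show ?thesis .
qed

lemma lab_empty: "lab Map.empty \<sigma> = None"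
  by (simp add: lab_unfold lab_step_def)

lemma lab_leaf: "t \<in> fin_strings \<Longrightarrow> \<sigma> \<in> leaves \<Longrightarrow> lab t \<sigma> = t \<sigma>"
  by (auto simp: lab_unfold lab_step_def tree_def leaves_def dest: node_nonempty)

text \<open>The labelling \<open>T\<^sup>t\<close> for all \<open>t \<in> 2\<^bsup>\<le>L\<^esup>\<close>, finite or infinite.\<close>

definition labelling :: "(nat list \<rightharpoonup> bool) \<Rightarrow> (nat list \<rightharpoonup> bool)" where
  "labelling t =
    (if t \<in> fin_strings then lab t
     else (\<lambda>\<sigma>. if full t \<sigma> False then Some False else if full t \<sigma> True then Some True else None))"

definition le_star :: "(nat list \<rightharpoonup> bool) \<Rightarrow> (nat list \<rightharpoonup> bool) \<Rightarrow> bool" where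
  "le_star s t \<longleftrightarrow> labelling s |` nodes_below astar \<subseteq>\<^sub>m labelling t |` nodes_below astar"

definition prec_star :: "(nat list \<rightharpoonup> bool) \<Rightarrow> (nat list \<rightharpoonup> bool) \<Rightarrow> bool" where
  "prec_star s t \<longleftrightarrow> le_star s t \<and> s \<noteq> t"

definition k_fin :: "(nat list \<rightharpoonup> bool) \<Rightarrow> nat \<Rightarrow> nat" where
  "k_fin t m = (LEAST k. \<not> (\<exists>a. labelling t [m, k, a] = Some True))"

lemma zero_below_astar: "least_elt \<in> underS R astar"
proof -
  obtain b c where b: "imm_succ R b c" and c: "is_top R c"
    using succ_succ by (auto simp: succ_of_succ_def)
  have ast: "astar = b"
    unfolding astar_def using b c imm_succ_unique is_top_unique by blast
  have bF: "b \<in> Field R" using b by (auto simp: imm_succ_def Field_def)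
  have z: "least_elt \<in> Field R" "\<And>a. a \<in> Field R \<Longrightarrow> (least_elt, a) \<in> R"
    unfolding least_elt_def
    using wo_rel.minim_in[OF wo_rel, of "Field R"] wo_rel.minim_least[OF wo_rel, of "Field R"] bF
    by auto
  have "least_elt \<noteq> b"
  proof
    assume eq: "least_elt = b"
    have "Field R \<subseteq> {b, c}"
    proof
      fix a assume a: "a \<in> Field R"
      then have "(b, a) \<in> R" "(a, c) \<in> R" using z eq c by (auto simp: is_top_def)
      then show "a \<in> {b, c}" using b by (auto simp: imm_succ_def)
    qed
    moreover from ge3 obtain f where "embed (natLeq_on 3) R f"
      by (auto simp: ordLeq_def)
    then have "inj_on f {..<3}" "f ` {..<3} \<subseteq> Field R"
      using embed_inj_on[OF natLeq_on_Well_order, of 3 R f] embed_Field[of "natLeq_on 3" R f]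
      by (auto simp: Field_natLeq_on lessThan_def natLeq_on_Well_order)
    ultimately have "card {..<3::nat} \<le> card {b, c}"
      by (intro card_inj_on_le[of f]) auto
    also have "card {b, c} \<le> 2" by (simp add: card_insert_if)
    finally show False by simp
  qed
  then show ?thesis using z bF ast by (simp add: underS_iff)
qed

lemma prec_star_prec:
  assumes "s \<in> fin_strings" "t \<in> fin_strings" "prec_star s t"
  shows "prec s t"
proof -
  have "s \<subseteq>\<^sub>m t" unfolding map_le_def
  proof
    fix \<sigma> assume "\<sigma> \<in> dom s"
    then obtain i where i: "s \<sigma> = Some i" by auto
    have "Field (lo least_elt) = leaves"
    proof -
      have "least_elt \<in> Field R"
        using zero_below_astar by (auto simp: underS_iff intro: FieldI1)
      then show ?thesis using orders by (simp add: node_orders_def leaves_def)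
    qed
    then have L: "\<sigma> \<in> leaves"
      using assms(1) \<open>\<sigma> \<in> dom s\<close> by (auto simp: fin_strings_def ofilter_def)
    then have N: "\<sigma> \<in> nodes_below astar"
      using zero_below_astar by (auto simp: nodes_below_def leaves_def)
    have "(labelling s |` nodes_below astar) \<sigma> = Some i"
      using L N i assms(1) by (simp add: labelling_def lab_leaf)
    then have "(labelling t |` nodes_below astar) \<sigma> = Some i"
      using assms(3) unfolding prec_star_def le_star_def map_le_def
      by (metis domI)
    then show "s \<sigma> = t \<sigma>"
      using L N i assms(2) by (simp add: labelling_def lab_leaf)
  qed
  then show ?thesis using assms(3) by (simp add: prec_star_def)
qed

lemma longest_prec_star:
  assumes "t \<in> fin_strings" "t \<noteq> Map.empty"
  shows "card (dom (longest {s \<in> fin_strings. prec_star s t})) < card (dom t)"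
proof -
  let ?S = "{s \<in> fin_strings. prec_star s t}"
  have "?S \<subseteq> {s. s \<subseteq>\<^sub>m t}" using prec_star_prec assms by auto
  then have "finite ?S"
    using finite_submaps[of t] assms by (auto simp: fin_strings_def intro: finite_subset)
  moreover have "Map.empty \<in> ?S"
    using assms by (auto simp: fin_strings_def ofilter_def prec_star_def le_star_def labelling_def
        lab_empty map_le_def)
  ultimately have "longest ?S \<in> ?S" by (intro longest_in) auto
  then have "prec (longest ?S) t" using prec_star_prec assms by auto
  then show ?thesis using assms card_dom_less by (auto simp: fin_strings_def)
qed

function n_fin :: "(nat list \<rightharpoonup> bool) \<Rightarrow> nat" where
  "n_fin t =
    (if t \<notin> fin_strings \<or> t = Map.empty then 0
     else let s = longest {s \<in> fin_strings. prec_star s t}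
          in if \<exists>m a. m < n_fin s \<and> labelling t [m, k_fin s m, a] = Some True
             then LEAST m. m < n_fin s \<and> (\<exists>a. labelling t [m, k_fin s m, a] = Some True)
             else n_fin s + 1)"
  by auto
termination
  by (relation "Wellfounded.measure (\<lambda>t. card (dom t))") (auto simp: longest_prec_star)

declare n_fin.simps [simp del]

text \<open>\<open>n_val t\<close> and \<open>k_val t\<close> are \<open>n\<^sup>t\<close> and \<open>k\<^sup>t\<close> for all \<open>t \<in> 2\<^bsup>\<le>L\<^esup>\<close>.\<close>

definition n_val :: "(nat list \<rightharpoonup> bool) \<Rightarrow> enat" where
  "n_val t =
    (if t \<in> fin_strings then enat (n_fin t)
     else Sup {enat j |j. \<forall>m<j. labelling t [m] = Some False})"

definition k_val :: "(nat list \<rightharpoonup> bool) \<Rightarrow> nat \<Rightarrow> nat" where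
  "k_val t m =
    (if t \<in> fin_strings then k_fin t m else LEAST k. labelling t [m, k] = Some True)"

definition sq_le :: "nat \<Rightarrow> (nat list \<rightharpoonup> bool) \<Rightarrow> (nat list \<rightharpoonup> bool) \<Rightarrow> bool" where
  "sq_le m r s \<longleftrightarrow> le_star r s \<and> enat m \<le> min (n_val r) (n_val s) \<and> (\<forall>l<m. k_val r l = k_val s l)"

text \<open>
  The minimum of \<open>|s|\<close> over \<open>s \<in> 2\<^bsup>\<le>L\<^esup>\<close> with \<open>s \<sqsubseteq>\<^sub>m t\<close> is attained at a finite \<open>s\<close>, so the
  infinite \<open>s\<close>, for which \<open>|s| = \<omega>\<close>, are left out.
\<close>

definition c_val :: "(nat list \<rightharpoonup> bool) \<Rightarrow> nat \<Rightarrow> nat" where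
  "c_val t m = (LEAST j. \<exists>s \<in> fin_strings. card (dom s) = j \<and> sq_le m s t)"

definition codes :: "nat \<Rightarrow> bool list \<Rightarrow> bool" where
  "codes j \<zeta> \<longleftrightarrow> (\<forall>i < length \<zeta>. \<zeta> ! i = M j i)"

definition X_top :: "((nat list \<Rightarrow> bool) \<times> (nat \<Rightarrow> bool)) topology" where
  "X_top = prod_topology (cantor_topology leaves) (cantor_topology UNIV)"

text \<open>
  The points of \<open>2\<^bsup>L\<^esup>\<close> are represented in the product topology by extensional functions;
  \<open>as_map\<close> turns them into maps with domain \<open>L\<close>.
\<close>

definition as_map :: "(nat list \<Rightarrow> bool) \<Rightarrow> (nat list \<rightharpoonup> bool)" where
  "as_map x = (Some \<circ> x) |` leaves"

definition Y :: "((nat list \<Rightarrow> bool) \<times> (nat \<Rightarrow> bool)) set" where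
  "Y = {(x, y). (x, y) \<in> topspace X_top \<and>
    (\<forall>m. enat m < n_val (as_map x) \<longrightarrow>
      codes (k_val (as_map x) m) (map y [0..<c_val (as_map x) m + 1]))}"

definition Y_top :: "((nat list \<Rightarrow> bool) \<times> (nat \<Rightarrow> bool)) topology" where
  "Y_top = subtopology X_top Y"

definition H :: "((nat list \<Rightarrow> bool) \<times> (nat \<Rightarrow> bool)) rel" where
  "H = {((x, y), (x', y')). (x, y) \<in> Y \<and> (x', y') \<in> Y \<and> x = x' \<and>
    (\<exists>j. n_val (as_map x) = enat j \<and>
      {i. y i \<noteq> y' i} = {c_val (as_map x) j} \<and> \<not> y (c_val (as_map x) j))}"

end

section \<open>The Borel hierarchy and colourings\<close>

text \<open>
  \<open>Sigma0 X r\<close> is the class of \<open>\<Sigma>\<^sup>0\<close> subsets of \<open>X\<close> at the level given by the order type of the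
  well-order \<open>r\<close>. The smaller ordinals are the types of the proper initial segments of \<open>r\<close>.
  Level \<open>0\<close> is empty.
\<close>

inductive Sigma0 :: "'a topology \<Rightarrow> 'b rel \<Rightarrow> 'a set \<Rightarrow> bool" for X where
  open_set: "card (Field r) = 1 \<Longrightarrow> openin X A \<Longrightarrow> Sigma0 X r A"
| union: "(\<And>i::nat. b i \<in> Field r \<and> Sigma0 X (Restr r (underS r (b i))) (A i)) \<Longrightarrow>
    Sigma0 X r (\<Union>i. topspace X - A i)"

definition countable_Sigma0_colouring ::
  "'a topology \<Rightarrow> 'a rel \<Rightarrow> 'b rel \<Rightarrow> 'a set set \<Rightarrow> bool" where
  "countable_Sigma0_colouring X E r P \<longleftrightarrow> partition_on (topspace X) P \<and> countable P \<and>
    (\<forall>A \<in> P. Sigma0 X r A) \<and> (\<forall>A \<in> P. \<forall>(p, q) \<in> E. \<not> (p \<in> A \<and> q \<in> A))"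

end

theory Submission
  imports Defs
begin

text \<open>
  A set of level \<open>\<alpha>\<close> is a union of complements of sets of level at most \<open>\<alpha> - 1\<close>, so it suffices to
  find a point of \<open>Y\<close> in all of countably many such sets \<open>B\<close>, given that no edge lies outside
  any of them.

  Force with finite coherent partial labellings of the nodes of rank at most \<open>\<alpha>\<^sup>*\<close>, together with
  finitely many bits of \<open>y\<close>. As in Steel forcing, for generic points membership in a set of level
  \<open>b < \<alpha>\<close> is decided by the labels of rank less than \<open>b\<close>, and deciding it does not require any node
  of rank \<open>\<alpha>\<^sup>*\<close> to get the label 1. Suppose that \<open>k\<^sup>x(l)\<close> is decided for \<open>l < m\<close> and \<open>c\<^sup>x(l)\<close> for \<open>l \<le> m\<close>.
  Some extension forces the point into \<open>B\<close>: otherwise take a generic point \<open>(x, y)\<close> with \<open>n\<^sup>x = m\<close>;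
  flipping \<open>y\<close> at \<open>c\<^sup>x(m)\<close> gives an edge outside \<open>B\<close>. Then fix \<open>k\<^sup>x(m)\<close>, coding \<open>y\<close> up to \<open>c\<^sup>x(m)\<close>, and continue
  with the next set. In the limit \<open>n\<^sup>x = \<omega>\<close> and the point lies in all the sets.

  That finite information about \<open>x\<close> determines \<open>c\<^sup>x(m)\<close> rests on the theory of true stages: the
  labellings of infinitely many initial segments \<open>s\<close> of \<open>x\<close> are restrictions of the labelling of \<open>x\<close>
  below any given rank, and they exhaust it.
\<close>

text \<open>The two demands on a point, genericity and membership in \<open>Y\<close>, pull against
  each other: each label 0 at a node \<open>[m]\<close> makes \<open>Y\<close> prescribe bits of y.
  Such a label arises only from a label 1 at some \<open>[m, k]\<close>, a promise. Conditions leave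
  the nodes \<open>[m]\<close> unlabelled, and dense sets must be met without new promises. So a
  generic point over a state with m promises has n^x = m, and both it and its flip at c^x(m) lie in
  \<open>Y\<close>. Deciding a set in this way adds labels of rank below \<open>b\<close> only,
  which avoids the nodes \<open>[m, k]\<close> as long as \<open>b\<close> is at most
  \<open>astar\<close>. At the next level this fails, and the two ends of an edge take over.

  A state fixes exactly the bits of y below c^x(m), so flipping the bit c^x(m) respects it. Hence
  the bits fixed on entering a set have to lie below c^x(m + 1). This is why promises need
  arbitrarily large codes: there are only finitely many strings of bounded length, so a large k^x(m)
  is not guessed by any short string. Density of \<open>M\<close> supplies such codes, because
  Cantor space has no isolated points.\<close>

type_synonym condition = "(nat list \<rightharpoonup> bool) \<times> (nat \<rightharpoonup> bool)"
type_synonym point = "(nat list \<Rightarrow> bool) \<times> (nat \<Rightarrow> bool)"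

context alpha_tree
begin

section \<open>The well-order of ranks and the tree\<close>

lemma R_refl: "a \<in> Field R \<Longrightarrow> (a, a) \<in> R"
  using wo_rel.REFL[OF wo_rel] by (auto simp: refl_on_def)

lemma R_trans: "(a, b) \<in> R \<Longrightarrow> (b, c) \<in> R \<Longrightarrow> (a, c) \<in> R"
  using wo_rel.TRANS[OF wo_rel] by (auto elim: transE)

lemma R_antisym: "(a, b) \<in> R \<Longrightarrow> (b, a) \<in> R \<Longrightarrow> a = b"
  using wo_rel.ANTISYM[OF wo_rel] by (auto dest: antisymD)

lemma R_total: "a \<in> Field R \<Longrightarrow> b \<in> Field R \<Longrightarrow> (a, b) \<in> R \<or> b \<in> underS R a"
  using wo_rel.TOTALS[OF wo_rel] R_refl by (auto simp: underS_iff)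

lemma underS_Field1: "a \<in> underS R b \<Longrightarrow> a \<in> Field R"
  by (auto simp: underS_iff intro: FieldI1)

lemma underS_Field2: "a \<in> underS R b \<Longrightarrow> b \<in> Field R"
  by (auto simp: underS_iff intro: FieldI2)

lemma lt_le_trans: "a \<in> underS R b \<Longrightarrow> (b, c) \<in> R \<Longrightarrow> a \<in> underS R c"
  unfolding underS_iff using R_trans R_antisym by blast

lemma le_lt_trans: "(a, b) \<in> R \<Longrightarrow> b \<in> underS R c \<Longrightarrow> a \<in> underS R c"
  unfolding underS_iff using R_trans R_antisym by blast

lemma lt_trans: "a \<in> underS R b \<Longrightarrow> b \<in> underS R c \<Longrightarrow> a \<in> underS R c"
  using le_lt_trans by (auto simp: underS_iff)

lemma lt_not_le: "a \<in> underS R b \<Longrightarrow> (b, a) \<notin> R"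
  unfolding underS_iff using R_antisym by blast

lemma lt_imp_le: "a \<in> underS R b \<Longrightarrow> (a, b) \<in> R"
  by (simp add: underS_iff)

lemma le_cases: "(a, b) \<in> R \<Longrightarrow> a = b \<or> a \<in> underS R b"
  by (auto simp: underS_iff)

lemma R_induct [case_names step]:
  assumes "\<And>b. (\<And>a. a \<in> underS R b \<Longrightarrow> P a) \<Longrightarrow> P b"
  shows "P b"
  using wf_R by (induction b rule: wf_induct_rule) (use assms in \<open>auto simp: underS_iff\<close>)

definition top_elt :: nat where
  "top_elt = (THE c. is_top R c)"

lemma top_elt: "is_top R top_elt" and imm_succ_astar: "imm_succ R astar top_elt"
proof -
  obtain b c where bc: "imm_succ R b c" "is_top R c"
    using succ_succ by (auto simp: succ_of_succ_def)
  have "top_elt = c" unfolding top_elt_def using bc is_top_unique by blast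
  moreover have "astar = b" unfolding astar_def using bc imm_succ_unique is_top_unique by blast
  ultimately show "is_top R top_elt" "imm_succ R astar top_elt" using bc by auto
qed

lemma top_Field: "top_elt \<in> Field R"
  using top_elt by (simp add: is_top_def)

lemma le_top: "a \<in> Field R \<Longrightarrow> (a, top_elt) \<in> R"
  using top_elt by (simp add: is_top_def)

lemma astar_lt_top: "astar \<in> underS R top_elt"
  using imm_succ_astar by (simp add: underS_iff imm_succ_def)

lemma astar_Field: "astar \<in> Field R"
  using astar_lt_top underS_Field1 by blast

lemma imm_succ_lt: "imm_succ R b c \<Longrightarrow> b \<in> underS R c"
  by (simp add: imm_succ_def underS_iff)

lemma imm_succ_le: "imm_succ R b c \<Longrightarrow> a \<in> underS R c \<Longrightarrow> (a, b) \<in> R"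
  unfolding imm_succ_def
  by (metis FieldI1 R_total lt_imp_le underS_Field1 underS_iff)

lemma lt_top_iff: "a \<in> underS R top_elt \<longleftrightarrow> (a, astar) \<in> R"
  using imm_succ_le[OF imm_succ_astar] le_lt_trans[OF _ astar_lt_top] by blast

lemma least_le: "a \<in> Field R \<Longrightarrow> (least_elt, a) \<in> R"
  unfolding least_elt_def using wo_rel.minim_least[OF wo_rel, of "Field R" a] by auto

lemma least_Field: "least_elt \<in> Field R"
  using zero_below_astar underS_Field1 by blast

lemma not_lt_least: "a \<notin> underS R least_elt"
  using least_le lt_not_le underS_Field1 by blast

lemma least_lt: "a \<in> Field R \<Longrightarrow> a \<noteq> least_elt \<Longrightarrow> least_elt \<in> underS R a"
  using least_le by (auto simp: underS_iff)

lemma least_lt_top: "least_elt \<in> underS R top_elt"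
  using zero_below_astar astar_lt_top lt_trans by blast

lemma limit_point_fs: "limit_point R d \<Longrightarrow> fs d k \<in> underS R d"
  using fund by (simp add: fundamental_sequences_def)

lemma node_Field: "node R fs \<sigma> b \<Longrightarrow> b \<in> Field R"
  by (erule node.cases)
    (auto simp: is_top_def imm_succ_def dest: limit_point_fs underS_Field1 intro: FieldI1)

lemma node_child_cases:
  assumes "node R fs (\<sigma> @ [k]) c" "\<sigma> \<noteq> []"
  obtains b where "node R fs \<sigma> b" "imm_succ R c b"
    | b where "node R fs \<sigma> b" "limit_point R b" "c = fs b k"
  using assms(1) by (cases rule: node.cases) (use assms(2) that in auto)

lemma node_parent:
  assumes "node R fs (\<sigma> @ [k]) c" "\<sigma> \<noteq> []"
  shows "\<exists>b. node R fs \<sigma> b \<and> c \<in> underS R b"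
  using assms limit_point_fs imm_succ_lt by (metis node_child_cases)

lemma children_node:
  assumes "node R fs \<sigma> b" "b \<noteq> least_elt"
  shows "\<exists>c\<in>underS R b. node R fs (\<sigma> @ [k]) c"
  using children_below[OF assms] by (auto simp: nodes_below_def)

lemma node_child_rank:
  assumes "node R fs \<sigma> b" "node R fs (\<sigma> @ [k]) c" shows "c \<in> underS R b"
  using assms node_parent node_nonempty node_unique by metis

lemma node_tree: "node R fs \<sigma> b \<Longrightarrow> \<sigma> \<in> tree"
  by (auto simp: tree_def)

lemma node_leaves: "node R fs \<sigma> b \<Longrightarrow> \<sigma> \<in> leaves \<longleftrightarrow> b = least_elt"
  using node_unique by (auto simp: leaves_def)

lemma node_single: "node R fs [k] c \<longleftrightarrow> c = top_elt"
proof
  assume "node R fs [k] c"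
  then show "c = top_elt"
    by (cases rule: node.cases) (use top_elt is_top_unique node_nonempty in auto)
qed (use top_elt node.root_child in blast)

lemma node_pair: "node R fs [m, k] c \<longleftrightarrow> c = astar"
proof
  have *: "node R fs [m, k] astar"
    using node.succ_child[of R fs "[m]" top_elt astar k] imm_succ_astar node_single by simp
  show "node R fs [m, k] c" if "c = astar" using that * by simp
  show "c = astar" if "node R fs [m, k] c" using that * node_unique by blast
qed

lemma node_triple_below: "\<exists>c\<in>underS R astar. node R fs [m, k, a] c"
  using children_node[of "[m, k]" astar a] node_pair zero_below_astar by (auto simp: underS_iff)

text \<open>An isomorphism onto the natural numbers turns comparisons in \<open>lo b\<close> into
  arithmetic and makes initial segments visibly finite.\<close>

definition pos :: "nat \<Rightarrow> nat list \<Rightarrow> nat" where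
  "pos b = (SOME f. iso (lo b) natLeq f)"

lemma iso_pos:
  assumes "b \<in> Field R"
  shows "iso (lo b) natLeq (pos b)"
proof -
  have "\<exists>f. iso (lo b) natLeq f" using orders assms by (auto simp: node_orders_def ordIso_def)
  then show ?thesis unfolding pos_def by (rule someI_ex)
qed

lemma lo_Well_order: "b \<in> Field R \<Longrightarrow> Well_order (lo b)"
  using orders by (auto simp: node_orders_def ordIso_def)

lemma lo_wo_rel: "b \<in> Field R \<Longrightarrow> wo_rel (lo b)"
  using lo_Well_order by (simp add: wo_rel_def)

lemma Field_lo: "b \<in> Field R \<Longrightarrow> Field (lo b) = {\<sigma>. node R fs \<sigma> b}"
  using orders by (simp add: node_orders_def)

lemma bij_pos: "b \<in> Field R \<Longrightarrow> bij_betw (pos b) {\<sigma>. node R fs \<sigma> b} UNIV"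
  using iso_pos[of b] by (simp add: iso_iff2 Field_lo Field_natLeq)

lemma pos_inj: "node R fs \<sigma> b \<Longrightarrow> node R fs \<tau> b \<Longrightarrow> pos b \<sigma> = pos b \<tau> \<longleftrightarrow> \<sigma> = \<tau>"
  using bij_pos[of b] node_Field by (auto simp: bij_betw_def inj_on_def)

lemma pos_surj:
  assumes "b \<in> Field R"
  obtains \<sigma> where "node R fs \<sigma> b" "pos b \<sigma> = n"
proof -
  have "n \<in> pos b ` {\<sigma>. node R fs \<sigma> b}"
    using bij_pos[OF assms] by (simp add: bij_betw_def)
  then show ?thesis using that by blast
qed

lemma lo_iff:
  assumes "b \<in> Field R"
  shows "(\<sigma>, \<tau>) \<in> lo b \<longleftrightarrow> node R fs \<sigma> b \<and> node R fs \<tau> b \<and> pos b \<sigma> \<le> pos b \<tau>"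
proof -
  have "(\<sigma>, \<tau>) \<in> lo b \<longrightarrow> \<sigma> \<in> Field (lo b) \<and> \<tau> \<in> Field (lo b)"
    by (blast intro: FieldI1 FieldI2)
  then show ?thesis
    using iso_pos[OF assms] unfolding iso_iff2 natLeq_def Field_lo[OF assms] by blast
qed

lemma node_less_iff:
  assumes "b \<in> Field R"
  shows "node_less b \<sigma> \<tau> \<longleftrightarrow> node R fs \<sigma> b \<and> node R fs \<tau> b \<and> pos b \<sigma> < pos b \<tau>"
  unfolding underS_iff lo_iff[OF assms] using pos_inj[of \<sigma> b \<tau>] by (auto simp: order_less_le)

lemma finite_pos_le: "b \<in> Field R \<Longrightarrow> finite {\<sigma>. node R fs \<sigma> b \<and> pos b \<sigma> \<le> n}"
proof -
  assume b: "b \<in> Field R"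
  have "inj_on (pos b) {\<sigma>. node R fs \<sigma> b \<and> pos b \<sigma> \<le> n}"
    using pos_inj by (auto simp: inj_on_def)
  moreover have "pos b ` {\<sigma>. node R fs \<sigma> b \<and> pos b \<sigma> \<le> n} \<subseteq> {..n}" by auto
  ultimately show ?thesis using finite_imageD finite_subset by blast
qed

section \<open>Finite strings\<close>

definition first_leaves :: "nat \<Rightarrow> nat list set" where
  "first_leaves n = {\<sigma> \<in> leaves. pos least_elt \<sigma> < n}"

lemma bij_first_leaves: "bij_betw (pos least_elt) (first_leaves n) {..<n}"
proof -
  have "pos least_elt ` first_leaves n = {..<n}"
  proof
    show "{..<n} \<subseteq> pos least_elt ` first_leaves n"
    proof
      fix j assume "j \<in> {..<n}"
      moreover obtain \<sigma> where "node R fs \<sigma> least_elt" "pos least_elt \<sigma> = j"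
        using pos_surj[OF least_Field] by blast
      ultimately show "j \<in> pos least_elt ` first_leaves n"
        by (auto simp: first_leaves_def leaves_def)
    qed
  qed (auto simp: first_leaves_def)
  moreover have "inj_on (pos least_elt) (first_leaves n)"
    using pos_inj by (auto simp: inj_on_def first_leaves_def leaves_def)
  ultimately show ?thesis by (simp add: bij_betw_def)
qed

lemma card_first_leaves: "card (first_leaves n) = n"
  using bij_betw_same_card[OF bij_first_leaves] by simp

lemma finite_first_leaves: "finite (first_leaves n)"
  using bij_betw_finite[OF bij_first_leaves] by simp

lemma first_leaves_mono: "m \<le> n \<Longrightarrow> first_leaves m \<subseteq> first_leaves n"
  by (auto simp: first_leaves_def)

text \<open>An initial segment of an order of type \<omega> is determined by its size. For the least
  n with \<open>dom t \<subseteq> first_leaves n\<close>, some element of the domain has position at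
  least n - 1, and closure under predecessors pulls in all of \<open>first_leaves n\<close>.\<close>

lemma fin_strings_iff: "t \<in> fin_strings \<longleftrightarrow> dom t = first_leaves (card (dom t))"
proof
  assume t: "t \<in> fin_strings"
  have sub: "dom t \<subseteq> leaves"
    using t Field_lo[OF least_Field] by (auto simp: fin_strings_def ofilter_def leaves_def)
  have closed: "\<sigma> \<in> dom t" if "\<tau> \<in> dom t" "\<sigma> \<in> leaves" "pos least_elt \<sigma> \<le> pos least_elt \<tau>" for \<sigma> \<tau>
    using t that sub lo_iff[OF least_Field, of \<sigma> \<tau>]
    by (auto simp: fin_strings_def ofilter_def under_def leaves_def)
  define n where "n = (LEAST n. dom t \<subseteq> first_leaves n)"
  have fin: "finite (dom t)" using t by (simp add: fin_strings_def)
  have "dom t \<subseteq> first_leaves (Suc (Max (pos least_elt ` dom t)))"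
    using sub fin by (auto simp: first_leaves_def less_Suc_eq_le intro: Max_ge)
  then have n: "dom t \<subseteq> first_leaves n" unfolding n_def by (rule LeastI)
  have "dom t = first_leaves n"
  proof (cases n)
    case 0 then show ?thesis using n by (auto simp: first_leaves_def)
  next
    case (Suc j)
    have "\<not> dom t \<subseteq> first_leaves j"
      using Suc not_less_Least[of j "\<lambda>n. dom t \<subseteq> first_leaves n"] by (auto simp: n_def)
    then obtain \<tau> where "\<tau> \<in> dom t" "\<tau> \<notin> first_leaves j" by blast
    then have "\<tau> \<in> dom t" "j \<le> pos least_elt \<tau>" using sub by (auto simp: first_leaves_def)
    have "\<sigma> \<in> dom t" if "\<sigma> \<in> first_leaves n" for \<sigma>
      using that \<open>j \<le> pos least_elt \<tau>\<close> Suc by (intro closed[OF \<open>\<tau> \<in> dom t\<close>]) (auto simp: first_leaves_def)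
    then have "first_leaves n \<subseteq> dom t" by blast
    then show ?thesis using n by blast
  qed
  then show "dom t = first_leaves (card (dom t))" using card_first_leaves by simp
next
  assume t: "dom t = first_leaves (card (dom t))"
  have "finite (first_leaves (card (dom t)))" by (rule finite_first_leaves)
  then have "finite (dom t)" using t by simp
  moreover have "ofilter (lo least_elt) (first_leaves n)" for n
    using lo_iff[OF least_Field] Field_lo[OF least_Field]
    by (auto simp: ofilter_def first_leaves_def under_def leaves_def)
  ultimately show "t \<in> fin_strings" unfolding fin_strings_def using t by (metis mem_Collect_eq)
qed

lemma fin_strings_finite: "t \<in> fin_strings \<Longrightarrow> finite (dom t)"
  by (simp add: fin_strings_def)

lemma empty_fin_string: "Map.empty \<in> fin_strings"
  by (simp add: fin_strings_def ofilter_def)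

lemma fin_strings_comparable:
  assumes "r \<in> fin_strings" "s \<in> fin_strings" "r \<subseteq>\<^sub>m x" "s \<subseteq>\<^sub>m x" "card (dom r) \<le> card (dom s)"
  shows "r \<subseteq>\<^sub>m s"
  unfolding map_le_def
proof
  fix \<sigma> assume \<sigma>: "\<sigma> \<in> dom r"
  then have "\<sigma> \<in> dom s"
    using assms first_leaves_mono unfolding fin_strings_iff by blast
  then show "r \<sigma> = s \<sigma>" using \<sigma> assms by (simp add: map_le_def)
qed

lemma infinite_leaves: "infinite leaves"
  using bij_betw_finite[OF bij_pos[OF least_Field]] by (simp add: leaves_def)

lemma finite_fin_strings: "finite {t \<in> fin_strings. card (dom t) \<le> n}"
proof (rule finite_subset)
  show "{t \<in> fin_strings. card (dom t) \<le> n} \<subseteq> {t. dom t \<subseteq> first_leaves n \<and> ran t \<subseteq> UNIV}"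
  proof clarsimp
    fix t \<sigma> i assume "t \<in> fin_strings" "card (dom t) \<le> n" "t \<sigma> = Some i"
    then show "\<sigma> \<in> first_leaves n" using first_leaves_mono fin_strings_iff[of t] by blast
  qed
  have fin: "finite {t. dom t = B \<and> ran t \<subseteq> (UNIV :: bool set)}" if "B \<in> Pow (first_leaves n)" for B
    using that finite_first_leaves finite_subset by (intro finite_set_of_finite_maps) auto
  have *: "{t. dom t \<subseteq> first_leaves n \<and> ran t \<subseteq> (UNIV :: bool set)} =
      (\<Union>B\<in>Pow (first_leaves n). {t. dom t = B \<and> ran t \<subseteq> UNIV})" by auto
  show "finite {t. dom t \<subseteq> first_leaves n \<and> ran t \<subseteq> (UNIV :: bool set)}"
    unfolding * by (rule finite_UN_I[OF _ fin]) (use finite_first_leaves in simp_all)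
qed

text \<open>Since the least upper bound is not strict, an immediate successor may share its value
  with its predecessor. No other coincidence is possible.\<close>

lemma a_lub_cases:
  assumes "b \<in> Field R"
  shows "a_lub b = b \<or> imm_succ R (a_lub b) b"
proof -
  define A where "A = Above R (underS R b)"
  have b: "b \<in> A" using assms by (auto simp: A_def Above_def underS_iff)
  have sub: "A \<subseteq> Field R" by (auto simp: A_def Above_def)
  have d: "a_lub b \<in> A" "(a_lub b, b) \<in> R"
    unfolding a_lub_def wo_rel.supr_def[OF wo_rel] A_def[symmetric]
    using wo_rel.minim_in[OF wo_rel sub] wo_rel.minim_least[OF wo_rel sub] b by auto
  show ?thesis
  proof (cases "a_lub b = b")
    case False
    have "e = a_lub b \<or> e = b" if "(a_lub b, e) \<in> R" "(e, b) \<in> R" for e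
      using d(1) that R_antisym by (auto simp: A_def Above_def underS_iff)
    then show ?thesis using d False by (auto simp: imm_succ_def)
  qed simp
qed

lemma imm_succ_unique2: "imm_succ R b c \<Longrightarrow> imm_succ R b c' \<Longrightarrow> c = c'"
  unfolding imm_succ_def by (metis FieldI2 R_total lt_imp_le)

text \<open>A number is the value of \<open>a_lub\<close> at no more than two ranks: itself and its
  immediate successor. This bounds the ranks that can carry labels at a given stage.\<close>

lemma finite_a_lub: "finite {b \<in> Field R. a_lub b < n}"
proof -
  have "{b \<in> Field R. a_lub b < n} \<subseteq> (\<Union>d<n. {d} \<union> {c. imm_succ R d c})"
    using a_lub_cases by force
  moreover have "finite {c. imm_succ R d c}" for d
  proof (cases "\<exists>c. imm_succ R d c")
    case True
    then obtain c where "imm_succ R d c" by blast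
    then have "{c. imm_succ R d c} = {c}" using imm_succ_unique2 by auto
    then show ?thesis by simp
  qed simp
  ultimately show ?thesis by (auto intro: finite_subset)
qed

section \<open>The finite labellings\<close>

text \<open>The inclusions of restricted labellings are split by rank here, so that inductions can
  treat one rank at a time; \<open>map_le_agree\<close> gives the translation.\<close>

definition agree_at :: "nat \<Rightarrow> (nat list \<rightharpoonup> bool) \<Rightarrow> (nat list \<rightharpoonup> bool) \<Rightarrow> bool" where
  "agree_at c K L \<longleftrightarrow> (\<forall>\<sigma> i. node R fs \<sigma> c \<longrightarrow> K \<sigma> = Some i \<longrightarrow> L \<sigma> = Some i)"

definition agree :: "nat \<Rightarrow> (nat list \<rightharpoonup> bool) \<Rightarrow> (nat list \<rightharpoonup> bool) \<Rightarrow> bool" where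
  "agree b K L \<longleftrightarrow> (\<forall>c\<in>underS R b. agree_at c K L)"

lemma map_le_agree: "K |` nodes_below b \<subseteq>\<^sub>m L |` nodes_below b \<longleftrightarrow> agree b K L"
proof
  assume le: "K |` nodes_below b \<subseteq>\<^sub>m L |` nodes_below b"
  show "agree b K L"
    unfolding agree_def agree_at_def
  proof (intro ballI allI impI)
    fix c \<sigma> i assume "c \<in> underS R b" "node R fs \<sigma> c" "K \<sigma> = Some i"
    moreover from this have "\<sigma> \<in> nodes_below b" by (auto simp: nodes_below_def)
    ultimately show "L \<sigma> = Some i"
      using le unfolding map_le_def by (metis domI restrict_in)
  qed
next
  assume "agree b K L"
  then show "K |` nodes_below b \<subseteq>\<^sub>m L |` nodes_below b"
    by (fastforce simp: map_le_def restrict_map_def agree_def agree_at_def nodes_below_def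
        split: if_splits)
qed

lemma agree_trans: "agree b J K \<Longrightarrow> agree b K L \<Longrightarrow> agree b J L"
  unfolding agree_def agree_at_def by blast

lemma agree_below: "agree b K L \<Longrightarrow> (c, b) \<in> R \<Longrightarrow> agree c K L"
  unfolding agree_def using lt_le_trans by blast

lemma agreeD: "agree b K L \<Longrightarrow> \<sigma> \<in> nodes_below b \<Longrightarrow> K \<sigma> = Some i \<Longrightarrow> L \<sigma> = Some i"
  unfolding agree_def agree_at_def nodes_below_def by blast

lemma agree_atD: "agree_at c K L \<Longrightarrow> node R fs \<sigma> c \<Longrightarrow> K \<sigma> = Some i \<Longrightarrow> L \<sigma> = Some i"
  unfolding agree_at_def by blast

lemma agree_agree_at: "agree b K L \<Longrightarrow> c \<in> underS R b \<Longrightarrow> agree_at c K L"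
  unfolding agree_def by blast

text \<open>The local rule for \<open>T\<^sup>x\<close>, adapted to partial labellings: a label 0
  needs its witness inside the domain, whereas a label 1 only must not be refuted there. On a total
  labelling this is the full rule.\<close>

definition coherent :: "(nat list \<rightharpoonup> bool) \<Rightarrow> bool" where
  "coherent L \<longleftrightarrow> (\<forall>\<sigma> b. node R fs \<sigma> b \<and> b \<noteq> least_elt \<longrightarrow>
    (L \<sigma> = Some True \<longrightarrow> (\<forall>k. L (\<sigma> @ [k]) \<noteq> Some True)) \<and>
    (L \<sigma> = Some False \<longrightarrow> (\<exists>k. L (\<sigma> @ [k]) = Some True)))"

lemma coherent_True:
  "coherent L \<Longrightarrow> node R fs \<sigma> b \<Longrightarrow> b \<noteq> least_elt \<Longrightarrow> L \<sigma> = Some True \<Longrightarrow> L (\<sigma> @ [k]) \<noteq> Some True"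
  unfolding coherent_def by blast

lemma coherent_False:
  "coherent L \<Longrightarrow> node R fs \<sigma> b \<Longrightarrow> b \<noteq> least_elt \<Longrightarrow> L \<sigma> = Some False \<Longrightarrow>
    \<exists>k. L (\<sigma> @ [k]) = Some True"
  unfolding coherent_def by blast

definition preds :: "nat \<Rightarrow> (nat list \<rightharpoonup> bool) \<Rightarrow> (nat list \<rightharpoonup> bool) set" where
  "preds b t = {s \<in> fin_strings. prec s t \<and> agree b (lab s) (lab t)}"

lemma finite_preds: "t \<in> fin_strings \<Longrightarrow> finite (preds b t)"
  using finite_submaps[of t] fin_strings_finite
  by (auto simp: preds_def intro: finite_subset)

lemma longest_max:
  assumes "finite S" "s \<in> S" shows "card (dom s) \<le> card (dom (longest S))"
proof -
  let ?f = "\<lambda>s. card (dom s)"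
  have "\<forall>y. y \<in> S \<longrightarrow> ?f y \<le> Max (?f ` S)" using assms by auto
  then have "\<forall>y. y \<in> S \<longrightarrow> ?f y < Suc (Max (?f ` S))" by (simp add: less_Suc_eq_le)
  from arg_max_nat_le[where P="\<lambda>s. s \<in> S" and f="?f", OF assms(2) this]
  show ?thesis by (simp add: longest_def arg_max_on_def)
qed

lemma longest_preds:
  assumes "t \<in> fin_strings" "preds b t \<noteq> {}"
  shows "longest (preds b t) \<in> preds b t"
  using assms finite_preds longest_in by blast

definition next_node :: "nat \<Rightarrow> (nat list \<rightharpoonup> bool) \<Rightarrow> nat list" where
  "next_node b t = wo_rel.minim (lo b)
    {\<tau>. node R fs \<tau> b \<and> (lab (longest (preds b t)) \<tau> = None \<or>
      lab (longest (preds b t)) \<tau> = Some True \<and> (\<exists>k. lab t (\<tau> @ [k]) = Some True))}"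

lemma lab_node:
  assumes "t \<in> fin_strings" "node R fs \<sigma> b" "b \<noteq> least_elt"
  shows "lab t \<sigma> =
    (if card (preds b t) \<le> a_lub b then None
     else if node_less b \<sigma> (next_node b t) then lab (longest (preds b t)) \<sigma>
     else if \<sigma> = next_node b t then Some (\<not> (\<exists>k. lab t (\<sigma> @ [k]) = Some True))
     else None)"
proof (cases "t = Map.empty")
  case True
  then have "preds b t = {}" by (auto simp: preds_def map_le_def dom_def)
  then show ?thesis using True by (simp add: lab_empty)
next
  case False
  moreover have "\<sigma> \<in> tree - {[]}" "\<sigma> \<notin> leaves"
    using assms node_tree node_nonempty node_leaves by auto
  ultimately show ?thesis
    using assms(1) rk_eq[OF assms(2)]
    by (subst lab_unfold) (simp add: lab_step_def preds_def map_le_agree Let_def next_node_def)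
qed

lemma lab_none:
  assumes "t \<in> fin_strings" "node R fs \<sigma> b" "b \<noteq> least_elt" "card (preds b t) \<le> a_lub b"
  shows "lab t \<sigma> = None"
  using lab_node[OF assms(1-3)] assms(4) by simp

text \<open>Nothing after the changed node is labelled, and only finitely many nodes come before
  it.\<close>

lemma finite_lab_at:
  assumes "t \<in> fin_strings" "b \<in> Field R"
  shows "finite {\<sigma>. node R fs \<sigma> b \<and> lab t \<sigma> \<noteq> None}"
proof (cases "b = least_elt")
  case True
  then have "{\<sigma>. node R fs \<sigma> b \<and> lab t \<sigma> \<noteq> None} \<subseteq> dom t"
    using assms lab_leaf by (auto simp: leaves_def)
  then show ?thesis using fin_strings_finite[OF assms(1)] finite_subset by blast
next
  case False
  define \<tau> where "\<tau> = next_node b t"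
  have "{\<sigma>. node R fs \<sigma> b \<and> lab t \<sigma> \<noteq> None}
      \<subseteq> insert \<tau> {\<sigma>. node R fs \<sigma> b \<and> pos b \<sigma> \<le> pos b \<tau>}"
  proof
    fix \<sigma> assume \<sigma>: "\<sigma> \<in> {\<sigma>. node R fs \<sigma> b \<and> lab t \<sigma> \<noteq> None}"
    then have "node_less b \<sigma> \<tau> \<or> \<sigma> = \<tau>"
      using lab_node[OF assms(1) _ False, of \<sigma>] unfolding \<tau>_def[symmetric] by (auto split: if_splits)
    then show "\<sigma> \<in> insert \<tau> {\<sigma>. node R fs \<sigma> b \<and> pos b \<sigma> \<le> pos b \<tau>}"
      using \<sigma> node_less_iff[OF assms(2)] by auto
  qed
  then show ?thesis using finite_pos_le[OF assms(2)] finite_subset by blast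
qed

text \<open>The defining property of the node \<open>\<tau>\<close> in the recursion for \<open>T\<^sup>t\<close>, where \<open>u\<close> is the longest predecessor
  of \<open>t\<close>.\<close>

definition change_at ::
  "nat \<Rightarrow> (nat list \<rightharpoonup> bool) \<Rightarrow> (nat list \<rightharpoonup> bool) \<Rightarrow> nat list \<Rightarrow> bool" where
  "change_at b u t \<tau> \<longleftrightarrow> node R fs \<tau> b \<and>
    (lab u \<tau> = None \<or> lab u \<tau> = Some True \<and> (\<exists>k. lab t (\<tau> @ [k]) = Some True)) \<and>
    (\<forall>\<rho>. node R fs \<rho> b \<longrightarrow> pos b \<rho> < pos b \<tau> \<longrightarrow>
      lab u \<rho> \<noteq> None \<and> (lab u \<rho> = Some True \<longrightarrow> (\<forall>k. lab t (\<rho> @ [k]) \<noteq> Some True)) \<and>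
      lab t \<rho> = lab u \<rho>) \<and>
    lab t \<tau> = Some (\<not> (\<exists>k. lab t (\<tau> @ [k]) = Some True)) \<and>
    (\<forall>\<sigma>. node R fs \<sigma> b \<longrightarrow> pos b \<tau> < pos b \<sigma> \<longrightarrow> lab t \<sigma> = None)"

lemma lab_some:
  assumes t: "t \<in> fin_strings" and b: "b \<in> Field R" "b \<noteq> least_elt"
    and big: "\<not> card (preds b t) \<le> a_lub b"
  obtains \<tau> where "change_at b (longest (preds b t)) t \<tau>"
proof -
  define u where "u = longest (preds b t)"
  define A where "A = {\<tau>. node R fs \<tau> b \<and> (lab u \<tau> = None \<or>
                             lab u \<tau> = Some True \<and> (\<exists>k. lab t (\<tau> @ [k]) = Some True))}"
  define \<tau> where "\<tau> = next_node b t"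
  have \<tau>_minim: "\<tau> = wo_rel.minim (lo b) A" by (simp add: \<tau>_def next_node_def A_def u_def)
  have "preds b t \<noteq> {}" using big by auto
  then have u: "u \<in> fin_strings" using longest_preds[OF t] by (auto simp: u_def preds_def)
  \<comment> \<open>The minimum that defines the changed node is taken over a nonempty set: the
    predecessor labels finitely many of the infinitely many nodes of rank \<open>b\<close>.\<close>
  have "infinite {\<sigma>. node R fs \<sigma> b}"
    using bij_betw_finite[OF bij_pos[OF b(1)]] by simp
  then have "infinite ({\<sigma>. node R fs \<sigma> b} - {\<sigma>. node R fs \<sigma> b \<and> lab u \<sigma> \<noteq> None})"
    using finite_lab_at[OF u b(1)] by simp
  then have "{\<sigma>. node R fs \<sigma> b} - {\<sigma>. node R fs \<sigma> b \<and> lab u \<sigma> \<noteq> None} \<noteq> {}"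
    by (metis finite.emptyI)
  then have "A \<noteq> {}" by (auto simp: A_def)
  moreover have sub: "A \<subseteq> Field (lo b)" using Field_lo[OF b(1)] by (auto simp: A_def)
  ultimately have \<tau>: "\<tau> \<in> A" "\<And>\<rho>. \<rho> \<in> A \<Longrightarrow> (\<tau>, \<rho>) \<in> lo b"
    unfolding \<tau>_minim using wo_rel.minim_in[OF lo_wo_rel[OF b(1)] sub]
      wo_rel.minim_least[OF lo_wo_rel[OF b(1)] sub] by auto
  have \<tau>b: "node R fs \<tau> b" using \<tau>(1) by (simp add: A_def)
  have eq: "lab t \<sigma> = (if pos b \<sigma> < pos b \<tau> then lab u \<sigma>
             else if \<sigma> = \<tau> then Some (\<not> (\<exists>k. lab t (\<tau> @ [k]) = Some True))
             else None)" if "node R fs \<sigma> b" for \<sigma>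
    using lab_node[OF t that b(2)] big node_less_iff[OF b(1), of \<sigma> \<tau>] that \<tau>b
    unfolding u_def[symmetric] \<tau>_def[symmetric] by simp
  have "\<rho> \<notin> A" if "pos b \<rho> < pos b \<tau>" for \<rho>
    using \<tau>(2)[of \<rho>] that lo_iff[OF b(1)] by auto
  then have "change_at b u t \<tau>"
    unfolding change_at_def using \<tau>(1) eq \<tau>b by (auto simp: A_def)
  then show ?thesis using that by (simp add: u_def)
qed

lemma lab_defined:
  assumes "t \<in> fin_strings" "node R fs \<sigma> b" "b \<noteq> least_elt" "lab t \<sigma> \<noteq> None"
  obtains u \<tau> where "u \<in> preds b t" "u = longest (preds b t)" "\<not> card (preds b t) \<le> a_lub b"
    "change_at b u t \<tau>"
proof -
  have big: "\<not> card (preds b t) \<le> a_lub b" using lab_none[OF assms(1-3)] assms(4) by argo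
  then have "preds b t \<noteq> {}" by auto
  then have u: "longest (preds b t) \<in> preds b t" by (rule longest_preds[OF assms(1)])
  obtain \<tau> where "change_at b (longest (preds b t)) t \<tau>"
    using lab_some[OF assms(1) node_Field[OF assms(2)] assms(3) big] .
  with that[OF u refl big] show ?thesis .
qed

lemma change_at_cases:
  assumes "change_at b u t \<tau>" "node R fs \<sigma> b"
  obtains "pos b \<sigma> < pos b \<tau>" "lab t \<sigma> = lab u \<sigma>" | "\<sigma> = \<tau>" | "pos b \<tau> < pos b \<sigma>" "lab t \<sigma> = None"
proof -
  have \<tau>: "node R fs \<tau> b" using assms(1) by (simp add: change_at_def)
  consider "pos b \<sigma> < pos b \<tau>" | "pos b \<sigma> = pos b \<tau>" | "pos b \<tau> < pos b \<sigma>" by linarith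
  then show ?thesis
  proof cases
    case 1 then show ?thesis using assms that(1) by (simp add: change_at_def)
  next
    case 2 then show ?thesis using pos_inj[OF assms(2) \<tau>] that(2) by simp
  next
    case 3 then show ?thesis using assms that(3) by (simp add: change_at_def)
  qed
qed

text \<open>By minimality of the changed node, all nodes before it are labelled by the predecessor
  and keep their labels; all nodes after it are unlabelled.\<close>

lemma lab_initial:
  assumes "t \<in> fin_strings" "node R fs \<sigma> b" "lab t \<sigma> \<noteq> None"
    and "node R fs \<rho> b" "pos b \<rho> \<le> pos b \<sigma>" "b \<noteq> least_elt"
  shows "lab t \<rho> \<noteq> None"
proof -
  obtain u \<tau> where ch: "change_at b u t \<tau>"
    using lab_defined[OF assms(1,2,6,3)] by blast
  then have "pos b \<rho> \<le> pos b \<tau>"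
    using assms(2,3,5) by (cases rule: change_at_cases) auto
  from ch assms(4) show ?thesis
  proof (cases rule: change_at_cases)
    case 1
    then show ?thesis using ch assms(4) by (simp add: change_at_def)
  next
    case 2
    then show ?thesis using ch by (simp add: change_at_def)
  qed (use \<open>pos b \<rho> \<le> pos b \<tau>\<close> in simp)
qed

text \<open>Induction on the length. Before the changed node, labels are inherited: a label 1 there
  is not refuted, because the changed node is the first where this can happen, and the witness of a
  label 0 has lower rank, where the predecessor's labels persist.\<close>

lemma coherent_lab: "t \<in> fin_strings \<Longrightarrow> coherent (lab t)"
proof (induction "card (dom t)" arbitrary: t rule: less_induct)
  case less
  show ?case unfolding coherent_def
  proof (intro allI impI)
    fix \<sigma> b assume \<sigma>: "node R fs \<sigma> b \<and> b \<noteq> least_elt"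
    show "(lab t \<sigma> = Some True \<longrightarrow> (\<forall>k. lab t (\<sigma> @ [k]) \<noteq> Some True)) \<and>
          (lab t \<sigma> = Some False \<longrightarrow> (\<exists>k. lab t (\<sigma> @ [k]) = Some True))"
    proof (cases "lab t \<sigma> = None")
      case False
      then obtain u \<tau> where u: "u \<in> preds b t" and ch: "change_at b u t \<tau>"
        using lab_defined[OF less.prems] \<sigma> by blast
      have u': "u \<in> fin_strings" "prec u t" "agree b (lab u) (lab t)"
        using u by (auto simp: preds_def)
      then have coh: "coherent (lab u)"
        using less card_dom_less fin_strings_finite by blast
      from ch conjunct1[OF \<sigma>] show ?thesis
      proof (cases rule: change_at_cases)
        case 1
        have "\<exists>k. lab t (\<sigma> @ [k]) = Some True" if "lab t \<sigma> = Some False"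
          using coherent_False[OF coh, of \<sigma> b] that 1 \<sigma> agreeD[OF u'(3)] children_below by metis
        then show ?thesis using ch 1 \<sigma> unfolding change_at_def by metis
      qed (use ch in \<open>auto simp: change_at_def\<close>)
    qed simp
  qed
qed

text \<open>Two strings that are both correct with respect to one coherent \<open>L\<close> cannot
  contradict each other, although nothing is assumed of \<open>u\<close> at rank \<open>c\<close>
  itself. Inside the induction on ranks there is one on the length of \<open>u\<close>: its longest
  predecessor already preserves the labels of \<open>r\<close>. A change at a node labelled by
  \<open>r\<close> would need label 1 there and a child with label 1 in \<open>lab u\<close>; both
  would pass to \<open>L\<close> and violate its coherence.\<close>

lemma agree_at_mono:
  assumes coh: "coherent L"
  shows "r \<in> fin_strings \<Longrightarrow> u \<in> fin_strings \<Longrightarrow> r \<subseteq>\<^sub>m u \<Longrightarrow>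
    agree c (lab r) L \<Longrightarrow> agree_at c (lab r) L \<Longrightarrow> agree c (lab u) L \<Longrightarrow> agree_at c (lab r) (lab u)"
proof (induction c arbitrary: r u rule: R_induct)
  case (step c)
  have mono: "agree c (lab r') (lab u')"
    if "r' \<in> fin_strings" "u' \<in> fin_strings" "r' \<subseteq>\<^sub>m u'" "agree c (lab r') L" "agree c (lab u') L" for r' u'
    unfolding agree_def
  proof
    fix c' assume c': "c' \<in> underS R c"
    show "agree_at c' (lab r') (lab u')"
      using step.IH[OF c' that(1-3)] agree_below[OF that(4)] agree_below[OF that(5)]
        agree_agree_at[OF that(4) c'] lt_imp_le[OF c'] by blast
  qed
  show ?case using step.prems
  proof (induction "card (dom u)" arbitrary: u rule: less_induct)
    case (less u)
    show ?case
    proof (cases "c = least_elt \<or> r = u")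
      case True
      then show ?thesis using less.prems(1-3)
        by (auto simp: agree_at_def lab_leaf leaves_def map_le_def dom_def)
    next
      case False
      show ?thesis unfolding agree_at_def
      proof (intro allI impI)
        fix \<sigma> i assume \<sigma>: "node R fs \<sigma> c" "lab r \<sigma> = Some i"
        have cF: "c \<in> Field R" using \<sigma>(1) by (rule node_Field)
        have ru: "agree c (lab r) (lab u)" using mono less.prems by blast
        have big: "\<not> card (preds c r) \<le> a_lub c" using lab_none[OF less.prems(1) \<sigma>(1)] \<sigma>(2) False by auto
        \<comment> \<open>All predecessors of \<open>r\<close> are predecessors of \<open>u\<close>,
          so \<open>u\<close> also exceeds the threshold \<open>a_lub c\<close> and labels nodes of
          rank \<open>c\<close>.\<close>
        have "preds c r \<subseteq> preds c u"
          using agree_trans[OF _ ru] less.prems(3) map_le_trans map_le_antisym unfolding preds_def by blast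
        then have big': "\<not> card (preds c u) \<le> a_lub c"
          using big card_mono[OF finite_preds[OF less.prems(2)]] by (meson le_trans)
        have r: "r \<in> preds c u" using ru less.prems False by (simp add: preds_def)
        define u' where "u' = longest (preds c u)"
        have u': "u' \<in> preds c u" unfolding u'_def using longest_preds[OF less.prems(2)] r by blast
        then have u'': "u' \<in> fin_strings" "prec u' u" "agree c (lab u') (lab u)" by (auto simp: preds_def)
        have "card (dom r) \<le> card (dom u')"
          unfolding u'_def using longest_max[OF finite_preds[OF less.prems(2)] r] .
        then have ru': "r \<subseteq>\<^sub>m u'" using fin_strings_comparable less.prems(1,3) u'' by blast
        have "agree_at c (lab r) (lab u')"
          using less.hyps[OF _ less.prems(1) u''(1) ru' less.prems(4,5)] u'' less.prems(2,6)
            card_dom_less[OF fin_strings_finite] agree_trans by blast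
        note * = agree_atD[OF this]
        obtain \<tau> where ch: "change_at c u' u \<tau>"
          using lab_some[OF less.prems(2) cF _ big'] False unfolding u'_def by blast
        then have \<tau>: "node R fs \<tau> c" by (simp add: change_at_def)
        have "\<not> pos c \<tau> \<le> pos c \<sigma>"
        proof
          assume "pos c \<tau> \<le> pos c \<sigma>"
          then obtain j where j: "lab r \<tau> = Some j"
            using lab_initial[OF less.prems(1) \<sigma>(1) _ \<tau>] \<sigma>(2) False by auto
          then have "lab u' \<tau> = Some j" "L \<tau> = Some j"
            using *[OF \<tau>] agree_atD[OF less.prems(5) \<tau>] by auto
          moreover from this obtain k where "j = True" "lab u (\<tau> @ [k]) = Some True"
            using ch by (auto simp: change_at_def)
          moreover from this have "L (\<tau> @ [k]) = Some True"
            using agreeD[OF less.prems(6)] children_below[OF \<tau>] False by blast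
          ultimately show False using coherent_True[OF coh \<tau>] False by blast
        qed
        then show "lab u \<sigma> = Some i" using ch \<sigma> *[OF \<sigma>(1)] by (auto simp: change_at_def)
      qed
    qed
  qed
qed

lemma agree_mono:
  assumes "coherent L" "r \<in> fin_strings" "u \<in> fin_strings" "r \<subseteq>\<^sub>m u"
    "agree b (lab r) L" "agree b (lab u) L"
  shows "agree b (lab r) (lab u)"
  unfolding agree_def
proof
  fix c assume c: "c \<in> underS R b"
  show "agree_at c (lab r) (lab u)"
    using agree_at_mono[OF assms(1-4)] agree_below[OF assms(5)] agree_below[OF assms(6)]
      agree_agree_at[OF assms(5) c] lt_imp_le[OF c] by blast
qed

section \<open>True initial segments\<close>

definition pfx :: "(nat list \<rightharpoonup> bool) \<Rightarrow> nat \<Rightarrow> (nat list \<rightharpoonup> bool)" where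
  "pfx T n = T |` first_leaves n"

text \<open>The true stages for \<open>b\<close>: the guess at stage \<open>n\<close> makes no error
  below \<open>b\<close>, though it may be incomplete.\<close>

definition true_at :: "(nat list \<rightharpoonup> bool) \<Rightarrow> nat \<Rightarrow> nat \<Rightarrow> bool" where
  "true_at T b n \<longleftrightarrow> agree b (lab (pfx T n)) T"

text \<open>Isolates the properties of \<open>T\<^sup>x\<close> that the analysis of true stages
  uses.\<close>

definition total_lab :: "(nat list \<rightharpoonup> bool) \<Rightarrow> bool" where
  "total_lab T \<longleftrightarrow> coherent T \<and> (\<forall>\<sigma> b. node R fs \<sigma> b \<longrightarrow> T \<sigma> \<noteq> None)"

lemma dom_pfx: "total_lab T \<Longrightarrow> dom (pfx T n) = first_leaves n"
  by (auto simp: pfx_def dom_def restrict_map_def total_lab_def first_leaves_def leaves_def)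

lemma card_pfx: "total_lab T \<Longrightarrow> card (dom (pfx T n)) = n"
  by (simp add: dom_pfx card_first_leaves)

lemma pfx_fin: "total_lab T \<Longrightarrow> pfx T n \<in> fin_strings"
  by (simp add: fin_strings_iff dom_pfx card_first_leaves)

lemma pfx_mono: "m \<le> n \<Longrightarrow> pfx T m \<subseteq>\<^sub>m pfx T n"
  using first_leaves_mono[of m n] by (auto simp: pfx_def map_le_def restrict_map_def)

lemma pfx_inj: "total_lab T \<Longrightarrow> pfx T m = pfx T n \<longleftrightarrow> m = n"
  using card_pfx by metis

lemma pfx_le_iff: "total_lab T \<Longrightarrow> pfx T m \<subseteq>\<^sub>m pfx T n \<longleftrightarrow> m \<le> n"
  using pfx_mono pfx_inj nat_le_linear map_le_antisym by metis

lemma fin_string_pfx: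
  assumes "total_lab T" "s \<in> fin_strings" "\<And>\<sigma> i. s \<sigma> = Some i \<Longrightarrow> T \<sigma> = Some i"
  shows "s = pfx T (card (dom s))"
proof
  fix \<sigma>
  have "s \<sigma> = None \<longleftrightarrow> \<sigma> \<notin> first_leaves (card (dom s))"
    using assms(2) fin_strings_iff by (metis domIff)
  then show "s \<sigma> = pfx T (card (dom s)) \<sigma>"
    using assms(3) by (cases "s \<sigma>") (auto simp: pfx_def)
qed

lemma pfx_below:
  assumes "total_lab T" "s \<in> fin_strings" "s \<subseteq>\<^sub>m pfx T n"
  obtains m where "m \<le> n" "s = pfx T m"
proof -
  have "T \<sigma> = Some i" if "s \<sigma> = Some i" for \<sigma> i
  proof -
    have "\<sigma> \<in> dom s" using that by auto
    then have "pfx T n \<sigma> = Some i" using assms(3) that unfolding map_le_def by metis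
    then show ?thesis by (auto simp: pfx_def restrict_map_def split: if_splits)
  qed
  then have s: "s = pfx T (card (dom s))" using fin_string_pfx assms by blast
  then have "card (dom s) \<le> n" using pfx_le_iff assms(1,3) by metis
  then show ?thesis using s that by blast
qed

text \<open>Along a true stage, the recursion consults exactly the earlier true stages. One
  inclusion is transitivity; the other is \<open>agree_mono\<close>, with \<open>T\<close> as the
  common coherent labelling.\<close>

lemma preds_pfx:
  assumes T: "total_lab T" and n: "true_at T b n"
  shows "preds b (pfx T n) = pfx T ` {m. m < n \<and> true_at T b m}"
proof
  show "preds b (pfx T n) \<subseteq> pfx T ` {m. m < n \<and> true_at T b m}"
  proof
    fix s assume "s \<in> preds b (pfx T n)"
    then have s: "s \<in> fin_strings" "prec s (pfx T n)" "agree b (lab s) (lab (pfx T n))"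
      by (auto simp: preds_def)
    then obtain m where m: "m \<le> n" "s = pfx T m" using pfx_below[OF T] by blast
    then have "m < n" using s(2) by (cases "m = n") auto
    moreover have "true_at T b m" using s(3) n m(2) agree_trans unfolding true_at_def by blast
    ultimately show "s \<in> pfx T ` {m. m < n \<and> true_at T b m}" using m(2) by blast
  qed
  show "pfx T ` {m. m < n \<and> true_at T b m} \<subseteq> preds b (pfx T n)"
  proof clarify
    fix m assume m: "m < n" "true_at T b m"
    have "agree b (lab (pfx T m)) (lab (pfx T n))"
      using agree_mono[of T] T pfx_fin pfx_mono m n unfolding true_at_def total_lab_def
      by (meson T less_imp_le_nat)
    then show "pfx T m \<in> preds b (pfx T n)"
      using m pfx_mono[of m n T] pfx_inj[OF T] pfx_fin[OF T] by (simp add: preds_def)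
  qed
qed

lemma card_preds_pfx:
  assumes "total_lab T" "true_at T b n"
  shows "card (preds b (pfx T n)) = card {m. m < n \<and> true_at T b m}"
  using preds_pfx[OF assms] pfx_inj[OF assms(1)] by (simp add: card_image inj_on_def)

lemma longest_preds_pfx:
  assumes T: "total_lab T" and n: "true_at T b n" and ne: "preds b (pfx T n) \<noteq> {}"
  obtains m where "longest (preds b (pfx T n)) = pfx T m" "m < n" "true_at T b m"
    "\<And>m'. m' < n \<Longrightarrow> true_at T b m' \<Longrightarrow> m' \<le> m"
proof -
  have "longest (preds b (pfx T n)) \<in> pfx T ` {m. m < n \<and> true_at T b m}"
    using longest_preds[OF pfx_fin[OF T] ne] preds_pfx[OF T n] by simp
  then obtain m where m: "longest (preds b (pfx T n)) = pfx T m" "m < n" "true_at T b m" by blast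
  have "m' \<le> m" if "m' < n" "true_at T b m'" for m'
  proof -
    have "pfx T m' \<in> preds b (pfx T n)" using that preds_pfx[OF T n] by blast
    then have "card (dom (pfx T m')) \<le> card (dom (pfx T m))"
      using longest_max[OF finite_preds[OF pfx_fin[OF T]]] m(1) by metis
    then show ?thesis by (simp add: card_pfx[OF T])
  qed
  then show ?thesis using m that by blast
qed

lemma pfx_change:
  assumes T: "total_lab T" and n: "true_at T b n" and b: "b \<in> Field R" "b \<noteq> least_elt"
    and big: "a_lub b < card {m. m < n \<and> true_at T b m}"
  obtains m \<tau> where "m < n" "true_at T b m" "\<And>m'. m' < n \<Longrightarrow> true_at T b m' \<Longrightarrow> m' \<le> m"
    "change_at b (pfx T m) (pfx T n) \<tau>"
proof -
  have big': "\<not> card (preds b (pfx T n)) \<le> a_lub b"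
    using big card_preds_pfx[OF T n] by simp
  then have ne: "preds b (pfx T n) \<noteq> {}" by auto
  obtain \<tau> where "change_at b (longest (preds b (pfx T n))) (pfx T n) \<tau>"
    using lab_some[OF pfx_fin[OF T] b big'] .
  then show ?thesis using longest_preds_pfx[OF T n ne] that by metis
qed

lemma true_at_mono:
  assumes T: "total_lab T" and m: "true_at T b m" and n: "true_at T b n" and "m \<le> n"
    and "\<sigma> \<in> nodes_below b" "lab (pfx T m) \<sigma> = Some i"
  shows "lab (pfx T n) \<sigma> = Some i"
proof -
  have "agree b (lab (pfx T m)) (lab (pfx T n))"
    using agree_mono[of T] T m n pfx_fin[OF T] pfx_mono[OF assms(4)]
    unfolding true_at_def total_lab_def by blast
  then show ?thesis using agreeD assms(5,6) by blast
qed

text \<open>The induction on ranks alternates between the two notions: being true up to all smaller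
  ranks gives \<open>true_at\<close>, and a separate argument then adds the rank \<open>b\<close>
  itself.\<close>

definition true_upto :: "(nat list \<rightharpoonup> bool) \<Rightarrow> nat \<Rightarrow> nat \<Rightarrow> bool" where
  "true_upto T b n \<longleftrightarrow> true_at T b n \<and> agree_at b (lab (pfx T n)) T"

lemma true_upto_iff:
  "b \<in> Field R \<Longrightarrow> true_upto T b n \<longleftrightarrow> (\<forall>c. (c, b) \<in> R \<longrightarrow> agree_at c (lab (pfx T n)) T)"
  unfolding true_upto_def true_at_def agree_def using R_refl le_cases lt_imp_le by blast

lemma true_at_iff:
  "true_at T b n \<longleftrightarrow> (\<forall>c\<in>underS R b. true_upto T c n)"
  unfolding true_upto_def true_at_def agree_def using lt_trans by blast

lemma true_upto_least:
  assumes T: "total_lab T" shows "true_upto T least_elt n"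
proof -
  have "T \<sigma> = Some i" if "node R fs \<sigma> least_elt" "lab (pfx T n) \<sigma> = Some i" for \<sigma> i
  proof -
    have "pfx T n \<sigma> = Some i" using that lab_leaf[OF pfx_fin[OF T]] by (simp add: leaves_def)
    then show ?thesis by (auto simp: pfx_def restrict_map_def split: if_splits)
  qed
  then show ?thesis using not_lt_least by (auto simp: true_upto_def true_at_def agree_def agree_at_def)
qed

text \<open>At stage \<open>n\<close> only the finitely many ranks \<open>c\<close> with \<open>a_lub c < n\<close> are active, so a stage which
  is the first one to be true up to the last active rank is true everywhere below \<open>b\<close>.\<close>

lemma true_at_unbounded:
  assumes T: "total_lab T" and b: "b \<in> Field R" "b \<noteq> least_elt"
    and below: "\<And>c N. c \<in> underS R b \<Longrightarrow> \<exists>n\<ge>N. true_upto T c n"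
  shows "\<exists>n\<ge>N. true_at T b n"
proof -
  \<comment> \<open>The cutoff is \<open>N\<close>, not the stage chosen afterwards: ranks outside
    this set turn out to have at most \<open>N\<close> predecessors at that stage. Inserting
    \<open>least_elt\<close> keeps the set nonempty.\<close>
  define A where "A = insert least_elt {c \<in> underS R b. a_lub c < N}"
  have "finite A"
    unfolding A_def using finite_subset[OF _ finite_a_lub[of N]] underS_Field1 by (metis (no_types, lifting) finite_insert mem_Collect_eq subsetI)
  moreover have "A \<noteq> {}" "A \<subseteq> Field R"
    using least_Field underS_Field1 by (auto simp: A_def)
  ultimately have "\<exists>c1\<in>A. \<forall>c\<in>A. (c, c1) \<in> R"
  proof (induction A rule: finite_ne_induct)
    case (insert x F)
    then obtain c1 where c1: "c1 \<in> F" "\<forall>c\<in>F. (c, c1) \<in> R" by auto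
    show ?case
    proof (cases "(x, c1) \<in> R")
      case False
      then have "(c1, x) \<in> R" using R_total[of x c1] insert.prems c1(1) lt_imp_le by blast
      then show ?thesis using c1 R_trans R_refl insert.prems by blast
    qed (use c1 in blast)
  qed (use R_refl in auto)
  then obtain c1 where c1: "c1 \<in> A" "\<And>c. c \<in> A \<Longrightarrow> (c, c1) \<in> R" by blast
  have c1b: "c1 \<in> underS R b" using c1(1) least_lt[OF b] by (auto simp: A_def)
  define n where "n = (LEAST n. N \<le> n \<and> true_upto T c1 n)"
  have n: "N \<le> n" "true_upto T c1 n"
    using LeastI_ex[OF below[OF c1b, of N, unfolded Bex_def]] by (auto simp: n_def)
  have min: "m < N" if "m < n" "true_upto T c1 m" for m
    using that not_less_Least[of m "\<lambda>n. N \<le> n \<and> true_upto T c1 n"] by (auto simp: n_def)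
  have cF: "c1 \<in> Field R" using c1b underS_Field1 by blast
  have "agree_at c (lab (pfx T n)) T" if c: "c \<in> underS R b" for c
  proof (cases "(c, c1) \<in> R")
    case True
    then show ?thesis using n(2) true_upto_iff[OF cF] by blast
  next
    case False
    then have c1c: "c1 \<in> underS R c" using R_total[of c c1] c cF underS_Field1 by blast
    have "c \<notin> A" using False c1(2) by blast
    then have a: "N \<le> a_lub c" "c \<noteq> least_elt" using c by (auto simp: A_def)
    \<comment> \<open>A predecessor at a rank above \<open>c1\<close> agrees with stage
      \<open>n\<close> up to \<open>c1\<close>, so it is itself true up to \<open>c1\<close>.
      Minimality of \<open>n\<close> puts it before \<open>N\<close>, and the threshold
      \<open>a_lub c\<close> is not exceeded.\<close>
    have "preds c (pfx T n) \<subseteq> pfx T ` {..<N}"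
    proof
      fix s assume "s \<in> preds c (pfx T n)"
      then have s: "s \<in> fin_strings" "prec s (pfx T n)" "agree c (lab s) (lab (pfx T n))"
        by (auto simp: preds_def)
      then obtain m where m: "m \<le> n" "s = pfx T m" using pfx_below[OF T] by blast
      then have "m < n" using s(2) by (cases "m = n") auto
      have "agree_at c' (lab (pfx T m)) T" if c': "(c', c1) \<in> R" for c'
      proof -
        have "agree_at c' (lab s) (lab (pfx T n))"
          using agree_agree_at[OF s(3) le_lt_trans[OF c' c1c]] .
        moreover have "agree_at c' (lab (pfx T n)) T" using n(2) true_upto_iff[OF cF] c' by blast
        ultimately show ?thesis using m(2) unfolding agree_at_def by blast
      qed
      then have "true_upto T c1 m" using true_upto_iff[OF cF] by blast
      then have "m < N" using min \<open>m < n\<close> by blast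
      then show "s \<in> pfx T ` {..<N}" using m(2) by blast
    qed
    then have "card (preds c (pfx T n)) \<le> card (pfx T ` {..<N})" by (intro card_mono) auto
    also have "\<dots> \<le> a_lub c" using card_image_le[of "{..<N}" "pfx T"] a(1) by simp
    finally show ?thesis
      using lab_none[OF pfx_fin[OF T] _ a(2)] by (auto simp: agree_at_def)
  qed
  then show ?thesis using n(1) unfolding true_at_def agree_def by blast
qed

text \<open>Induction on the position. Correctly labelled nodes never change again, since that needs
  a refuting child, so late changes occur at position \<open>j\<close> or beyond and the node at
  \<open>j\<close> is labelled. If \<open>T\<close> gives it 0, the witness is visible at all late
  true stages; if \<open>T\<close> gives it 1, no true stage shows a refuting child.\<close>

lemma eventually_correct:
  assumes T: "total_lab T" and c: "c \<in> Field R" "c \<noteq> least_elt"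
    and unb: "\<And>N. \<exists>n\<ge>N. true_at T c n"
    and cov: "\<And>\<sigma>. \<sigma> \<in> nodes_below c \<Longrightarrow> \<exists>n. true_at T c n \<and> lab (pfx T n) \<sigma> \<noteq> None"
    and big: "\<And>n. n \<ge> n1 \<Longrightarrow> a_lub c < card {m. m < n \<and> true_at T c m}"
  shows "\<exists>n0. \<forall>n\<ge>n0. true_at T c n \<longrightarrow>
    (\<forall>\<rho>. node R fs \<rho> c \<longrightarrow> pos c \<rho> < j \<longrightarrow> lab (pfx T n) \<rho> = T \<rho>)"
proof (induction j)
  case (Suc j)
  then obtain n0 where n0: "\<And>n \<rho>. n \<ge> n0 \<Longrightarrow> true_at T c n \<Longrightarrow> node R fs \<rho> c \<Longrightarrow>
      pos c \<rho> < j \<Longrightarrow> lab (pfx T n) \<rho> = T \<rho>" by blast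
  have coh: "coherent T" using T by (simp add: total_lab_def)
  obtain \<sigma> where \<sigma>: "node R fs \<sigma> c" "pos c \<sigma> = j" using pos_surj[OF c(1)] by blast
  have "\<exists>n2. T \<sigma> = Some False \<longrightarrow> (\<exists>k. \<forall>n\<ge>n2. true_at T c n \<longrightarrow> lab (pfx T n) (\<sigma> @ [k]) = Some True)"
  proof (cases "T \<sigma> = Some False")
    case True
    then obtain k where k: "T (\<sigma> @ [k]) = Some True"
      using coherent_False[OF coh \<sigma>(1) c(2)] by blast
    have b: "\<sigma> @ [k] \<in> nodes_below c" using children_below \<sigma> c by blast
    then obtain n2 i where n2: "true_at T c n2" "lab (pfx T n2) (\<sigma> @ [k]) = Some i"
      using cov by blast
    then have "i = True" using agreeD[OF _ b] k unfolding true_at_def by fastforce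
    then have "\<forall>n\<ge>n2. true_at T c n \<longrightarrow> lab (pfx T n) (\<sigma> @ [k]) = Some True"
      using true_at_mono[OF T n2(1) _ _ b] n2(2) by blast
    then show ?thesis by blast
  qed simp
  then obtain n2 where n2: "T \<sigma> = Some False \<Longrightarrow>
      \<exists>k. \<forall>n\<ge>n2. true_at T c n \<longrightarrow> lab (pfx T n) (\<sigma> @ [k]) = Some True" by blast
  obtain n3 where n3: "n3 \<ge> max n0 (max n1 n2)" "true_at T c n3" using unb by blast
  \<comment> \<open>The strict bound ensures that the true stage just before \<open>n\<close> is at
    least \<open>n3\<close>, so that the induction hypothesis applies to it as well.\<close>
  have "lab (pfx T n) \<rho> = T \<rho>"
    if n: "n \<ge> Suc n3" "true_at T c n" and \<rho>: "node R fs \<rho> c" "pos c \<rho> < Suc j" for n \<rho>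
  proof (cases "pos c \<rho> < j")
    case True
    then show ?thesis using n0[of n \<rho>] n n3 \<rho> by auto
  next
    case False
    then have "pos c \<rho> = pos c \<sigma>" using \<rho> \<sigma> by simp
    then have \<rho>\<sigma>: "\<rho> = \<sigma>" using pos_inj \<rho> \<sigma> by blast
    obtain m \<tau> where m: "m < n" "true_at T c m" "\<And>m'. m' < n \<Longrightarrow> true_at T c m' \<Longrightarrow> m' \<le> m"
      and ch: "change_at c (pfx T m) (pfx T n) \<tau>"
      using pfx_change[OF T n(2) c big] n(1) n3(1) by (metis Suc_leD le_trans max.bounded_iff)
    have "m \<ge> n3" using m(3)[OF _ n3(2)] n(1) by simp
    then have old: "lab (pfx T m) \<rho>' = T \<rho>'" if "node R fs \<rho>' c" "pos c \<rho>' < j" for \<rho>'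
      using n0[of m \<rho>'] that m n3 by simp
    have child: "T (\<rho>' @ [k]) = Some True"
      if "node R fs \<rho>' c" "lab (pfx T n) (\<rho>' @ [k]) = Some True" for \<rho>' k
      using agreeD[of c "lab (pfx T n)" T] that n(2) children_below[OF that(1) c(2)]
      unfolding true_at_def by blast
    have \<tau>: "node R fs \<tau> c" using ch by (simp add: change_at_def)
    have \<tau>j: "\<not> pos c \<tau> < j"
    proof
      assume "pos c \<tau> < j"
      then have "lab (pfx T m) \<tau> = T \<tau>" using old \<tau> by blast
      moreover have "T \<tau> \<noteq> None" using T \<tau> by (auto simp: total_lab_def)
      ultimately obtain k where "T \<tau> = Some True" "lab (pfx T n) (\<tau> @ [k]) = Some True"
        using ch by (auto simp: change_at_def)
      then show False using child[OF \<tau>] coherent_True[OF coh \<tau> c(2)] by blast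
    qed
    have def: "lab (pfx T n) \<sigma> \<noteq> None"
    proof -
      have "\<sigma> = \<tau> \<or> pos c \<sigma> < pos c \<tau>" using \<tau>j \<sigma> pos_inj[OF \<sigma>(1) \<tau>] by linarith
      then show ?thesis using ch \<sigma>(1) by (auto simp: change_at_def)
    qed
    have cohn: "coherent (lab (pfx T n))" by (rule coherent_lab[OF pfx_fin[OF T]])
    show ?thesis
    proof (cases "T \<sigma> = Some False")
      case True
      then obtain k where "lab (pfx T n) (\<sigma> @ [k]) = Some True"
        using n2 n n3 by (metis Suc_leD le_trans max.bounded_iff)
      then have "lab (pfx T n) \<sigma> \<noteq> Some True" using coherent_True[OF cohn \<sigma>(1) c(2)] by blast
      then show ?thesis using def True \<rho>\<sigma> by auto
    next
      case False
      then have t: "T \<sigma> = Some True" using T \<sigma>(1) by (auto simp: total_lab_def)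
      have "lab (pfx T n) \<sigma> \<noteq> Some False"
        using coherent_False[OF cohn \<sigma>(1) c(2)] child[OF \<sigma>(1)] coherent_True[OF coh \<sigma>(1) c(2) t]
        by blast
      then show ?thesis using def t \<rho>\<sigma> by auto
    qed
  qed
  then show ?case by blast
qed simp

lemma infinite_card_below:
  fixes P :: "nat \<Rightarrow> bool"
  assumes "\<And>N. \<exists>n\<ge>N. P n"
  obtains n1 where "\<And>n. n \<ge> n1 \<Longrightarrow> a < card {m. m < n \<and> P m}"
proof -
  have "infinite {m. P m}"
    using assms by (simp add: infinite_nat_iff_unbounded_le)
  then obtain F where F: "F \<subseteq> {m. P m}" "finite F" "card F = Suc a"
    using infinite_arbitrarily_large by blast
  have "a < card {m. m < n \<and> P m}" if "n \<ge> Suc (Max F)" for n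
  proof -
    have "F \<subseteq> {m. m < n \<and> P m}"
    proof
      fix m assume m: "m \<in> F"
      then have "m \<le> Max F" using F(2) by simp
      then show "m \<in> {m. m < n \<and> P m}" using F(1) m that by auto
    qed
    then have "card F \<le> card {m. m < n \<and> P m}" by (intro card_mono) auto
    then show ?thesis using F(3) by simp
  qed
  then show ?thesis using that by blast
qed

text \<open>Among the late stages choose one whose change is at the least position. Its labelling is
  correct, except that the changed node may wrongly have the label 1; then the next change at that
  node corrects this.\<close>

lemma true_upto_unbounded:
  assumes T: "total_lab T" and c: "c \<in> Field R" "c \<noteq> least_elt"
    and unb: "\<And>N. \<exists>n\<ge>N. true_at T c n"
    and cov: "\<And>\<sigma>. \<sigma> \<in> nodes_below c \<Longrightarrow> \<exists>n. true_at T c n \<and> lab (pfx T n) \<sigma> \<noteq> None"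
  shows "\<exists>n\<ge>N. true_upto T c n"
proof -
  have coh: "coherent T" using T by (simp add: total_lab_def)
  obtain n1' where big': "\<And>n. n \<ge> n1' \<Longrightarrow> a_lub c < card {m. m < n \<and> true_at T c m}"
    using infinite_card_below[OF unb] by blast
  obtain n1 where n1: "n1 \<ge> max N n1'" "true_at T c n1" using unb by blast
  then have big: "\<And>n. n \<ge> n1 \<Longrightarrow> a_lub c < card {m. m < n \<and> true_at T c m}" using big' by simp
  define Ch where "Ch n m \<tau> \<longleftrightarrow> n \<ge> n1 \<and> true_at T c n \<and> m < n \<and> true_at T c m \<and>
    (\<forall>m'<n. true_at T c m' \<longrightarrow> m' \<le> m) \<and> change_at c (pfx T m) (pfx T n) \<tau>" for n m \<tau>
  have Ch: "\<exists>m \<tau>. Ch n m \<tau>" if "n \<ge> n1" "true_at T c n" for n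
    using pfx_change[OF T that(2) c big[OF that(1)]] that unfolding Ch_def by metis
  define j where "j = (LEAST j. \<exists>n m \<tau>. Ch n m \<tau> \<and> pos c \<tau> = j)"
  have "\<exists>j n m \<tau>. Ch n m \<tau> \<and> pos c \<tau> = j" using Ch[of n1] n1 by blast
  then have "\<exists>n m \<tau>. Ch n m \<tau> \<and> pos c \<tau> = j" unfolding j_def by (rule LeastI_ex)
  then obtain n m \<tau> where n: "Ch n m \<tau>" "pos c \<tau> = j" by blast
  have min: "j \<le> pos c \<tau>'" if "Ch n' m' \<tau>'" for n' m' \<tau>'
    unfolding j_def using that by (intro Least_le) blast
  have old: "lab (pfx T n') \<rho> = lab (pfx T m') \<rho>"
    if "Ch n' m' \<tau>'" "node R fs \<rho> c" "pos c \<rho> < j" for n' m' \<tau>' \<rho>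
    using that min[OF that(1)] by (simp add: Ch_def change_at_def)
  \<comment> \<open>No late change occurs before position \<open>j\<close>, so the labels there are
    constant along the late true stages. Being eventually correct, they are correct at every one of
    them.\<close>
  have correct: "lab (pfx T n') \<rho> = T \<rho>"
    if n': "n' \<ge> n1" "true_at T c n'" and \<rho>: "node R fs \<rho> c" "pos c \<rho> < j" for n' \<rho>
  proof -
    obtain n0 where n0: "\<And>n \<rho>. n \<ge> n0 \<Longrightarrow> true_at T c n \<Longrightarrow> node R fs \<rho> c \<Longrightarrow> pos c \<rho> < j \<Longrightarrow>
        lab (pfx T n) \<rho> = T \<rho>"
      using eventually_correct[OF T c unb cov big] by blast
    have "lab (pfx T n'') \<rho> = lab (pfx T n') \<rho>" if "n'' \<ge> n'" "true_at T c n''" for n''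
      using that
    proof (induction n'' rule: less_induct)
      case (less n'')
      show ?case
      proof (cases "n'' = n'")
        case False
        obtain m'' \<tau>'' where ch: "Ch n'' m'' \<tau>''" using Ch[of n''] less.prems n' by auto
        then have "m'' \<ge> n'" "m'' < n''" "true_at T c m''"
          using False less.prems n' by (auto simp: Ch_def)
        then show ?thesis using less.IH[of m''] old[OF ch \<rho>] by simp
      qed simp
    qed
    moreover obtain n'' where "n'' \<ge> max n0 n'" "true_at T c n''" using unb by blast
    ultimately show ?thesis using n0[OF _ _ \<rho>] by (metis max.bounded_iff)
  qed
  have nn: "n \<ge> n1" "true_at T c n" and \<tau>: "node R fs \<tau> c"
    using n by (auto simp: Ch_def change_at_def)
  have upto: "true_upto T c n'" if ch: "Ch n' m' \<tau>" and eq: "lab (pfx T n') \<tau> = T \<tau>" for n' m'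
  proof -
    have n': "n' \<ge> n1" "true_at T c n'" "change_at c (pfx T m') (pfx T n') \<tau>"
      using ch by (auto simp: Ch_def)
    have "T \<sigma> = Some i" if \<sigma>: "node R fs \<sigma> c" "lab (pfx T n') \<sigma> = Some i" for \<sigma> i
      using n'(3) \<sigma>(1)
    proof (cases rule: change_at_cases)
      case 1
      then show ?thesis using correct[OF n'(1,2) \<sigma>(1)] n(2) \<sigma>(2) by simp
    qed (use eq \<sigma> in auto)
    then show ?thesis using n'(2) by (auto simp: true_upto_def agree_at_def)
  qed
  show ?thesis
  proof (cases "lab (pfx T n) \<tau> = T \<tau>")
    case True
    then show ?thesis using upto n(1) nn(1) n1(1) by (meson le_trans max.bounded_iff)
  next
    case False
    obtain n0 where n0: "\<And>n. n \<ge> n0 \<Longrightarrow> true_at T c n \<Longrightarrow> lab (pfx T n) \<tau> = T \<tau>"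
      using eventually_correct[OF T c unb cov big, of n1 "Suc j"] \<tau> n(2) by blast
    \<comment> \<open>At the first stage where the wrong label of \<tau> is gone, the preceding true
      stage still has it. By minimality of \<open>j\<close> the change is at \<tau> itself, so it
      replaces 1 by 0 and comes with a visible witness.\<close>
    define bad where "bad n' \<longleftrightarrow> n' \<ge> n \<and> true_at T c n' \<and> lab (pfx T n') \<tau> \<noteq> lab (pfx T n) \<tau>" for n'
    obtain n' where "n' \<ge> max n0 n" "true_at T c n'" using unb by blast
    then have "bad n'" using n0 False by (simp add: bad_def)
    define n2 where "n2 = (LEAST n'. bad n')"
    have n2: "bad n2" unfolding n2_def using \<open>bad n'\<close> by (rule LeastI)
    have n2min: "\<not> bad k" if "k < n2" for k using that not_less_Least unfolding n2_def by blast
    have n2': "n2 \<ge> n" "true_at T c n2" "lab (pfx T n2) \<tau> \<noteq> lab (pfx T n) \<tau>" using n2 by (auto simp: bad_def)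
    then have "n2 > n" by (cases "n2 = n") auto
    obtain m2 \<tau>2 where ch: "Ch n2 m2 \<tau>2" using Ch[of n2] n2' nn by auto
    then have m2: "m2 \<ge> n" "m2 < n2" "true_at T c m2" using \<open>n2 > n\<close> nn by (auto simp: Ch_def)
    then have eq: "lab (pfx T m2) \<tau> = lab (pfx T n) \<tau>" using n2min[of m2] by (auto simp: bad_def)
    have ch': "change_at c (pfx T m2) (pfx T n2) \<tau>2" using ch by (simp add: Ch_def)
    then have "\<tau>2 = \<tau>" using \<tau>
    proof (cases rule: change_at_cases)
      case 3
      then show ?thesis using min[OF ch] n(2) by simp
    qed (use eq n2' in auto)
    have some: "lab (pfx T n) \<tau> \<noteq> None" using n(1) by (auto simp: Ch_def change_at_def)
    obtain k where k: "lab (pfx T n2) (\<tau> @ [k]) = Some True" "lab (pfx T n2) \<tau> = Some False"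
      using ch' eq some \<open>\<tau>2 = \<tau>\<close> by (auto simp: change_at_def)
    then have "T (\<tau> @ [k]) = Some True"
      using agreeD[of c "lab (pfx T n2)" T] n2'(2) children_below[OF \<tau> c(2)]
      unfolding true_at_def by blast
    then have "T \<tau> \<noteq> Some True" using coherent_True[OF coh \<tau> c(2)] by blast
    then have "T \<tau> = Some False" using T \<tau> by (auto simp: total_lab_def)
    then have "true_upto T c n2" using upto ch k \<open>\<tau>2 = \<tau>\<close> by metis
    then show ?thesis using n2'(1) nn(1) n1(1) by (meson le_trans max.bounded_iff)
  qed
qed

text \<open>A label seen at a stage that is true up to the rank of the node persists to every later
  stage that is true below \<open>b\<close>, by \<open>agree_at_mono\<close>.\<close>

lemma true_at_cover:
  assumes T: "total_lab T" and b: "b \<in> Field R"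
    and unb: "\<And>N. \<exists>n\<ge>N. true_at T b n"
    and cov: "\<And>c \<sigma>. c \<in> underS R b \<Longrightarrow> node R fs \<sigma> c \<Longrightarrow> \<exists>n. true_upto T c n \<and> lab (pfx T n) \<sigma> \<noteq> None"
    and \<sigma>: "\<sigma> \<in> nodes_below b"
  shows "\<exists>n. true_at T b n \<and> lab (pfx T n) \<sigma> \<noteq> None"
proof -
  obtain c where c: "c \<in> underS R b" "node R fs \<sigma> c" using \<sigma> by (auto simp: nodes_below_def)
  then obtain m i where m: "true_upto T c m" "lab (pfx T m) \<sigma> = Some i" using cov by blast
  obtain n where n: "n \<ge> m" "true_at T b n" using unb by blast
  have "true_upto T c n" using n(2) c(1) true_at_iff by blast
  then have "agree_at c (lab (pfx T m)) (lab (pfx T n))"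
    using agree_at_mono[of T "pfx T m" "pfx T n" c] T m(1) pfx_fin[OF T] pfx_mono[OF n(1)]
    unfolding true_upto_def true_at_def total_lab_def by blast
  then have "lab (pfx T n) \<sigma> = Some i" using agree_atD c(2) m(2) by blast
  then show ?thesis using n(2) by blast
qed

lemma true_at_least: "total_lab T \<Longrightarrow> true_at T least_elt n"
  using true_upto_least by (simp add: true_upto_def)

text \<open>The two claims need a joint induction: unboundedness at \<open>c\<close> uses that all
  lower nodes get labelled, and labelling the nodes of rank \<open>c\<close> uses unboundedly many
  stages that are true up to \<open>c\<close>.\<close>

lemma true_upto_infinite_cover:
  assumes T: "total_lab T"
  shows "c \<in> Field R \<Longrightarrow> (\<forall>N. \<exists>n\<ge>N. true_upto T c n) \<and>
    (\<forall>\<sigma>. node R fs \<sigma> c \<longrightarrow> (\<exists>n. true_upto T c n \<and> lab (pfx T n) \<sigma> \<noteq> None))"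
proof (induction c rule: R_induct)
  case (step c)
  show ?case
  proof (cases "c = least_elt")
    case True
    have "\<exists>n. lab (pfx T n) \<sigma> \<noteq> None" if "node R fs \<sigma> c" for \<sigma>
    proof -
      have "\<sigma> \<in> first_leaves (Suc (pos least_elt \<sigma>))" "\<sigma> \<in> leaves"
        using that True by (auto simp: first_leaves_def leaves_def)
      then have "lab (pfx T (Suc (pos least_elt \<sigma>))) \<sigma> = T \<sigma>"
        using lab_leaf[OF pfx_fin[OF T]] by (simp add: pfx_def)
      then show ?thesis using T that unfolding total_lab_def by metis
    qed
    then show ?thesis using true_upto_least[OF T] True by auto
  next
    case False
    have IH: "\<exists>n\<ge>N. true_upto T c' n"
      "node R fs \<sigma> c' \<Longrightarrow> \<exists>n. true_upto T c' n \<and> lab (pfx T n) \<sigma> \<noteq> None"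
      if "c' \<in> underS R c" for c' N \<sigma>
      using step.IH[OF that] underS_Field1[OF that] by auto
    have unb: "\<exists>n\<ge>N. true_at T c n" for N
      using true_at_unbounded[OF T step.prems False] IH(1) by blast
    have cov: "\<exists>n. true_at T c n \<and> lab (pfx T n) \<sigma> \<noteq> None" if "\<sigma> \<in> nodes_below c" for \<sigma>
      using true_at_cover[OF T step.prems unb IH(2) that] by blast
    have unb': "\<exists>n\<ge>N. true_upto T c n" for N
      by (rule true_upto_unbounded[OF T step.prems False unb cov])
    have "\<exists>n. true_upto T c n \<and> lab (pfx T n) \<sigma> \<noteq> None" if \<sigma>: "node R fs \<sigma> c" for \<sigma>
    proof -
      obtain n1 where big: "\<And>n. n \<ge> n1 \<Longrightarrow> a_lub c < card {m. m < n \<and> true_at T c m}"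
        using infinite_card_below[OF unb] by blast
      obtain n0 where n0: "\<And>n. n \<ge> n0 \<Longrightarrow> true_at T c n \<Longrightarrow> lab (pfx T n) \<sigma> = T \<sigma>"
        using eventually_correct[OF T step.prems False unb cov big, of n1 "Suc (pos c \<sigma>)"] \<sigma> by blast
      obtain n where n: "n \<ge> n0" "true_upto T c n" using unb' by blast
      then have "lab (pfx T n) \<sigma> = T \<sigma>" using n0 by (simp add: true_upto_def)
      then show ?thesis using n T \<sigma> unfolding total_lab_def by metis
    qed
    then show ?thesis using unb' by blast
  qed
qed

lemma true_at_infinite:
  assumes T: "total_lab T" and b: "b \<in> Field R" shows "\<exists>n\<ge>N. true_at T b n"
proof (cases "b = least_elt")
  case True then show ?thesis using true_at_least[OF T] by blast
next
  case False
  then show ?thesis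
    using true_at_unbounded[OF T b] true_upto_infinite_cover[OF T underS_Field1] by blast
qed

lemma true_at_covers:
  assumes T: "total_lab T" and b: "b \<in> Field R" and \<sigma>: "\<sigma> \<in> nodes_below b"
  shows "\<exists>n. true_at T b n \<and> lab (pfx T n) \<sigma> \<noteq> None"
  using true_at_cover[OF T b true_at_infinite[OF T b] _ \<sigma>] true_upto_infinite_cover[OF T underS_Field1]
  by blast

section \<open>The labelling of a point\<close>

abbreviation TL :: "(nat list \<Rightarrow> bool) \<Rightarrow> (nat list \<rightharpoonup> bool)" where
  "TL x \<equiv> labelling (as_map x)"

lemma dom_as_map: "dom (as_map x) = leaves"
  by (auto simp: as_map_def dom_def restrict_map_def)

lemma as_map_not_fin: "as_map x \<notin> fin_strings"
  using infinite_leaves dom_as_map fin_strings_finite by metis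

lemma full_leaf: "\<sigma> \<in> leaves \<Longrightarrow> full (as_map x) \<sigma> i \<longleftrightarrow> i = x \<sigma>"
  by (auto simp: as_map_def intro: full.leaf elim: full.cases)

lemma full_node:
  assumes "node R fs \<sigma> b" "b \<noteq> least_elt"
  shows "full (as_map x) \<sigma> i \<longleftrightarrow>
    (if i then \<forall>k. full (as_map x) (\<sigma> @ [k]) False else \<exists>k. full (as_map x) (\<sigma> @ [k]) True)"
proof -
  have "\<sigma> \<in> tree - leaves" using assms node_tree node_leaves by blast
  then show ?thesis by (auto intro: full.label0 full.label1 elim: full.cases)
qed

lemma full_total: "node R fs \<sigma> b \<Longrightarrow> full (as_map x) \<sigma> True \<noteq> full (as_map x) \<sigma> False"
proof (induction b arbitrary: \<sigma> rule: R_induct)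
  case (step b)
  show ?case
  proof (cases "b = least_elt")
    case True
    then show ?thesis using step.prems full_leaf[of \<sigma> x] by (auto simp: leaves_def)
  next
    case False
    have "full (as_map x) (\<sigma> @ [k]) True \<noteq> full (as_map x) (\<sigma> @ [k]) False" for k
      using step.IH children_node[OF step.prems False] by blast
    then show ?thesis using full_node[OF step.prems False, of x] by auto
  qed
qed

lemma TL_iff: "node R fs \<sigma> b \<Longrightarrow> TL x \<sigma> = Some i \<longleftrightarrow> full (as_map x) \<sigma> i"
  using full_total[of \<sigma> b x] as_map_not_fin[of x] by (cases i) (auto simp: labelling_def)

lemma TL_leaf: "\<sigma> \<in> leaves \<Longrightarrow> TL x \<sigma> = Some (x \<sigma>)"
  using TL_iff[of \<sigma> least_elt x] full_leaf by (simp add: leaves_def)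

lemma TL_not_None: "node R fs \<sigma> b \<Longrightarrow> TL x \<sigma> \<noteq> None"
  using full_total[of \<sigma> b x] TL_iff[of \<sigma> b x True] TL_iff[of \<sigma> b x False] by auto

lemma TL_eq_True:
  assumes "node R fs \<sigma> b" "b \<noteq> least_elt"
  shows "TL x \<sigma> = Some True \<longleftrightarrow> (\<forall>k. TL x (\<sigma> @ [k]) = Some False)"
  using full_node[OF assms, of x True] TL_iff[OF assms(1)] TL_iff children_node[OF assms] by metis

lemma TL_eq_False:
  assumes "node R fs \<sigma> b" "b \<noteq> least_elt"
  shows "TL x \<sigma> = Some False \<longleftrightarrow> (\<exists>k. TL x (\<sigma> @ [k]) = Some True)"
  using full_node[OF assms, of x False] TL_iff[OF assms(1)] TL_iff children_node[OF assms] by metis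

lemma total_lab_TL: "total_lab (TL x)"
  unfolding total_lab_def coherent_def
  using TL_not_None TL_eq_True TL_eq_False by fastforce

text \<open>Where a coherent labelling is total it obeys the recursion for \<open>T\<^sup>x\<close>,
  hence is determined by the leaves. The bound \<open>b0\<close> is needed because conditions
  determine labels up to \<open>astar\<close> only.\<close>

lemma TL_unique:
  assumes coh: "coherent L" and tot: "\<And>\<sigma> c. node R fs \<sigma> c \<Longrightarrow> (c, b0) \<in> R \<Longrightarrow> L \<sigma> \<noteq> None"
    and leaf: "\<And>\<sigma>. \<sigma> \<in> leaves \<Longrightarrow> L \<sigma> = Some (x \<sigma>)"
  shows "node R fs \<sigma> b \<Longrightarrow> (b, b0) \<in> R \<Longrightarrow> L \<sigma> = TL x \<sigma>"
proof (induction b arbitrary: \<sigma> rule: R_induct)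
  case (step b)
  show ?case
  proof (cases "b = least_elt")
    case True
    then have "\<sigma> \<in> leaves" using step.prems by (simp add: leaves_def)
    then show ?thesis using leaf TL_leaf by simp
  next
    case False
    have eq: "L (\<sigma> @ [k]) = TL x (\<sigma> @ [k])" for k
      using step.IH children_node[OF step.prems(1) False] lt_le_trans[OF _ step.prems(2)] lt_imp_le
      by blast
    obtain i where "L \<sigma> = Some i" using tot step.prems by blast
    then show ?thesis
      using eq TL_eq_False[OF step.prems(1) False, of x] TL_not_None[OF step.prems(1), of x]
        coherent_True[OF coh step.prems(1) False] coherent_False[OF coh step.prems(1) False]
      by (cases i) auto
  qed
qed

lemma n_val_ge: "enat m \<le> n_val (as_map x) \<longleftrightarrow> (\<forall>l<m. TL x [l] = Some False)"
proof -
  let ?A = "{enat j |j. \<forall>m<j. TL x [m] = Some False}"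
  have n: "n_val (as_map x) = Sup ?A" using as_map_not_fin by (simp add: n_val_def)
  show ?thesis
  proof
    assume "\<forall>l<m. TL x [l] = Some False"
    then show "enat m \<le> n_val (as_map x)" unfolding n by (intro Sup_upper) blast
  next
    assume le: "enat m \<le> n_val (as_map x)"
    show "\<forall>l<m. TL x [l] = Some False"
    proof (intro allI impI, rule ccontr)
      fix l assume l: "l < m" "TL x [l] \<noteq> Some False"
      have "Sup ?A \<le> enat l"
      proof (rule Sup_least)
        fix a assume "a \<in> ?A"
        then obtain j where "a = enat j" "\<forall>m<j. TL x [m] = Some False" by blast
        then show "a \<le> enat l" using l(2) by (metis enat_ord_simps(1) not_le)
      qed
      then have "enat m \<le> enat l" using le unfolding n by (rule order_trans[rotated])
      then show False using l(1) by simp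
    qed
  qed
qed

lemma n_val_eq: "\<forall>l<m. TL x [l] = Some False \<Longrightarrow> TL x [m] \<noteq> Some False \<Longrightarrow> n_val (as_map x) = enat m"
proof -
  assume *: "\<forall>l<m. TL x [l] = Some False" "TL x [m] \<noteq> Some False"
  then have "enat m \<le> n_val (as_map x)" "\<not> enat (Suc m) \<le> n_val (as_map x)"
    using n_val_ge lessI by blast+
  then show ?thesis
    by (cases "n_val (as_map x)") (auto simp: not_less_eq_eq)
qed

lemma k_val_point: "k_val (as_map x) l = (LEAST k. TL x [l, k] = Some True)"
  using as_map_not_fin by (simp add: k_val_def)

lemma le_star_point: "s \<in> fin_strings \<Longrightarrow> le_star s (as_map x) \<longleftrightarrow> agree astar (lab s) (TL x)"
  by (simp add: le_star_def map_le_agree labelling_def[of s])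

lemma le_star_fin: "s \<in> fin_strings \<Longrightarrow> t \<in> fin_strings \<Longrightarrow> le_star s t \<longleftrightarrow> agree astar (lab s) (lab t)"
  by (simp add: le_star_def map_le_agree labelling_def)

lemma prec_star_preds: "t \<in> fin_strings \<Longrightarrow> {s \<in> fin_strings. prec_star s t} = preds astar t"
  unfolding preds_def using prec_star_prec[of _ t] le_star_fin[of _ t] by (auto simp: prec_star_def)

lemma labelling_fin: "s \<in> fin_strings \<Longrightarrow> labelling s = lab s"
  by (simp add: labelling_def)

lemma k_fin_eq: "s \<in> fin_strings \<Longrightarrow> k_fin s m = (LEAST k. \<not> (\<exists>a. lab s [m, k, a] = Some True))"
  by (simp add: k_fin_def labelling_def)

lemma triple_below: "[m, k, a] \<in> nodes_below astar"
  using node_triple_below by (auto simp: nodes_below_def)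

lemma TL_pair: "TL x [l, k] = Some True \<longleftrightarrow> (\<forall>a. TL x [l, k, a] = Some False)"
  using TL_eq_True[of "[l, k]" astar x] node_pair zero_below_astar by (auto simp: underS_iff)

lemma TL_single: "TL x [l] = Some False \<longleftrightarrow> (\<exists>k. TL x [l, k] = Some True)"
  using TL_eq_False[of "[l]" top_elt x] node_single least_lt_top by (auto simp: underS_iff)

lemma TL_triple: "TL x [l, k, a] = Some False \<longleftrightarrow> TL x [l, k, a] \<noteq> Some True"
proof -
  obtain c where "node R fs [l, k, a] c" using node_triple_below by blast
  then have "TL x [l, k, a] \<noteq> None" by (rule TL_not_None)
  then show ?thesis by auto
qed

text \<open>Once all \<open>k\<^sup>s(l)\<close>, \<open>l < m\<close>, have reached their limits, \<open>n\<^sup>s\<close> grows along the true initial segments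
  until it is at least \<open>m\<close>.\<close>

lemma ex_sq_le:
  assumes m: "enat m \<le> n_val (as_map x)"
  obtains s where "s \<in> fin_strings" "sq_le m s (as_map x)"
proof -
  let ?T = "TL x"
  note T = total_lab_TL[of x]
  define tr where "tr n \<longleftrightarrow> true_at ?T astar n" for n
  have unb: "\<exists>n\<ge>N. tr n" for N unfolding tr_def using true_at_infinite[OF T astar_Field] by blast
  have lab_T: "?T \<sigma> = Some i" if "tr n" "\<sigma> \<in> nodes_below astar" "lab (pfx ?T n) \<sigma> = Some i" for n \<sigma> i
    using that agreeD unfolding tr_def true_at_def by blast
  \<comment> \<open>Each candidate below the true value is refuted by some node
    \<open>[l, j, a]\<close> with label 1, which all late true stages see. The true value is refuted
    at no true stage.\<close>
  have k: "\<exists>N. \<forall>n\<ge>N. tr n \<longrightarrow> k_fin (pfx ?T n) l = k_val (as_map x) l" if l: "l < m" for l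
  proof -
    define k where "k = k_val (as_map x) l"
    have "\<exists>k. ?T [l, k] = Some True" using l m n_val_ge TL_single by blast
    then have "?T [l, k] = Some True" unfolding k_def k_val_point by (rule LeastI_ex)
    then have ka: "?T [l, k, a] = Some False" for a using TL_pair by blast
    have "\<exists>n. \<forall>n'\<ge>n. tr n' \<longrightarrow> (\<exists>a. lab (pfx ?T n') [l, j, a] = Some True)" if "j < k" for j
    proof -
      have "?T [l, j] \<noteq> Some True" using that not_less_Least unfolding k_def k_val_point by blast
      then obtain a where a: "?T [l, j, a] = Some True" using TL_pair TL_triple by blast
      obtain n i where n: "tr n" "lab (pfx ?T n) [l, j, a] = Some i"
        using true_at_covers[OF T astar_Field triple_below] unfolding tr_def by blast
      then have "i = True" using lab_T[OF n(1) triple_below n(2)] a by simp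
      then show ?thesis
        using true_at_mono[OF T, of astar n] triple_below n unfolding tr_def by blast
    qed
    then obtain g where g: "\<And>j n'. j < k \<Longrightarrow> n' \<ge> g j \<Longrightarrow> tr n' \<Longrightarrow>
        \<exists>a. lab (pfx ?T n') [l, j, a] = Some True" by metis
    define N where "N = Max (insert 0 (g ` {..<k}))"
    have "k_fin (pfx ?T n) l = k" if n: "n \<ge> N" "tr n" for n
      unfolding k_fin_eq[OF pfx_fin[OF T]]
    proof (rule Least_equality)
      show "\<nexists>a. lab (pfx ?T n) [l, k, a] = Some True"
        using lab_T[OF n(2) triple_below] ka by fastforce
      fix j assume j: "\<nexists>a. lab (pfx ?T n) [l, j, a] = Some True"
      show "k \<le> j"
      proof (rule ccontr)
        assume "\<not> k \<le> j"
        moreover from this have "g j \<le> N" unfolding N_def by (intro Max_ge) auto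
        ultimately show False using g[of j n] n j by simp
      qed
    qed
    then show ?thesis unfolding k_def by blast
  qed
  then obtain h where h: "\<And>l n. l < m \<Longrightarrow> n \<ge> h l \<Longrightarrow> tr n \<Longrightarrow> k_fin (pfx ?T n) l = k_val (as_map x) l"
    by metis
  define N where "N = Max (insert 0 (h ` {..<m}))"
  have kN: "k_fin (pfx ?T n) l = k_val (as_map x) l" if "n \<ge> N" "tr n" "l < m" for n l
  proof -
    have "h l \<le> N" unfolding N_def using that by (intro Max_ge) auto
    then show ?thesis using h that by simp
  qed
  have grow: "\<exists>n\<ge>N. tr n \<and> i \<le> n_fin (pfx ?T n)" if "i \<le> m" for i
    using that
  proof (induction i)
    case 0 then show ?case using unb by blast
  next
    case (Suc i)
    then obtain n0 where n0: "n0 \<ge> N" "tr n0" "i \<le> n_fin (pfx ?T n0)" by auto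
    \<comment> \<open>Taking the next true stage makes the stage \<open>n0\<close> the longest
      predecessor, that is, the one from which \<open>n_fin\<close> is computed.\<close>
    define n where "n = (LEAST n. n0 < n \<and> tr n)"
    have "\<exists>n. n0 < n \<and> tr n" using unb[of "Suc n0"] Suc_le_lessD by blast
    then have n: "n0 < n" "tr n" unfolding n_def by (metis (mono_tags, lifting) LeastI_ex)+
    have nmin: "m' \<le> n0" if "m' < n" "tr m'" for m'
      using that not_less_Least[of m' "\<lambda>n. n0 < n \<and> tr n"] unfolding n_def[symmetric] by auto
    have tn: "true_at ?T astar n" using n(2) by (simp add: tr_def)
    have "pfx ?T n0 \<in> preds astar (pfx ?T n)" using preds_pfx[OF T tn] n n0 by (auto simp: tr_def)
    then have ne: "preds astar (pfx ?T n) \<noteq> {}" by blast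
    have "longest (preds astar (pfx ?T n)) = pfx ?T n0"
    proof (rule longest_preds_pfx[OF T tn ne])
      fix m' assume m': "longest (preds astar (pfx ?T n)) = pfx ?T m'" "m' < n" "true_at ?T astar m'"
        "\<And>m''. m'' < n \<Longrightarrow> true_at ?T astar m'' \<Longrightarrow> m'' \<le> m'"
      then have "m' = n0" using nmin n(1) n0(2) by (simp add: tr_def le_antisym)
      then show ?thesis using m' by simp
    qed
    then have lon: "longest {s \<in> fin_strings. prec_star s (pfx ?T n)} = pfx ?T n0"
      using prec_star_preds[OF pfx_fin[OF T]] by simp
    have pn: "pfx ?T n \<in> fin_strings" by (rule pfx_fin[OF T])
    have "pfx ?T n \<noteq> Map.empty" using card_pfx[OF T, of n] n(1) by auto
    then have eq: "n_fin (pfx ?T n) =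
      (if \<exists>m a. m < n_fin (pfx ?T n0) \<and> lab (pfx ?T n) [m, k_fin (pfx ?T n0) m, a] = Some True
       then LEAST m. m < n_fin (pfx ?T n0) \<and> (\<exists>a. lab (pfx ?T n) [m, k_fin (pfx ?T n0) m, a] = Some True)
       else n_fin (pfx ?T n0) + 1)"
      unfolding n_fin.simps[of "pfx ?T n"] Let_def lon labelling_fin[OF pn]
      using pn by (intro if_not_P) simp
    have no: "lab (pfx ?T n) [l, k_fin (pfx ?T n0) l, a] \<noteq> Some True" if l: "l < m" for l a
    proof -
      have "\<exists>k. ?T [l, k] = Some True" using l m n_val_ge TL_single by blast
      then have "?T [l, k_val (as_map x) l] = Some True" unfolding k_val_point by (rule LeastI_ex)
      then have "?T [l, k_fin (pfx ?T n0) l, a] = Some False" using TL_pair kN[OF n0(1,2) l] by metis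
      then show ?thesis using lab_T[OF n(2) triple_below] by fastforce
    qed
    \<comment> \<open>The values below \<open>m\<close> can no longer be refuted, so a refutation
      resets \<open>n_fin\<close> to an index of at least \<open>m\<close>; otherwise it grows by
      one.\<close>
    have "Suc i \<le> n_fin (pfx ?T n)"
    proof (cases "\<exists>m a. m < n_fin (pfx ?T n0) \<and> lab (pfx ?T n) [m, k_fin (pfx ?T n0) m, a] = Some True")
      case True
      then have "\<exists>l. l < n_fin (pfx ?T n0) \<and> (\<exists>a. lab (pfx ?T n) [l, k_fin (pfx ?T n0) l, a] = Some True)"
        by blast
      from LeastI_ex[OF this] have "\<exists>a. lab (pfx ?T n) [n_fin (pfx ?T n), k_fin (pfx ?T n0) (n_fin (pfx ?T n)), a] = Some True"
        unfolding eq if_P[OF True] by blast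
      then have "m \<le> n_fin (pfx ?T n)" using no by (meson not_le)
      then show ?thesis using Suc.prems by simp
    next
      case False
      then have "n_fin (pfx ?T n) = n_fin (pfx ?T n0) + 1" unfolding eq by (rule if_not_P)
      then show ?thesis using n0(3) by simp
    qed
    then show ?case using n n0 by (meson le_trans less_imp_le_nat)
  qed
  then obtain n where n: "n \<ge> N" "tr n" "m \<le> n_fin (pfx ?T n)" by blast
  have pn: "pfx ?T n \<in> fin_strings" by (rule pfx_fin[OF T])
  have "sq_le m (pfx ?T n) (as_map x)"
    unfolding sq_le_def using n m kN[OF n(1,2)] pn le_star_point[OF pn]
    by (simp add: n_val_def[of "pfx ?T n"] k_val_def[of "pfx ?T n"] tr_def true_at_def)
  then show ?thesis using that pn by blast
qed

section \<open>Conditions\<close>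

text \<open>The domain stops at rank \<open>astar\<close>. The nodes \<open>[m]\<close> have rank
  \<open>top_elt\<close> and stay unlabelled, since their labels determine n^x, which has to remain
  open.\<close>

definition cond :: "condition \<Rightarrow> bool" where
  "cond d \<longleftrightarrow> finite (dom (fst d)) \<and> finite (dom (snd d)) \<and>
    dom (fst d) \<subseteq> nodes_below top_elt \<and> coherent (fst d)"

definition ext ::
  "condition \<Rightarrow> condition \<Rightarrow> bool" where
  "ext d e \<longleftrightarrow> fst d \<subseteq>\<^sub>m fst e \<and> snd d \<subseteq>\<^sub>m snd e"

text \<open>Extensions that do not promise anything new about the nodes \<open>\<langle>m, k\<rangle>\<close>.\<close>

definition sext ::
  "condition \<Rightarrow> condition \<Rightarrow> bool" where
  "sext d e \<longleftrightarrow> ext d e \<and> (\<forall>m k. fst e [m, k] = Some True \<longrightarrow> fst d [m, k] = Some True)"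

definition holds ::
  "condition \<Rightarrow> point \<Rightarrow> bool" where
  "holds d z \<longleftrightarrow> fst d \<subseteq>\<^sub>m TL (fst z) \<and> snd d \<subseteq>\<^sub>m Some \<circ> snd z"

text \<open>Density is demanded through extensions without promises, so that meeting countably many
  dense sets does not influence n^x.\<close>

definition sdense :: "condition set \<Rightarrow> bool" where
  "sdense D \<longleftrightarrow> (\<forall>d. cond d \<longrightarrow> (\<exists>e\<in>D. cond e \<and> sext d e))"

text \<open>No filter is recorded: conditions that hold at a common point are compatible by
  \<open>cond_join\<close>.\<close>

definition generic ::
  "condition set set \<Rightarrow> point \<Rightarrow> bool" where
  "generic \<D> z \<longleftrightarrow> (\<forall>D\<in>\<D>. \<exists>d\<in>D. cond d \<and> holds d z)"

lemma map_leD: "f \<subseteq>\<^sub>m g \<Longrightarrow> f a = Some i \<Longrightarrow> g a = Some i"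
  unfolding map_le_def by (metis domI)

lemma map_leI: "(\<And>a i. f a = Some i \<Longrightarrow> g a = Some i) \<Longrightarrow> f \<subseteq>\<^sub>m g"
  by (auto simp: map_le_def)

lemma ext_refl: "ext d d"
  by (simp add: ext_def)

lemma ext_trans: "ext d e \<Longrightarrow> ext e f \<Longrightarrow> ext d f"
  unfolding ext_def by (meson map_le_trans)

lemma sext_refl: "sext d d"
  by (simp add: sext_def ext_refl)

lemma sext_trans: "sext d e \<Longrightarrow> sext e f \<Longrightarrow> sext d f"
  unfolding sext_def using ext_trans by blast

lemma sext_ext: "sext d e \<Longrightarrow> ext d e"
  by (simp add: sext_def)

lemma holds_ext: "ext d e \<Longrightarrow> holds e z \<Longrightarrow> holds d z"
  unfolding ext_def holds_def by (meson map_le_trans)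

lemma nodes_below_mono: "(b, c) \<in> R \<Longrightarrow> nodes_below b \<subseteq> nodes_below c"
  unfolding nodes_below_def using lt_le_trans by blast

lemma nodes_below_iff: "node R fs \<sigma> c \<Longrightarrow> \<sigma> \<in> nodes_below b \<longleftrightarrow> c \<in> underS R b"
  unfolding nodes_below_def using node_unique by blast

lemma pair_not_below: "(b, astar) \<in> R \<Longrightarrow> [m, k] \<notin> nodes_below b"
  using nodes_below_iff[of "[m, k]" astar b] node_pair lt_not_le by blast

lemma sext_below:
  assumes "ext d e" "(b, astar) \<in> R" "dom (fst e) \<subseteq> dom (fst d) \<union> nodes_below b"
  shows "sext d e"
  unfolding sext_def
proof (intro conjI allI impI)
  fix m k assume e: "fst e [m, k] = Some True"
  then have "[m, k] \<in> dom (fst d)" using pair_not_below[OF assms(2)] assms(3) by blast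
  then obtain i where "fst d [m, k] = Some i" by blast
  then show "fst d [m, k] = Some True" using e map_leD assms(1) unfolding ext_def by fastforce
qed (rule assms(1))

section \<open>Adding labels to conditions\<close>

lemma cond_empty: "cond (Map.empty, Map.empty)"
  by (simp add: cond_def coherent_def)

lemma cond_update_snd: "cond d \<Longrightarrow> finite (dom u) \<Longrightarrow> cond (fst d, u)"
  by (simp add: cond_def)

text \<open>The index differs from the entry at position \<open>length \<sigma>\<close> of every
  labelled node. So the children of the new child are unlabelled too, and giving it the label 1 is
  safe.\<close>

lemma fresh_child:
  assumes "finite (dom (p :: nat list \<rightharpoonup> bool))"
  obtains k where "p (\<sigma> @ [k]) = None" "\<And>j. p (\<sigma> @ [k] @ [j]) = None"
proof -
  have "finite ((\<lambda>\<rho>. \<rho> ! length \<sigma>) ` dom p)" using assms by simp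
  then obtain k where k: "k \<notin> (\<lambda>\<rho>. \<rho> ! length \<sigma>) ` dom p"
    using ex_new_if_finite[OF infinite_UNIV_nat] by blast
  have "p \<rho> = None" if "\<rho> ! length \<sigma> = k" for \<rho> using k that by force
  then show ?thesis using that[of k] by (simp add: nth_append)
qed

text \<open>The label 0 never conflicts with the parent, and its witness is a label 1 at a fresh
  child; a leaf needs no witness. The bound on the new domain shows later that no promise was
  made.\<close>

lemma cond_label_False:
  assumes d: "cond d" and \<sigma>: "node R fs \<sigma> b" "(b, astar) \<in> R" "fst d \<sigma> = None"
  obtains e where "cond e" "ext d e" "snd e = snd d" "fst e \<sigma> = Some False"
    "dom (fst e) \<subseteq> dom (fst d) \<union> {\<sigma>} \<union> (range (\<lambda>k. \<sigma> @ [k]) \<inter> nodes_below b)"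
proof -
  define p where "p = fst d"
  have p: "finite (dom p)" "dom p \<subseteq> nodes_below top_elt" "coherent p" "p \<sigma> = None"
    using d \<sigma> by (auto simp: cond_def p_def)
  have \<sigma>t: "\<sigma> \<in> nodes_below top_elt" using \<sigma> lt_top_iff by (auto simp: nodes_below_def)
  show ?thesis
  proof (cases "b = least_elt")
    case True
    have leaf: "b' = least_elt" if "node R fs \<sigma> b'" for b' using node_unique[OF that \<sigma>(1)] True by simp
    have "coherent (p(\<sigma> \<mapsto> False))"
      unfolding coherent_def
    proof (intro allI impI conjI)
      fix \<tau> c k assume "node R fs \<tau> c \<and> c \<noteq> least_elt" "(p(\<sigma> \<mapsto> False)) \<tau> = Some True"
      then show "(p(\<sigma> \<mapsto> False)) (\<tau> @ [k]) \<noteq> Some True"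
        using coherent_True[OF p(3), of \<tau> c k] by (auto split: if_splits)
    next
      fix \<tau> c assume \<tau>: "node R fs \<tau> c \<and> c \<noteq> least_elt" "(p(\<sigma> \<mapsto> False)) \<tau> = Some False"
      then have "\<tau> \<noteq> \<sigma>" using leaf by blast
      then obtain k where k: "p (\<tau> @ [k]) = Some True"
        using coherent_False[OF p(3), of \<tau> c] \<tau> by auto
      moreover from this have "\<tau> @ [k] \<noteq> \<sigma>" using p(4) by auto
      ultimately show "\<exists>k. (p(\<sigma> \<mapsto> False)) (\<tau> @ [k]) = Some True" by (auto intro!: exI[of _ k])
    qed
    then have "cond (p(\<sigma> \<mapsto> False), snd d)" using d p \<sigma>t by (auto simp: cond_def)
    moreover have "ext d (p(\<sigma> \<mapsto> False), snd d)" using p(4) by (auto simp: ext_def p_def map_le_def)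
    ultimately show ?thesis by (rule that) (auto simp: p_def)
  next
    case False
    obtain k where k: "p (\<sigma> @ [k]) = None" "\<And>j. p (\<sigma> @ [k] @ [j]) = None"
      using fresh_child[OF p(1), of \<sigma>] by blast
    have below: "\<sigma> @ [k] \<in> nodes_below b" using children_below[OF \<sigma>(1) False] .
    have kt: "\<sigma> @ [k] \<in> nodes_below top_elt"
      using below nodes_below_mono[OF le_top[OF node_Field[OF \<sigma>(1)]]] by blast
    define q where "q = p(\<sigma> \<mapsto> False, \<sigma> @ [k] \<mapsto> True)"
    have q: "q \<sigma> = Some False" "q (\<sigma> @ [k]) = Some True"
      "\<And>\<tau>. \<tau> \<noteq> \<sigma> \<Longrightarrow> \<tau> \<noteq> \<sigma> @ [k] \<Longrightarrow> q \<tau> = p \<tau>" by (auto simp: q_def)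
    have "coherent q"
      unfolding coherent_def
    proof (intro allI impI conjI)
      fix \<tau> c j assume \<tau>: "node R fs \<tau> c \<and> c \<noteq> least_elt" "q \<tau> = Some True"
      show "q (\<tau> @ [j]) \<noteq> Some True"
      proof (cases "\<tau> = \<sigma> @ [k]")
        case True
        then show ?thesis using k(2)[of j] q(3)[of "\<tau> @ [j]"] by simp
      next
        case nk: False
        then have "\<tau> \<noteq> \<sigma>" using \<tau>(2) q(1) by auto
        then have "p (\<tau> @ [j]) \<noteq> Some True" "\<tau> @ [j] \<noteq> \<sigma> @ [k]"
          using nk q(3)[of \<tau>] \<tau> coherent_True[OF p(3), of \<tau> c j] by auto
        then show ?thesis using q(1) q(3)[of "\<tau> @ [j]"] by (cases "\<tau> @ [j] = \<sigma>") auto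
      qed
    next
      fix \<tau> c assume \<tau>: "node R fs \<tau> c \<and> c \<noteq> least_elt" "q \<tau> = Some False"
      show "\<exists>k. q (\<tau> @ [k]) = Some True"
      proof (cases "\<tau> = \<sigma>")
        case True then show ?thesis using q(2) by blast
      next
        case n: False
        then have "\<tau> \<noteq> \<sigma> @ [k]" using \<tau>(2) q(2) by auto
        then obtain j where j: "p (\<tau> @ [j]) = Some True"
          using coherent_False[OF p(3), of \<tau> c] \<tau> n q(3)[of \<tau>] by auto
        then have "\<tau> @ [j] \<noteq> \<sigma>" "\<tau> @ [j] \<noteq> \<sigma> @ [k]" using p(4) k(1) by (metis option.distinct(1))+
        then show ?thesis using j q(3)[of "\<tau> @ [j]"] by auto
      qed
    qed
    then have "cond (q, snd d)" using d p \<sigma>t kt by (auto simp: cond_def q_def)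
    moreover have "ext d (q, snd d)"
      using p(4) k(1) by (auto simp: ext_def p_def map_le_def q_def)
    ultimately show ?thesis
    proof (rule that)
      show "dom (fst (q, snd d)) \<subseteq> dom (fst d) \<union> {\<sigma>} \<union> (range (\<lambda>k. \<sigma> @ [k]) \<inter> nodes_below b)"
        using below by (auto simp: q_def p_def)
    qed (simp_all add: q)
  qed
qed

lemma cond_label_set:
  assumes "finite A" "A \<subseteq> nodes_below b" "(b, astar) \<in> R" "cond d"
  shows "\<exists>e. cond e \<and> ext d e \<and> snd e = snd d \<and> A \<subseteq> dom (fst e) \<and>
    dom (fst e) \<subseteq> dom (fst d) \<union> nodes_below b"
  using assms(1,2)
proof (induction A rule: finite_induct)
  case empty
  then show ?case using assms(4) ext_refl by (intro exI[of _ d]) auto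
next
  case (insert \<sigma> A)
  then obtain e where e: "cond e" "ext d e" "snd e = snd d" "A \<subseteq> dom (fst e)"
    "dom (fst e) \<subseteq> dom (fst d) \<union> nodes_below b" by auto
  show ?case
  proof (cases "fst e \<sigma> = None")
    case True
    obtain c where c: "node R fs \<sigma> c" "c \<in> underS R b"
      using insert.prems by (auto simp: nodes_below_def)
    have ca: "(c, astar) \<in> R" using c(2) assms(3) R_trans lt_imp_le by blast
    obtain f where f: "cond f" "ext e f" "snd f = snd e" "fst f \<sigma> = Some False"
      "dom (fst f) \<subseteq> dom (fst e) \<union> {\<sigma>} \<union> (range (\<lambda>k. \<sigma> @ [k]) \<inter> nodes_below c)"
      using cond_label_False[OF e(1) c(1) ca True] .
    have "dom (fst f) \<subseteq> dom (fst d) \<union> nodes_below b"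
      using f(5) e(5) nodes_below_mono[OF lt_imp_le[OF c(2)]] insert.prems by blast
    moreover have "A \<subseteq> dom (fst f)"
      using e(4) f(2) map_le_implies_dom_le[of "fst e" "fst f"] by (auto simp: ext_def)
    ultimately show ?thesis using f e ext_trans[OF e(2) f(2)] by (intro exI[of _ f]) auto
  next
    case False
    then show ?thesis using e by blast
  qed
qed

text \<open>A fundamental sequence is increasing and cofinal, so it stays below \<open>b\<close>
  only finitely often. At a successor rank, all children have the predecessor as their rank, which
  is not below \<open>b\<close>.\<close>

lemma finite_children_below:
  assumes "node R fs \<sigma> c" "b \<in> underS R c"
  shows "finite {k. \<sigma> @ [k] \<in> nodes_below b}"
proof (cases "limit_point R c")
  case True
  then obtain k0 where k0: "(b, fs c k0) \<in> R"
    using fund assms(2) True unfolding fundamental_sequences_def by blast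
  have "\<sigma> @ [k] \<notin> nodes_below b" if "k0 < k" for k
  proof -
    have "fs c k0 \<in> underS R (fs c k)"
      using fund True that unfolding fundamental_sequences_def by blast
    then have "(b, fs c k) \<in> R" using k0 R_trans lt_imp_le by blast
    then show ?thesis
      using nodes_below_iff[OF node.limit_child[OF assms(1) True]] lt_not_le by blast
  qed
  then have "{k. \<sigma> @ [k] \<in> nodes_below b} \<subseteq> {..k0}" using not_le by blast
  then show ?thesis using finite_subset by blast
next
  case False
  then obtain a where a: "imm_succ R a c"
    using assms(2) underS_Field2 unfolding limit_point_def by blast
  have "\<sigma> @ [k] \<notin> nodes_below b" for k
    using nodes_below_iff[OF node.succ_child[OF assms(1) a]] imm_succ_le[OF a assms(2)] lt_not_le
    by blast
  then show ?thesis by simp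
qed

text \<open>Labelled nodes of rank above \<open>b\<close> have finitely many children of rank below
  \<open>b\<close>. Labelling all of these prevents later labels below \<open>b\<close> from
  refuting a label 1 above \<open>b\<close>. The added nodes lie below \<open>b\<close> and create
  no new obligations.\<close>

lemma cond_complete:
  assumes d: "cond d" and b: "(b, astar) \<in> R"
  obtains e where "cond e" "ext d e" "snd e = snd d" "dom (fst e) \<subseteq> dom (fst d) \<union> nodes_below b"
    "\<And>\<sigma> c k. fst e \<sigma> = Some True \<Longrightarrow> node R fs \<sigma> c \<Longrightarrow> b \<in> underS R c \<Longrightarrow> \<sigma> @ [k] \<in> nodes_below b \<Longrightarrow>
      \<sigma> @ [k] \<in> dom (fst e)"
proof -
  define D where "D = {\<sigma> \<in> dom (fst d). \<exists>c. node R fs \<sigma> c \<and> b \<in> underS R c}"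
  define A where "A = (\<Union>\<sigma>\<in>D. (\<lambda>k. \<sigma> @ [k]) ` {k. \<sigma> @ [k] \<in> nodes_below b})"
  have "finite D" using d by (auto simp: D_def cond_def)
  moreover have "finite {k. \<sigma> @ [k] \<in> nodes_below b}" if "\<sigma> \<in> D" for \<sigma>
    using that finite_children_below by (auto simp: D_def)
  ultimately have "finite A" unfolding A_def by blast
  moreover have "A \<subseteq> nodes_below b" by (auto simp: A_def)
  ultimately obtain e where e: "cond e" "ext d e" "snd e = snd d" "A \<subseteq> dom (fst e)"
    "dom (fst e) \<subseteq> dom (fst d) \<union> nodes_below b"
    using cond_label_set[OF _ _ b d] by blast
  show ?thesis
  proof (rule that[OF e(1-3,5)])
    fix \<sigma> c k
    assume *: "fst e \<sigma> = Some True" "node R fs \<sigma> c" "b \<in> underS R c" "\<sigma> @ [k] \<in> nodes_below b"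
    have "\<sigma> \<notin> nodes_below b" using nodes_below_iff[OF *(2)] *(3) lt_not_le lt_imp_le by blast
    then have "\<sigma> \<in> D" using e(5) * by (auto simp: D_def)
    then show "\<sigma> @ [k] \<in> dom (fst e)" using e(4) *(4) by (auto simp: A_def)
  qed
qed

section \<open>Deciding a set without new promises\<close>

definition nodes_upto :: "nat \<Rightarrow> nat list set" where
  "nodes_upto b = {\<sigma>. \<exists>c. node R fs \<sigma> c \<and> (c, b) \<in> R}"

lemma nodes_upto_child: "node R fs \<sigma> c \<Longrightarrow> (c, b) \<in> R \<Longrightarrow> node R fs (\<sigma> @ [k]) c' \<Longrightarrow> \<sigma> @ [k] \<in> nodes_upto b"
  unfolding nodes_upto_def using node_child_rank R_trans lt_imp_le by blast

lemma nodes_below_upto: "nodes_below b \<subseteq> nodes_upto b"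
  by (auto simp: nodes_below_def nodes_upto_def underS_iff)

lemma nodes_upto_below: "b \<in> underS R c \<Longrightarrow> nodes_upto b \<subseteq> nodes_below c"
  unfolding nodes_below_def nodes_upto_def using le_lt_trans by blast

definition restr :: "nat \<Rightarrow> condition \<Rightarrow> condition" where
  "restr b d = (fst d |` nodes_upto b, snd d)"

lemma ext_restr: "ext (restr b d) d"
  by (auto simp: ext_def restr_def map_le_def)

lemma cond_node: "cond d \<Longrightarrow> fst d \<sigma> = Some i \<Longrightarrow> \<exists>c. node R fs \<sigma> c \<and> (c, astar) \<in> R"
  using lt_top_iff by (fastforce simp: cond_def nodes_below_def)

lemma cond_restr:
  assumes "cond d" shows "cond (restr b d)"
proof -
  have "coherent (fst d |` nodes_upto b)"
    unfolding coherent_def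
  proof (intro allI impI conjI)
    fix \<sigma> c k assume "node R fs \<sigma> c \<and> c \<noteq> least_elt" "(fst d |` nodes_upto b) \<sigma> = Some True"
    then show "(fst d |` nodes_upto b) (\<sigma> @ [k]) \<noteq> Some True"
      using assms coherent_True[of "fst d" \<sigma> c k]
      by (auto simp: cond_def restrict_map_def split: if_splits)
  next
    fix \<sigma> c assume \<sigma>: "node R fs \<sigma> c \<and> c \<noteq> least_elt" "(fst d |` nodes_upto b) \<sigma> = Some False"
    then have "fst d \<sigma> = Some False" "\<sigma> \<in> nodes_upto b" by (auto simp: restrict_map_def split: if_splits)
    moreover from this obtain k where k: "fst d (\<sigma> @ [k]) = Some True"
      using assms coherent_False[of "fst d" \<sigma> c] \<sigma> by (auto simp: cond_def)
    moreover obtain c' where "node R fs (\<sigma> @ [k]) c'" using cond_node[OF assms k] by blast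
    ultimately show "\<exists>k. (fst d |` nodes_upto b) (\<sigma> @ [k]) = Some True"
      using nodes_upto_child by (auto simp: nodes_upto_def restrict_map_def)
  qed
  then show ?thesis using assms by (auto simp: cond_def restr_def)
qed

text \<open>The conditions that force the complement of the set forced by \<open>W\<close>.\<close>

definition forbid ::
  "nat \<Rightarrow> condition set \<Rightarrow> condition set" where
  "forbid b W = {w. cond w \<and> dom (fst w) \<subseteq> nodes_upto b \<and>
    \<not> (\<exists>q r. cond q \<and> ext w q \<and> r \<in> W \<and> ext r q)}"

text \<open>The analogue of retagging in Steel forcing: once \<open>d\<close> is complete at \<open>b\<close>, the part below \<open>b\<close>
  of an extension of its restriction to the ranks up to \<open>b\<close> can be added to \<open>d\<close>.\<close>

lemma sdense_decide:
  assumes b: "(b, astar) \<in> R" and W: "\<And>r. r \<in> W \<Longrightarrow> dom (fst r) \<subseteq> nodes_below b"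
  shows "sdense {d. restr b d \<in> forbid b W \<or> (\<exists>r\<in>W. ext r d)}"
  unfolding sdense_def
proof (intro allI impI)
  fix d assume d: "cond d"
  obtain e where e: "cond e" "ext d e" "snd e = snd d" "dom (fst e) \<subseteq> dom (fst d) \<union> nodes_below b"
    and complete: "\<And>\<sigma> c k. fst e \<sigma> = Some True \<Longrightarrow> node R fs \<sigma> c \<Longrightarrow> b \<in> underS R c \<Longrightarrow>
      \<sigma> @ [k] \<in> nodes_below b \<Longrightarrow> \<sigma> @ [k] \<in> dom (fst e)"
    using cond_complete[OF d b] by blast
  have bF: "b \<in> Field R" using b by (rule FieldI1)
  show "\<exists>e\<in>{d. restr b d \<in> forbid b W \<or> (\<exists>r\<in>W. ext r d)}. cond e \<and> sext d e"
  proof (cases "restr b e \<in> forbid b W")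
    case True
    then show ?thesis using e sext_below[OF e(2) b e(4)] by blast
  next
    case False
    then obtain q r where q: "cond q" "ext (restr b e) q" "r \<in> W" "ext r q"
      using cond_restr[OF e(1)] unfolding forbid_def by (auto simp: restr_def)
    define p where "p = fst e"
    \<comment> \<open>Only the part of \<open>q\<close> below \<open>b\<close> is transplanted. It
      contains the labels of \<open>r\<close>, and it cannot contain promises because
      \<open>b\<close> is at most \<open>astar\<close>.\<close>
    define q' where "q' = fst q |` nodes_below b"
    have pq: "fst q \<sigma> = Some i" if "p \<sigma> = Some i" "\<sigma> \<in> nodes_upto b" for \<sigma> i
      using q(2) that map_leD[of "fst (restr b e)" "fst q" \<sigma> i] by (simp add: ext_def restr_def p_def)
    have q'b: "q' \<sigma> = Some i \<longleftrightarrow> fst q \<sigma> = Some i \<and> \<sigma> \<in> nodes_below b" for \<sigma> i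
      by (auto simp: q'_def restrict_map_def)
    define f where "f = p ++ q'"
    have pf: "f \<sigma> = Some i" if "p \<sigma> = Some i" for \<sigma> i
    proof (cases "\<sigma> \<in> nodes_below b")
      case True
      then show ?thesis using pq[OF that] nodes_below_upto q'b by (auto simp: f_def map_add_Some_iff)
    next
      case False
      then show ?thesis using that by (auto simp: f_def map_add_def q'_def)
    qed
    have qf: "f \<sigma> = Some i" if "q' \<sigma> = Some i" for \<sigma> i using that by (simp add: f_def)
    have fc: "p \<sigma> = Some i \<or> q' \<sigma> = Some i" if "f \<sigma> = Some i" for \<sigma> i
      using that by (auto simp: f_def map_add_Some_iff)
    have cohp: "coherent p" and cohq: "coherent (fst q)" using e(1) q(1) by (auto simp: cond_def p_def)
    have "coherent f"
      unfolding coherent_def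
    proof (intro allI impI conjI notI)
      fix \<sigma> c k
      assume \<sigma>: "node R fs \<sigma> c \<and> c \<noteq> least_elt" "f \<sigma> = Some True" and k: "f (\<sigma> @ [k]) = Some True"
      consider "p \<sigma> = Some True" "p (\<sigma> @ [k]) = Some True"
        | "p \<sigma> = Some True" "q' (\<sigma> @ [k]) = Some True" "p (\<sigma> @ [k]) \<noteq> Some True"
        | "q' \<sigma> = Some True"
        using fc[OF \<sigma>(2)] fc[OF k] by blast
      then show False
      proof cases
        case 1 then show False using coherent_True[OF cohp] \<sigma>(1) by blast
      next
        case 2
        \<comment> \<open>The critical case, an old label 1 with a new child labelled 1. Up to rank
          \<open>b\<close> the old label is also present in \<open>q\<close>, which is coherent;
          above \<open>b\<close> the child had already been labelled by completeness.\<close>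
        show False
        proof (cases "(c, b) \<in> R")
          case True
          then have "fst q \<sigma> = Some True" using pq[OF 2(1)] \<sigma>(1) by (auto simp: nodes_upto_def)
          then show False using coherent_True[OF cohq] \<sigma>(1) 2(2) q'b by blast
        next
          case False
          then have "b \<in> underS R c" using R_total node_Field bF \<sigma>(1) by blast
          then have "\<sigma> @ [k] \<in> dom p"
            using complete[of \<sigma> c k] 2 \<sigma>(1) q'b unfolding p_def by blast
          then obtain i where "p (\<sigma> @ [k]) = Some i" by blast
          then show False using pf[of "\<sigma> @ [k]" i] k 2(3) by simp
        qed
      next
        case 3
        then have s: "\<sigma> \<in> nodes_below b" "fst q \<sigma> = Some True" using q'b by auto
        have "\<sigma> @ [k] \<in> nodes_upto b"
        proof -
          have "\<exists>c'. node R fs (\<sigma> @ [k]) c'"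
            using fc[OF k] cond_node[OF e(1), of "\<sigma> @ [k]" True] q'b by (auto simp: p_def nodes_below_def)
          then show ?thesis using nodes_upto_child \<sigma>(1) s(1) nodes_below_iff lt_imp_le by blast
        qed
        then have "fst q (\<sigma> @ [k]) = Some True" using fc[OF k] pq q'b by blast
        then show False using coherent_True[OF cohq] \<sigma>(1) s(2) by blast
      qed
    next
      fix \<sigma> c assume \<sigma>: "node R fs \<sigma> c \<and> c \<noteq> least_elt" "f \<sigma> = Some False"
      from fc[OF \<sigma>(2)] show "\<exists>k. f (\<sigma> @ [k]) = Some True"
      proof
        assume "p \<sigma> = Some False"
        then show ?thesis using coherent_False[OF cohp] \<sigma>(1) pf by blast
      next
        assume "q' \<sigma> = Some False"
        then have s: "\<sigma> \<in> nodes_below b" "fst q \<sigma> = Some False" using q'b by auto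
        then obtain k where k: "fst q (\<sigma> @ [k]) = Some True"
          using coherent_False[OF cohq] \<sigma>(1) by blast
        have "\<sigma> @ [k] \<in> nodes_below b"
          using children_below[of \<sigma> c k] \<sigma>(1) s(1) nodes_below_iff nodes_below_mono[of c b] lt_imp_le by blast
        then show ?thesis using k q'b qf by blast
      qed
    qed
    moreover have "dom f \<subseteq> dom p \<union> nodes_below b" by (auto simp: f_def q'_def)
    moreover have "nodes_below b \<subseteq> nodes_below top_elt" using nodes_below_mono le_top bF by blast
    moreover have "finite (dom f)" using e(1) q(1) by (simp add: f_def q'_def p_def cond_def)
    ultimately have cf: "cond (f, snd q)" using e(1) q(1) unfolding cond_def p_def by auto
    have eq: "snd e \<subseteq>\<^sub>m snd q" using q(2) by (simp add: ext_def restr_def)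
    moreover have "fst e \<subseteq>\<^sub>m f" by (rule map_leI) (use pf in \<open>simp add: p_def\<close>)
    ultimately have ef: "ext e (f, snd q)" by (simp add: ext_def)
    then have df: "ext d (f, snd q)" using ext_trans e(2) by blast
    have "dom (fst (f, snd q)) \<subseteq> dom (fst d) \<union> nodes_below b"
      using \<open>dom f \<subseteq> dom p \<union> nodes_below b\<close> e(4) by (auto simp: p_def)
    then have "sext d (f, snd q)" using sext_below[OF df b] by blast
    moreover have "ext r (f, snd q)"
    proof -
      have "f \<sigma> = Some i" if "fst r \<sigma> = Some i" for \<sigma> i
      proof -
        have "fst q \<sigma> = Some i" using map_leD[of "fst r" "fst q"] that q(4) by (simp add: ext_def)
        moreover have "\<sigma> \<in> nodes_below b" using W[OF q(3)] that by blast
        ultimately show ?thesis using q'b qf by blast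
      qed
      then have "fst r \<subseteq>\<^sub>m f" by (rule map_leI)
      then show ?thesis using q(4) by (simp add: ext_def)
    qed
    ultimately show ?thesis using cf q(3) by blast
  qed
qed

text \<open>The union is part of the coherent labelling \<open>T\<^sup>x\<close>, so no label 1 is
  refuted; the witness of a label 0 comes with the condition that contains the label.\<close>

lemma cond_join:
  assumes "cond d" "cond e" "holds d z" "holds e z"
  shows "\<exists>q. cond q \<and> ext d q \<and> ext e q \<and> holds q z"
proof -
  let ?T = "TL (fst z)"
  let ?p = "fst d ++ fst e" and ?u = "snd d ++ snd e"
  have dT: "fst d \<subseteq>\<^sub>m ?T" "fst e \<subseteq>\<^sub>m ?T" "snd d \<subseteq>\<^sub>m Some \<circ> snd z" "snd e \<subseteq>\<^sub>m Some \<circ> snd z"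
    using assms by (auto simp: holds_def)
  have p: "?p \<sigma> = Some i \<longleftrightarrow> fst d \<sigma> = Some i \<or> fst e \<sigma> = Some i" for \<sigma> i
    using dT map_leD[of "fst d" ?T \<sigma>] map_leD[of "fst e" ?T \<sigma>]
    by (cases "fst d \<sigma>"; cases "fst e \<sigma>") (auto simp: map_add_Some_iff)
  have u: "?u \<sigma> = Some i \<longleftrightarrow> snd d \<sigma> = Some i \<or> snd e \<sigma> = Some i" for \<sigma> i
    using dT map_leD[of "snd d" "Some \<circ> snd z" \<sigma>] map_leD[of "snd e" "Some \<circ> snd z" \<sigma>]
    by (cases "snd d \<sigma>"; cases "snd e \<sigma>") (auto simp: map_add_Some_iff)
  have pT: "?p \<subseteq>\<^sub>m ?T" using p map_leD[OF dT(1)] map_leD[OF dT(2)] by (intro map_leI) metis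
  have uT: "?u \<subseteq>\<^sub>m Some \<circ> snd z" using u map_leD[OF dT(3)] map_leD[OF dT(4)] by (intro map_leI) metis
  have cohT: "coherent ?T" using total_lab_TL by (simp add: total_lab_def)
  have cohd: "coherent (fst d)" and cohe: "coherent (fst e)" using assms by (auto simp: cond_def)
  have "coherent ?p"
    unfolding coherent_def
  proof (intro allI impI conjI)
    fix \<sigma> c k assume "node R fs \<sigma> c \<and> c \<noteq> least_elt" "?p \<sigma> = Some True"
    then show "?p (\<sigma> @ [k]) \<noteq> Some True"
      using map_leD[OF pT, of \<sigma> True] map_leD[OF pT, of "\<sigma> @ [k]" True] coherent_True[OF cohT, of \<sigma> c k]
      by metis
  next
    fix \<sigma> c assume "node R fs \<sigma> c \<and> c \<noteq> least_elt" "?p \<sigma> = Some False"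
    then show "\<exists>k. ?p (\<sigma> @ [k]) = Some True"
      using p coherent_False[OF cohd, of \<sigma> c] coherent_False[OF cohe, of \<sigma> c] by metis
  qed
  then have "cond (?p, ?u)" using assms(1,2) by (auto simp: cond_def)
  moreover have "ext d (?p, ?u)" "ext e (?p, ?u)"
    using p u by (auto simp: ext_def intro!: map_leI)
  moreover have "holds (?p, ?u) z" using pT uT by (simp add: holds_def)
  ultimately show ?thesis by blast
qed

section \<open>Forcing Borel sets\<close>

lemma Y_topspace: "Y \<subseteq> topspace X_top"
  by (auto simp: Y_def)

lemma topspace_Y_top: "topspace Y_top = Y"
  using Y_topspace by (auto simp: Y_top_def)

text \<open>Takes the place of a recursive forcing relation: on points of \<open>Y\<close> that are
  generic enough, \<open>A\<close> is described by finite positive information of rank below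
  \<open>b\<close>.\<close>

definition SDec :: "nat \<Rightarrow> point set \<Rightarrow> bool" where
  "SDec b A \<longleftrightarrow> (\<exists>W \<D>. (\<forall>w\<in>W. cond w \<and> dom (fst w) \<subseteq> nodes_below b) \<and>
    countable \<D> \<and> (\<forall>D\<in>\<D>. sdense D) \<and>
    (\<forall>z\<in>Y. generic \<D> z \<longrightarrow> (z \<in> A \<longleftrightarrow> (\<exists>w\<in>W. holds w z))))"

lemma generic_subset: "generic \<D> z \<Longrightarrow> \<E> \<subseteq> \<D> \<Longrightarrow> generic \<E> z"
  unfolding generic_def by blast

text \<open>The complement is described by \<open>forbid b W\<close>: such a condition excludes all
  of \<open>W\<close> by \<open>cond_join\<close>, and by density one side is always decided. The
  admissible ranks grow from below \<open>b\<close> to at most \<open>b\<close>.\<close>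

lemma SDec_complement:
  assumes A: "SDec b A" and b: "(b, astar) \<in> R"
  shows "\<exists>W \<D>. (\<forall>w\<in>W. cond w \<and> dom (fst w) \<subseteq> nodes_upto b) \<and>
    countable \<D> \<and> (\<forall>D\<in>\<D>. sdense D) \<and>
    (\<forall>z\<in>Y. generic \<D> z \<longrightarrow> (z \<notin> A \<longleftrightarrow> (\<exists>w\<in>W. holds w z)))"
proof -
  obtain W \<D> where W: "\<forall>w\<in>W. cond w \<and> dom (fst w) \<subseteq> nodes_below b"
    and \<D>: "countable \<D>" "\<forall>D\<in>\<D>. sdense D"
    and dec: "\<And>z. z \<in> Y \<Longrightarrow> generic \<D> z \<Longrightarrow> z \<in> A \<longleftrightarrow> (\<exists>w\<in>W. holds w z)"
    using A unfolding SDec_def by blast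
  define D where "D = {d. restr b d \<in> forbid b W \<or> (\<exists>r\<in>W. ext r d)}"
  have D: "sdense D" unfolding D_def using sdense_decide[OF b] W by blast
  have "z \<notin> A \<longleftrightarrow> (\<exists>w\<in>forbid b W. holds w z)" if z: "z \<in> Y" "generic (insert D \<D>) z" for z
  proof -
    have g: "generic \<D> z" using generic_subset[OF z(2)] by blast
    show ?thesis
    proof
      assume "z \<notin> A"
      then have no: "\<not> (\<exists>w\<in>W. holds w z)" using dec[OF z(1) g] by blast
      obtain d where d: "d \<in> D" "holds d z" using z(2) by (auto simp: generic_def)
      have "\<not> (\<exists>r\<in>W. ext r d)" using no d(2) holds_ext by blast
      then have "restr b d \<in> forbid b W" using d(1) by (simp add: D_def)
      then show "\<exists>w\<in>forbid b W. holds w z" using holds_ext[OF ext_restr d(2)] by blast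
    next
      assume "\<exists>w\<in>forbid b W. holds w z"
      then obtain w where w: "w \<in> forbid b W" "holds w z" by blast
      show "z \<notin> A"
      proof
        assume "z \<in> A"
        then obtain r where r: "r \<in> W" "holds r z" using dec[OF z(1) g] by blast
        obtain q where "cond q" "ext w q" "ext r q"
          using cond_join[of w r z] w r W by (auto simp: forbid_def)
        then show False using w(1) r(1) unfolding forbid_def by blast
      qed
    qed
  qed
  moreover have "\<forall>w\<in>forbid b W. cond w \<and> dom (fst w) \<subseteq> nodes_upto b" by (auto simp: forbid_def)
  moreover have "countable (insert D \<D>)" "\<forall>D\<in>insert D \<D>. sdense D" using \<D> D by auto
  ultimately show ?thesis by blast
qed

text \<open>The ranks up to \<open>b i\<close> lie below \<open>c\<close>, so complementation costs
  exactly one level, and countably many countable families of dense sets remain countable.\<close>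

lemma SDec_union:
  fixes A :: "nat \<Rightarrow> point set"
  assumes A: "\<And>i. b i \<in> underS R c \<and> SDec (b i) (A i)" and c: "c \<in> Field R"
  shows "SDec c (\<Union>i. Y - A i)"
proof -
  have "(b i, astar) \<in> R" for i
    using A[of i] lt_top_iff lt_le_trans[OF _ le_top[OF c]] by blast
  note * = SDec_complement[OF conjunct2[OF A] this]
  define Q where "Q i W \<D> \<longleftrightarrow> (\<forall>w\<in>W. cond w \<and> dom (fst w) \<subseteq> nodes_upto (b i)) \<and>
    countable \<D> \<and> (\<forall>D\<in>\<D>. sdense D) \<and>
    (\<forall>z\<in>Y. generic \<D> z \<longrightarrow> (z \<notin> A i \<longleftrightarrow> (\<exists>w\<in>W. holds w z)))" for i W \<D>
  have "\<exists>W \<D>. Q i W \<D>" for i unfolding Q_def by (rule *)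
  then obtain W \<D> where "\<And>i. Q i (W i) (\<D> i)" by metis
  note W = this[unfolded Q_def]
  have 1: "z \<in> (\<Union>i. Y - A i) \<longleftrightarrow> (\<exists>w\<in>(\<Union>i. W i). holds w z)"
    if z: "z \<in> Y" "generic (\<Union>i. \<D> i) z" for z
  proof -
    have "z \<notin> A i \<longleftrightarrow> (\<exists>w\<in>W i. holds w z)" for i
      using W[of i] z(1) generic_subset[OF z(2), of "\<D> i"] by blast
    then show ?thesis using z(1) by auto
  qed
  have 2: "\<forall>w\<in>(\<Union>i. W i). cond w \<and> dom (fst w) \<subseteq> nodes_below c"
    using W A nodes_upto_below by blast
  have 3: "countable (\<Union>i. \<D> i)" "\<forall>D\<in>(\<Union>i. \<D> i). sdense D" using W by auto
  show ?thesis
    unfolding SDec_def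
    by (rule exI[of _ "\<Union>i. W i"], rule exI[of _ "\<Union>i. \<D> i"], intro conjI 2 3 ballI impI 1)
qed

lemma SDec_topspace: "SDec b Y"
  unfolding SDec_def
  by (rule exI[of _ "{(Map.empty, Map.empty)}"], rule exI[of _ "{}"])
    (use cond_empty in \<open>auto simp: holds_def\<close>)

lemma cantor_open_nbhd:
  assumes "openin (cantor_topology I) U" "x \<in> U"
  obtains F where "finite F" "F \<subseteq> I"
    "\<And>x'. x' \<in> topspace (cantor_topology I) \<Longrightarrow> (\<And>i. i \<in> F \<Longrightarrow> x' i = x i) \<Longrightarrow> x' \<in> U"
proof -
  obtain V where V: "finite {i \<in> I. V i \<noteq> UNIV}" "x \<in> Pi\<^sub>E I V" "Pi\<^sub>E I V \<subseteq> U"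
    using assms unfolding openin_product_topology_alt by fastforce
  show ?thesis
  proof (rule that[OF V(1)])
    fix x' assume x': "x' \<in> topspace (cantor_topology I)" "\<And>i. i \<in> {i \<in> I. V i \<noteq> UNIV} \<Longrightarrow> x' i = x i"
    have "x' i \<in> V i" if "i \<in> I" for i
      using that x'(2)[of i] V(2) by (cases "V i = UNIV") (auto simp: PiE_def)
    then have "x' \<in> Pi\<^sub>E I V" using x'(1) by (auto simp: PiE_def)
    then show "x' \<in> U" using V(3) by blast
  qed auto
qed

text \<open>A basic neighbourhood is given by finitely many leaf labels and bits, so no dense sets
  are needed. Leaves lie below every rank other than \<open>least_elt\<close>.\<close>

lemma SDec_open:
  assumes A: "openin Y_top A" and b: "b \<in> Field R" "b \<noteq> least_elt"
  shows "SDec b A"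
proof -
  define W where "W = {w. cond w \<and> dom (fst w) \<subseteq> leaves \<and> (\<forall>z\<in>Y. holds w z \<longrightarrow> z \<in> A)}"
  obtain U where U: "openin X_top U" "A = U \<inter> Y" using A by (auto simp: Y_top_def openin_subtopology)
  have "\<exists>w\<in>W. holds w z" if z: "z \<in> A" for z
  proof -
    obtain x y where xy: "z = (x, y)" by (cases z)
    have "(x, y) \<in> U" using z U(2) xy by blast
    then obtain U1 U2 where U12: "openin (cantor_topology leaves) U1" "openin (cantor_topology UNIV) U2"
      "x \<in> U1" "y \<in> U2" "U1 \<times> U2 \<subseteq> U"
      using openin_prod_topology_alt[THEN iffD1, OF U(1)[unfolded X_top_def]] by meson
    obtain F where F: "finite F" "F \<subseteq> leaves"
      "\<And>x'. x' \<in> topspace (cantor_topology leaves) \<Longrightarrow> (\<And>i. i \<in> F \<Longrightarrow> x' i = x i) \<Longrightarrow> x' \<in> U1"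
      using cantor_open_nbhd[OF U12(1,3)] by blast
    obtain G where G: "finite G" "G \<subseteq> UNIV"
      "\<And>y'. y' \<in> topspace (cantor_topology UNIV) \<Longrightarrow> (\<And>i. i \<in> G \<Longrightarrow> y' i = y i) \<Longrightarrow> y' \<in> U2"
      using cantor_open_nbhd[OF U12(2,4)] by blast
    define w where "w = ((Some \<circ> x) |` F, (Some \<circ> y) |` G)"
    have dw: "dom (fst w) = F" "dom (snd w) = G" by (auto simp: w_def restrict_map_def dom_def)
    have "coherent (fst w)"
    proof -
      have "fst w \<sigma> = None" if "node R fs \<sigma> c" "c \<noteq> least_elt" for \<sigma> c
        using dw(1) F(2) node_leaves[OF that(1)] that(2) by blast
      then show ?thesis unfolding coherent_def by auto
    qed
    moreover have "leaves \<subseteq> nodes_below top_elt"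
      using least_lt_top by (auto simp: leaves_def nodes_below_def)
    ultimately have "cond w" using dw F G by (auto simp: cond_def)
    moreover have "z' \<in> A" if z': "z' \<in> Y" "holds w z'" for z'
    proof -
      obtain x' y' where xy': "z' = (x', y')" by (cases z')
      have "(x', y') \<in> topspace X_top" using z' Y_topspace xy' by blast
      then have tx: "x' \<in> topspace (cantor_topology leaves)" "y' \<in> topspace (cantor_topology UNIV)"
        by (auto simp: X_top_def)
      have "x' i = x i" if "i \<in> F" for i
      proof -
        have "TL x' i = Some (x i)"
          using z'(2) that xy' map_leD[of "fst w" "TL x'" i "x i"] by (simp add: holds_def w_def)
        then show ?thesis using TL_leaf[of i x'] F(2) that by auto
      qed
      moreover have "y' i = y i" if "i \<in> G" for i
        using z'(2) that xy' map_leD[of "snd w" "Some \<circ> y'" i "y i"] by (simp add: holds_def w_def)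
      ultimately have "(x', y') \<in> U" using F(3)[OF tx(1)] G(3)[OF tx(2)] U12(5) by blast
      then show ?thesis using U(2) z'(1) xy' by blast
    qed
    ultimately have "w \<in> W" using dw F(2) by (simp add: W_def)
    moreover have "fst w \<subseteq>\<^sub>m TL x" "snd w \<subseteq>\<^sub>m Some \<circ> y"
      using TL_leaf F(2) by (auto simp: w_def map_le_def restrict_map_def split: if_splits)
    then have "holds w z" using xy by (simp add: holds_def)
    ultimately show ?thesis by blast
  qed
  then have "z \<in> A \<longleftrightarrow> (\<exists>w\<in>W. holds w z)" if "z \<in> Y" for z
    using that unfolding W_def by blast
  moreover have "leaves \<subseteq> nodes_below b" using least_lt[OF b] by (auto simp: leaves_def nodes_below_def)
  then have "\<forall>w\<in>W. cond w \<and> dom (fst w) \<subseteq> nodes_below b" by (auto simp: W_def)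
  ultimately show ?thesis unfolding SDec_def by (intro exI[of _ W] exI[of _ "{}"]) simp
qed

lemma Restr_Restr_underS:
  assumes "a \<in> underS R b"
  shows "Restr (Restr R (underS R b)) (underS (Restr R (underS R b)) a) = Restr R (underS R a)"
proof -
  have sub: "underS R a \<subseteq> underS R b" using lt_trans[OF _ assms] by blast
  then have "underS (Restr R (underS R b)) a = underS R a"
    using assms by (auto simp: underS_def)
  then show ?thesis using sub by blast
qed

lemma Sigma0_SDec:
  assumes "Sigma0 X r A"
  shows "X = Y_top \<Longrightarrow> b \<in> Field R \<Longrightarrow> r = Restr R (underS R b) \<Longrightarrow> SDec b A"
  using assms
proof (induction arbitrary: b rule: Sigma0.induct)
  case (open_set r A)
  have "b \<noteq> least_elt"
  proof
    assume "b = least_elt"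
    then have "r = {}" using open_set.prems not_lt_least by auto
    then show False using open_set.hyps by simp
  qed
  then show ?case using SDec_open open_set by blast
next
  case (union a r A)
  have "a i \<in> underS R b \<and> SDec (a i) (A i)" for i
  proof -
    have "a i \<in> Field r" using union.IH by blast
    then have ai: "a i \<in> underS R b" using union.prems(3) by (auto simp: Field_def)
    then show ?thesis
      using union.IH[of i] union.prems underS_Field1[OF ai] Restr_Restr_underS[OF ai] by blast
  qed
  then show ?case using SDec_union[of a b A] union.prems topspace_Y_top by simp
qed

section \<open>Generic points\<close>

lemma finite_common_bound:
  assumes "finite A" "\<And>a. a \<in> A \<Longrightarrow> \<exists>n. P a n" "\<And>a m n. P a m \<Longrightarrow> m \<le> n \<Longrightarrow> P a n"
  shows "\<exists>n::nat. \<forall>a\<in>A. P a n"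
  using assms(1,2)
proof (induction A rule: finite_induct)
  case (insert a A)
  then obtain n where n: "\<forall>a\<in>A. P a n" by auto
  obtain m where m: "P a m" using insert.prems by blast
  have "\<forall>b\<in>insert a A. P b (max m n)" using m n assms(3) by (metis insertE max.cobounded1 max.cobounded2)
  then show ?case by blast
qed simp

text \<open>The union of the chain is coherent and total up to \<open>astar\<close>. Reading x off
  its leaves, \<open>TL_unique\<close> identifies the union with \<open>T\<^sup>x\<close>.
  Consequently every finite piece of information about the point is contained in a member of the
  chain.\<close>

lemma chain_point:
  assumes c: "\<And>n. cond (d n)" and step: "\<And>n. ext (d n) (d (Suc n))"
    and cover: "\<And>\<sigma> c. node R fs \<sigma> c \<Longrightarrow> (c, astar) \<in> R \<Longrightarrow> \<exists>n. \<sigma> \<in> dom (fst (d n))"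
    and cover': "\<And>i. \<exists>n. i \<in> dom (snd (d n))"
  obtains x y where "(x, y) \<in> topspace X_top" "\<And>n. holds (d n) (x, y)"
    "\<And>w. finite (dom (fst w)) \<Longrightarrow> finite (dom (snd w)) \<Longrightarrow> dom (fst w) \<subseteq> nodes_upto astar \<Longrightarrow>
      holds w (x, y) \<Longrightarrow> \<exists>n. ext w (d n)"
proof -
  have mono: "ext (d m) (d n)" if "m \<le> n" for m n
    using that by (induction n rule: dec_induct) (auto intro: ext_refl ext_trans step)
  have fmono: "fst (d n) \<sigma> = Some i" if "fst (d m) \<sigma> = Some i" "m \<le> n" for m n \<sigma> i
    using map_leD[of "fst (d m)" "fst (d n)" \<sigma> i] mono[OF that(2)] that(1) by (simp add: ext_def)
  have smono: "snd (d n) \<sigma> = Some i" if "snd (d m) \<sigma> = Some i" "m \<le> n" for m n \<sigma> i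
    using map_leD[of "snd (d m)" "snd (d n)" \<sigma> i] mono[OF that(2)] that(1) by (simp add: ext_def)
  have func: "i = j" if "fst (d m) \<sigma> = Some i" "fst (d n) \<sigma> = Some j" for m n \<sigma> i j
    using fmono[OF that(1), of "max m n"] fmono[OF that(2), of "max m n"] by simp
  have sfunc: "i = j" if "snd (d m) \<sigma> = Some i" "snd (d n) \<sigma> = Some j" for m n \<sigma> i j
    using smono[OF that(1), of "max m n"] smono[OF that(2), of "max m n"] by simp
  define L where "L \<sigma> = (if \<exists>n. fst (d n) \<sigma> = Some True then Some True
    else if \<exists>n. fst (d n) \<sigma> = Some False then Some False else None)" for \<sigma>
  have L: "L \<sigma> = Some i \<longleftrightarrow> (\<exists>n. fst (d n) \<sigma> = Some i)" for \<sigma> i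
    by (cases i) (auto simp: L_def dest: func)
  define x where "x = restrict (\<lambda>\<sigma>. L \<sigma> = Some True) leaves"
  define y where "y i \<longleftrightarrow> (\<exists>n. snd (d n) i = Some True)" for i
  have coh: "coherent L"
    unfolding coherent_def
  proof (intro allI impI conjI notI)
    fix \<sigma> c k assume \<sigma>: "node R fs \<sigma> c \<and> c \<noteq> least_elt" "L \<sigma> = Some True" "L (\<sigma> @ [k]) = Some True"
    then obtain m n where "fst (d m) \<sigma> = Some True" "fst (d n) (\<sigma> @ [k]) = Some True" using L by blast
    then have "fst (d (max m n)) \<sigma> = Some True" "fst (d (max m n)) (\<sigma> @ [k]) = Some True"
      using fmono[OF _ max.cobounded1] fmono[OF _ max.cobounded2] by blast+
    then show False using coherent_True[of "fst (d (max m n))" \<sigma> c k] c \<sigma>(1) by (auto simp: cond_def)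
  next
    fix \<sigma> c assume \<sigma>: "node R fs \<sigma> c \<and> c \<noteq> least_elt" "L \<sigma> = Some False"
    then obtain n where "fst (d n) \<sigma> = Some False" using L by blast
    then obtain k where "fst (d n) (\<sigma> @ [k]) = Some True"
      using coherent_False[of "fst (d n)" \<sigma> c] c \<sigma>(1) by (auto simp: cond_def)
    then show "\<exists>k. L (\<sigma> @ [k]) = Some True" using L by blast
  qed
  have tot: "L \<sigma> \<noteq> None" if "node R fs \<sigma> c" "(c, astar) \<in> R" for \<sigma> c
  proof -
    obtain n i where "fst (d n) \<sigma> = Some i" using cover[OF \<open>node R fs \<sigma> c\<close> \<open>(c, astar) \<in> R\<close>] by blast
    then have "L \<sigma> = Some i" using L by blast
    then show ?thesis by simp
  qed
  have leaf: "L \<sigma> = Some (x \<sigma>)" if "\<sigma> \<in> leaves" for \<sigma>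
  proof -
    have "L \<sigma> \<noteq> None" using tot[of \<sigma> least_elt] that least_le[OF astar_Field] by (simp add: leaves_def)
    then show ?thesis using that by (auto simp: x_def)
  qed
  have LT: "L \<sigma> = TL x \<sigma>" if "\<sigma> \<in> nodes_upto astar" for \<sigma>
    using TL_unique[OF coh tot leaf] that by (auto simp: nodes_upto_def)
  have dT: "TL x \<sigma> = Some i" if "fst (d n) \<sigma> = Some i" for n \<sigma> i
  proof -
    have "\<sigma> \<in> nodes_upto astar" using cond_node[OF c that] by (auto simp: nodes_upto_def)
    then show ?thesis using LT L that by metis
  qed
  have dy: "y j = i" if "snd (d n) j = Some i" for n i j
    using that by (cases i) (auto simp: y_def dest: sfunc)
  show ?thesis
  proof (rule that)
    show "(x, y) \<in> topspace X_top" by (auto simp: X_top_def x_def)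
    show "holds (d n) (x, y)" for n
      using dT dy by (auto simp: holds_def intro!: map_leI)
    fix w assume w: "finite (dom (fst w))" "finite (dom (snd w))" "dom (fst w) \<subseteq> nodes_upto astar"
      "holds w (x, y)"
    have w': "fst w \<subseteq>\<^sub>m TL x" "snd w \<subseteq>\<^sub>m Some \<circ> y" using w(4) by (auto simp: holds_def)
    have "\<exists>n. fst (d n) \<sigma> = fst w \<sigma>" if \<sigma>: "\<sigma> \<in> dom (fst w)" for \<sigma>
    proof -
      obtain i where i: "fst w \<sigma> = Some i" using \<sigma> by blast
      have "L \<sigma> = Some i" using LT[of \<sigma>] \<sigma> w(3) map_leD[OF w'(1) i] by auto
      then show ?thesis using L i by auto
    qed
    then have "\<exists>n. \<forall>\<sigma>\<in>dom (fst w). \<sigma> \<in> dom (fst w) \<and> fst (d n) \<sigma> = fst w \<sigma>"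
      by (intro finite_common_bound[OF w(1)]) (auto intro: fmono)
    then obtain n1 where n1: "\<forall>\<sigma>\<in>dom (fst w). fst (d n1) \<sigma> = fst w \<sigma>" by blast
    have "\<exists>n. snd (d n) j = snd w j" if j: "j \<in> dom (snd w)" for j
    proof -
      obtain i where i: "snd w j = Some i" using j by blast
      obtain n i' where n: "snd (d n) j = Some i'" using cover'[of j] by blast
      then show ?thesis using map_leD[OF w'(2) i] dy[OF n] i by auto
    qed
    then have "\<exists>n. \<forall>j\<in>dom (snd w). j \<in> dom (snd w) \<and> snd (d n) j = snd w j"
      by (intro finite_common_bound[OF w(2)]) (auto intro: smono)
    then obtain n2 where n2: "\<forall>j\<in>dom (snd w). snd (d n2) j = snd w j" by blast
    have "ext w (d (max n1 n2))"
      unfolding ext_def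
    proof (intro conjI map_leI)
      fix \<sigma> i assume "fst w \<sigma> = Some i"
      then have "fst (d n1) \<sigma> = Some i" using n1 by (metis domI)
      then show "fst (d (max n1 n2)) \<sigma> = Some i" by (rule fmono[OF _ max.cobounded1])
    next
      fix j i assume "snd w j = Some i"
      then have "snd (d n2) j = Some i" using n2 by (metis domI)
      then show "snd (d (max n1 n2)) j = Some i" by (rule smono[OF _ max.cobounded2])
    qed
    then show "\<exists>n. ext w (d n)" by blast
  qed
qed

text \<open>Labelling with 0 makes no promise even at a node \<open>[m, k]\<close>, and the required
  witness has smaller rank.\<close>

lemma sdense_label:
  assumes "node R fs \<sigma> b" "(b, astar) \<in> R"
  shows "sdense {e. \<sigma> \<in> dom (fst e)}"
  unfolding sdense_def
proof (intro allI impI)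
  fix d assume d: "cond d"
  show "\<exists>e\<in>{e. \<sigma> \<in> dom (fst e)}. cond e \<and> sext d e"
  proof (cases "fst d \<sigma> = None")
    case True
    obtain e where e: "cond e" "ext d e" "snd e = snd d" "fst e \<sigma> = Some False"
      "dom (fst e) \<subseteq> dom (fst d) \<union> {\<sigma>} \<union> (range (\<lambda>k. \<sigma> @ [k]) \<inter> nodes_below b)"
      using cond_label_False[OF d assms True] .
    have "fst d [m, k] = Some True" if mk: "fst e [m, k] = Some True" for m k
    proof -
      have "[m, k] \<noteq> \<sigma>" using mk e(4) by auto
      moreover have "[m, k] \<notin> nodes_below b" using pair_not_below[OF assms(2)] .
      ultimately have "[m, k] \<in> dom (fst d)" using mk e(5) by blast
      then obtain i where i: "fst d [m, k] = Some i" by blast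
      then have "fst e [m, k] = Some i" using e(2) map_leD[of "fst d" "fst e"] by (simp add: ext_def)
      then show ?thesis using mk i by simp
    qed
    then have "sext d e" using e(2) by (simp add: sext_def)
    then show ?thesis using e by blast
  next
    case False
    then show ?thesis using d sext_refl by blast
  qed
qed

lemma sdense_bit: "sdense {e. i \<in> dom (snd e)}"
  unfolding sdense_def
proof (intro allI impI)
  fix d assume d: "cond d"
  show "\<exists>e\<in>{e. i \<in> dom (snd e)}. cond e \<and> sext d e"
  proof (cases "snd d i = None")
    case True
    have "cond (fst d, (snd d)(i \<mapsto> False))" using d by (simp add: cond_def)
    moreover have "sext d (fst d, (snd d)(i \<mapsto> False))"
      using True by (auto simp: sext_def ext_def map_le_def)
    ultimately show ?thesis by (intro bexI[of _ "(fst d, (snd d)(i \<mapsto> False))"]) auto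
  next
    case False
    then show ?thesis using d sext_refl by blast
  qed
qed

lemma countable_total_sets:
  obtains \<T> where "countable \<T>" "\<And>D. D \<in> \<T> \<Longrightarrow> sdense D"
    "\<And>\<sigma>. \<sigma> \<in> nodes_upto astar \<Longrightarrow> {e. \<sigma> \<in> dom (fst e)} \<in> \<T>" "\<And>i. {e. i \<in> dom (snd e)} \<in> \<T>"
proof (rule that)
  let ?T = "(\<lambda>\<sigma>. {e. \<sigma> \<in> dom (fst e)}) ` nodes_upto astar \<union> range (\<lambda>i::nat. {e. i \<in> dom (snd e)})"
  show "countable ?T" by auto
  show "sdense D" if "D \<in> ?T" for D
    using that sdense_label sdense_bit by (auto simp: nodes_upto_def)
qed auto

text \<open>All members of the chain extend \<open>d\<close> without promises. A label 1 of x at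
  \<open>[m, k]\<close> occurs in some member, so it was already in \<open>d\<close>.\<close>

lemma generic_point:
  assumes d: "cond d" and D: "countable \<D>" "\<And>D. D \<in> \<D> \<Longrightarrow> sdense D"
  obtains x y where "(x, y) \<in> topspace X_top" "holds d (x, y)" "generic \<D> (x, y)"
    "\<And>m k. TL x [m, k] = Some True \<Longrightarrow> fst d [m, k] = Some True"
    "\<And>w. finite (dom (fst w)) \<Longrightarrow> finite (dom (snd w)) \<Longrightarrow> dom (fst w) \<subseteq> nodes_upto astar \<Longrightarrow>
      holds w (x, y) \<Longrightarrow> \<exists>e. cond e \<and> sext d e \<and> ext w e \<and> holds e (x, y)"
proof -
  obtain \<T> where \<T>: "countable \<T>" "\<And>D. D \<in> \<T> \<Longrightarrow> sdense D"
    "\<And>\<sigma>. \<sigma> \<in> nodes_upto astar \<Longrightarrow> {e. \<sigma> \<in> dom (fst e)} \<in> \<T>" "\<And>i. {e. i \<in> dom (snd e)} \<in> \<T>"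
    using countable_total_sets by blast
  define \<E> where "\<E> = \<D> \<union> \<T>"
  have \<E>: "countable \<E>" "\<E> \<noteq> {}" "\<And>D. D \<in> \<E> \<Longrightarrow> sdense D"
    using D \<T> by (auto simp: \<E>_def)
  define E where "E = from_nat_into \<E>"
  have E: "range E = \<E>" unfolding E_def using \<E> by (simp add: range_from_nat_into)
  have "\<exists>f. \<forall>n. (cond (f n) \<and> (n = 0 \<longrightarrow> f n = d)) \<and> (f (Suc n) \<in> E n \<and> sext (f n) (f (Suc n)))"
  proof (rule dependent_nat_choice)
    show "\<exists>x. cond x \<and> ((0::nat) = 0 \<longrightarrow> x = d)" using d by blast
    fix e and n :: nat assume "cond e \<and> (n = 0 \<longrightarrow> e = d)"
    moreover have "sdense (E n)" using E \<E>(3) by blast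
    ultimately show "\<exists>e'. (cond e' \<and> (Suc n = 0 \<longrightarrow> e' = d)) \<and> e' \<in> E n \<and> sext e e'"
      unfolding sdense_def by blast
  qed
  then obtain f where f: "\<And>n. cond (f n)" "f 0 = d" "\<And>n. f (Suc n) \<in> E n" "\<And>n. sext (f n) (f (Suc n))"
    by blast
  have sd: "sext d (f n)" for n
    by (induction n) (use f sext_refl sext_trans in auto)
  have meet: "\<exists>n. f n \<in> D" if "D \<in> \<E>" for D
    using that E f(3) by blast
  have cov: "\<exists>n. \<sigma> \<in> dom (fst (f n))" if "node R fs \<sigma> c" "(c, astar) \<in> R" for \<sigma> c
    using meet[of "{e. \<sigma> \<in> dom (fst e)}"] \<T>(3)[of \<sigma>] that by (auto simp: \<E>_def nodes_upto_def)
  have cov': "\<exists>n. i \<in> dom (snd (f n))" for i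
    using meet[of "{e. i \<in> dom (snd e)}"] \<T>(4)[of i] by (auto simp: \<E>_def)
  obtain x y where xy: "(x, y) \<in> topspace X_top" "\<And>n. holds (f n) (x, y)"
    "\<And>w. finite (dom (fst w)) \<Longrightarrow> finite (dom (snd w)) \<Longrightarrow> dom (fst w) \<subseteq> nodes_upto astar \<Longrightarrow>
      holds w (x, y) \<Longrightarrow> \<exists>n. ext w (f n)"
  proof (rule chain_point[of f])
    show "cond (f n)" "ext (f n) (f (Suc n))" for n using f(1) sext_ext[OF f(4)] by auto
    show "\<exists>n. \<sigma> \<in> dom (fst (f n))" if "node R fs \<sigma> c" "(c, astar) \<in> R" for \<sigma> c
      using that by (rule cov)
    show "\<exists>n. i \<in> dom (snd (f n))" for i by (rule cov')
  qed (rule that)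
  have fin: "\<exists>e. cond e \<and> sext d e \<and> ext w e \<and> holds e (x, y)"
    if "finite (dom (fst w))" "finite (dom (snd w))" "dom (fst w) \<subseteq> nodes_upto astar" "holds w (x, y)" for w
    using xy(3)[OF that] f(1) sd xy(2) by blast
  show ?thesis
  proof (rule that[OF xy(1)])
    show "holds d (x, y)" using xy(2)[of 0] f(2) by simp
    show "generic \<D> (x, y)" unfolding generic_def
      using meet f(1) xy(2) by (metis UnI1 \<E>_def)
    fix m k assume mk: "TL x [m, k] = Some True"
    have "[m, k] \<in> nodes_upto astar" using node_pair R_refl[OF astar_Field] by (auto simp: nodes_upto_def)
    then obtain e where e: "sext d e" "ext ([[m, k] \<mapsto> True], Map.empty) e"
      using fin[of "([[m, k] \<mapsto> True], Map.empty)"] mk by (auto simp: holds_def map_le_def)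
    then have "fst e [m, k] = Some True" by (auto simp: ext_def map_le_def)
    then show "fst d [m, k] = Some True" using e(1) by (simp add: sext_def)
  qed (rule fin)
qed

section \<open>Deciding the numbers \<open>c\<^sup>x(m)\<close>\<close>

lemma sq_le_iff:
  assumes "s \<in> fin_strings"
  shows "sq_le m s (as_map x) \<longleftrightarrow> agree astar (lab s) (TL x) \<and> m \<le> n_fin s \<and> enat m \<le> n_val (as_map x) \<and>
    (\<forall>l<m. k_fin s l = k_val (as_map x) l)"
  using assms le_star_point[OF assms]
  by (auto simp: sq_le_def n_val_def[of s] k_val_def[of s])

lemma k_val_eqI:
  assumes "TL x [l, k] = Some True" "\<And>j. j < k \<Longrightarrow> TL x [l, j] = Some False"
  shows "k_val (as_map x) l = k"
  unfolding k_val_point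
proof (rule Least_equality)
  show "TL x [l, k] = Some True" by (rule assms(1))
  show "k \<le> j" if "TL x [l, j] = Some True" for j
    using assms(2)[of j] that by (metis not_le option.inject)
qed

lemma c_val_attained:
  assumes "enat m \<le> n_val (as_map x)"
  obtains s where "s \<in> fin_strings" "card (dom s) = c_val (as_map x) m" "sq_le m s (as_map x)"
proof -
  obtain s where "s \<in> fin_strings" "sq_le m s (as_map x)" using ex_sq_le[OF assms] .
  then have "\<exists>j. \<exists>s\<in>fin_strings. card (dom s) = j \<and> sq_le m s (as_map x)" by blast
  then have "\<exists>s\<in>fin_strings. card (dom s) = c_val (as_map x) m \<and> sq_le m s (as_map x)"
    unfolding c_val_def by (rule LeastI_ex)
  then show ?thesis using that by blast
qed

lemma c_val_zero: "c_val (as_map x) 0 = 0"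
proof -
  have "agree astar (lab Map.empty) (TL x)" by (simp add: agree_def agree_at_def lab_empty)
  then have "sq_le 0 Map.empty (as_map x)" using sq_le_iff[OF empty_fin_string] by (simp add: zero_enat_def[symmetric])
  then have "\<exists>s\<in>fin_strings. card (dom s) = 0 \<and> sq_le 0 s (as_map x)"
    using empty_fin_string by (intro bexI[of _ Map.empty]) auto
  then have "(LEAST j. \<exists>s\<in>fin_strings. card (dom s) = j \<and> sq_le 0 s (as_map x)) \<le> 0" by (rule Least_le)
  then show ?thesis by (simp add: c_val_def)
qed

text \<open>A positive rank carries labels only if its \<open>a_lub\<close> is below the number of
  restrictions of \<open>t\<close>. This leaves finitely many ranks, each with finitely many
  labels.\<close>

lemma finite_lab:
  assumes t: "t \<in> fin_strings"
  shows "finite (dom (lab t))"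
proof -
  define N where "N = card {s. s \<subseteq>\<^sub>m t}"
  have fin: "finite {s. s \<subseteq>\<^sub>m t}" using finite_submaps fin_strings_finite[OF t] by blast
  have "dom (lab t) \<subseteq> (\<Union>b\<in>insert least_elt {b \<in> Field R. a_lub b < N}. {\<sigma>. node R fs \<sigma> b \<and> lab t \<sigma> \<noteq> None})"
  proof
    fix \<sigma> assume \<sigma>: "\<sigma> \<in> dom (lab t)"
    then have "\<sigma> \<in> tree - {[]}" by (subst (asm) dom_def, subst (asm) lab_unfold) (auto simp: lab_step_def split: if_splits)
    then obtain b where b: "node R fs \<sigma> b" by (auto simp: tree_def)
    have "b \<in> insert least_elt {b \<in> Field R. a_lub b < N}"
    proof (cases "b = least_elt")
      case False
      have "lab t \<sigma> \<noteq> None" using \<sigma> by blast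
      then have "\<not> card (preds b t) \<le> a_lub b" using lab_none[OF t b False] by argo
      moreover have "card (preds b t) \<le> N"
        unfolding N_def by (rule card_mono[OF fin]) (auto simp: preds_def)
      ultimately show ?thesis using node_Field[OF b] by simp
    qed simp
    then show "\<sigma> \<in> (\<Union>b\<in>insert least_elt {b \<in> Field R. a_lub b < N}. {\<sigma>. node R fs \<sigma> b \<and> lab t \<sigma> \<noteq> None})"
      using b \<sigma> by auto
  qed
  moreover have "finite (\<Union>b\<in>insert least_elt {b \<in> Field R. a_lub b < N}. {\<sigma>. node R fs \<sigma> b \<and> lab t \<sigma> \<noteq> None})"
    using finite_a_lub[of N] finite_lab_at[OF t] least_Field by (intro finite_UN_I) auto
  ultimately show ?thesis by (rule finite_subset)
qed

text \<open>Besides a string that witnesses the value of \<open>c\<^sup>x(m)\<close> we need to know why the finitely many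
  shorter strings are not true initial segments of \<open>x\<close>.\<close>

lemma c_val_decide:
  assumes m: "enat m \<le> n_val (as_map x)"
  obtains S where "finite S" "S \<subseteq> nodes_below astar"
    "\<And>x'. (\<And>\<sigma>. \<sigma> \<in> S \<Longrightarrow> TL x' \<sigma> = TL x \<sigma>) \<Longrightarrow> enat m \<le> n_val (as_map x') \<Longrightarrow>
      (\<And>l. l < m \<Longrightarrow> k_val (as_map x') l = k_val (as_map x) l) \<Longrightarrow>
      c_val (as_map x') m = c_val (as_map x) m"
proof -
  define c where "c = c_val (as_map x) m"
  obtain s where s: "s \<in> fin_strings" "card (dom s) = c" "sq_le m s (as_map x)"
    using c_val_attained[OF m] unfolding c_def by blast
  have min: "\<not> sq_le m r (as_map x)" if "r \<in> fin_strings" "card (dom r) < c" for r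
    using that not_less_Least unfolding c_def c_val_def by blast
  define B where "B = {r \<in> fin_strings. card (dom r) \<le> c \<and> \<not> agree astar (lab r) (TL x)}"
  have "\<exists>\<sigma>\<in>nodes_below astar. \<exists>i. lab r \<sigma> = Some i \<and> TL x \<sigma> \<noteq> Some i" if "r \<in> B" for r
    using that unfolding B_def agree_def agree_at_def nodes_below_def by blast
  then obtain g where g: "\<And>r. r \<in> B \<Longrightarrow> g r \<in> nodes_below astar \<and> (\<exists>i. lab r (g r) = Some i \<and> TL x (g r) \<noteq> Some i)"
    by metis
  have "finite B" using finite_fin_strings[of c] by (rule rev_finite_subset) (auto simp: B_def)
  \<comment> \<open>Labels of the witness keep it valid; one disagreement for each string in
    \<open>B\<close> keeps that string excluded. A shorter string that agrees with x fails because
    of its own \<open>n_fin\<close> or \<open>k_fin\<close>, so it fails for the other point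
    too.\<close>
  define S where "S = (dom (lab s) \<inter> nodes_below astar) \<union> g ` B"
  show ?thesis
  proof (rule that)
    show "finite S" using finite_lab[OF s(1)] \<open>finite B\<close> by (simp add: S_def)
    show "S \<subseteq> nodes_below astar" using g by (auto simp: S_def)
    fix x' assume S: "\<And>\<sigma>. \<sigma> \<in> S \<Longrightarrow> TL x' \<sigma> = TL x \<sigma>" and m': "enat m \<le> n_val (as_map x')"
      and k: "\<And>l. l < m \<Longrightarrow> k_val (as_map x') l = k_val (as_map x) l"
    have sx: "agree astar (lab s) (TL x)" "m \<le> n_fin s" "\<And>l. l < m \<Longrightarrow> k_fin s l = k_val (as_map x) l"
      using s(3) sq_le_iff[OF s(1)] by auto
    have "agree astar (lab s) (TL x')"
      unfolding agree_def agree_at_def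
    proof (intro ballI allI impI)
      fix b \<sigma> i assume *: "b \<in> underS R astar" "node R fs \<sigma> b" "lab s \<sigma> = Some i"
      then have \<sigma>: "\<sigma> \<in> nodes_below astar" by (auto simp: nodes_below_def)
      then have "TL x \<sigma> = Some i" using agreeD[OF sx(1)] * by blast
      moreover have "\<sigma> \<in> S" using \<sigma> * by (auto simp: S_def)
      ultimately show "TL x' \<sigma> = Some i" using S by simp
    qed
    then have "sq_le m s (as_map x')" using sq_le_iff[OF s(1)] sx m' k by simp
    then have ex: "\<exists>s\<in>fin_strings. card (dom s) = c \<and> sq_le m s (as_map x')" using s by blast
    have "c \<le> j" if j: "\<exists>r\<in>fin_strings. card (dom r) = j \<and> sq_le m r (as_map x')" for j
    proof (rule ccontr)
      assume "\<not> c \<le> j"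
      obtain r where r: "r \<in> fin_strings" "card (dom r) = j" "sq_le m r (as_map x')" using j by blast
      have rx: "agree astar (lab r) (TL x')" "m \<le> n_fin r" "\<And>l. l < m \<Longrightarrow> k_fin r l = k_val (as_map x') l"
        using r(3) sq_le_iff[OF r(1)] by auto
      show False
      proof (cases "agree astar (lab r) (TL x)")
        case True
        then have "sq_le m r (as_map x)" using sq_le_iff[OF r(1)] rx m k by simp
        then show False using min r \<open>\<not> c \<le> j\<close> by simp
      next
        case False
        then have "r \<in> B" using r \<open>\<not> c \<le> j\<close> by (simp add: B_def)
        then obtain i where "g r \<in> nodes_below astar" "lab r (g r) = Some i" "TL x (g r) \<noteq> Some i" "g r \<in> S"
          using g by (auto simp: S_def)
        then show False using agreeD[OF rx(1)] S by metis
      qed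
    qed
    then have "(LEAST j. \<exists>s\<in>fin_strings. card (dom s) = j \<and> sq_le m s (as_map x')) = c"
      using ex by (intro Least_equality) auto
    then show "c_val (as_map x') m = c_val (as_map x) m" by (simp add: c_val_def[of "as_map x'"] c_def)
  qed
qed

text \<open>Diagonalisation: after the prescribed values the neighbourhood demands a difference from
  \<open>M j\<close> at position \<open>n + j\<close> for each \<open>j \<le> K\<close>. Any member
  of the list inside it has a larger index.\<close>

lemma code_above:
  obtains k where "K < k" "\<And>i. i < n \<Longrightarrow> M k i = \<zeta> i"
proof -
  define y where "y i = (if i < n then \<zeta> i else \<not> M (i - n) i)" for i
  define V where "V i = (if i < n + Suc K then {y i} else UNIV)" for i
  define U where "U = Pi\<^sub>E UNIV V"
  have "openin (cantor_topology UNIV) U"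
    unfolding U_def
  proof (rule product_topology_basis)
    have "{i. V i \<noteq> topspace (discrete_topology UNIV)} \<subseteq> {..<n + Suc K}" by (auto simp: V_def)
    then show "finite {i. V i \<noteq> topspace (discrete_topology UNIV)}" by (rule finite_subset) simp
  qed simp
  moreover have "y \<in> U" by (auto simp: U_def V_def)
  moreover have "y \<in> cantor_topology UNIV closure_of (range M)"
    using dense_list by (simp add: computable_dense_list_def)
  ultimately obtain k where "M k \<in> U" by (auto simp: in_closure_of)
  then have k: "M k i = y i" if "i < n + Suc K" for i
    using that by (auto simp: U_def V_def PiE_def Pi_def split: if_splits)
  have "K < k"
  proof (rule ccontr)
    assume "\<not> K < k"
    then have "M k (n + k) = y (n + k)" by (intro k) simp
    then show False by (simp add: y_def)
  qed
  moreover have "M k i = \<zeta> i" if "i < n" for i using k[of i] that by (simp add: y_def)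
  ultimately show ?thesis by (rule that)
qed

section \<open>The construction\<close>

text \<open>A state decides \<open>k\<^sup>x(l)\<close> for \<open>l < m\<close> and \<open>c\<^sup>x(l)\<close> for \<open>l \<le> m\<close>. It leaves open whether \<open>n\<^sup>x = m\<close>.\<close>

definition valid ::
  "condition \<Rightarrow> nat \<Rightarrow> (nat \<Rightarrow> nat) \<Rightarrow> (nat \<Rightarrow> nat) \<Rightarrow> bool" where
  "valid d m kk cc \<longleftrightarrow> cond d \<and>
    (\<forall>l<m. fst d [l, kk l] = Some True \<and> (\<forall>k<kk l. fst d [l, k] = Some False)) \<and>
    (\<forall>l k. fst d [l, k] = Some True \<longrightarrow> l < m \<and> k = kk l) \<and>
    dom (snd d) = {..<cc m} \<and>
    (\<forall>l<m. cc l < cc m \<and> (\<forall>i\<le>cc l. snd d i = Some (M (kk l) i))) \<and>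
    (\<forall>x. fst d \<subseteq>\<^sub>m TL x \<longrightarrow> (\<forall>l\<le>m. c_val (as_map x) l = cc l))"

lemma validD:
  assumes "valid d m kk cc"
  shows "cond d"
    and "l < m \<Longrightarrow> fst d [l, kk l] = Some True"
    and "l < m \<Longrightarrow> k < kk l \<Longrightarrow> fst d [l, k] = Some False"
    and "fst d [l, k] = Some True \<Longrightarrow> l < m \<and> k = kk l"
    and "dom (snd d) = {..<cc m}"
    and "l < m \<Longrightarrow> cc l < cc m"
    and "l < m \<Longrightarrow> i \<le> cc l \<Longrightarrow> snd d i = Some (M (kk l) i)"
    and "fst d \<subseteq>\<^sub>m TL x \<Longrightarrow> l \<le> m \<Longrightarrow> c_val (as_map x) l = cc l"
  using assms unfolding valid_def by blast+

lemma valid_empty: "valid (Map.empty, Map.empty) 0 (\<lambda>_. 0) (\<lambda>_. 0)"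
  using cond_empty c_val_zero by (simp add: valid_def)

lemma valid_k_val:
  assumes "valid d m kk cc" "fst d \<subseteq>\<^sub>m TL x" "l < m"
  shows "TL x [l] = Some False" "k_val (as_map x) l = kk l"
proof -
  have "TL x [l, kk l] = Some True" "\<And>k. k < kk l \<Longrightarrow> TL x [l, k] = Some False"
    using map_leD[OF assms(2)] validD(2,3)[OF assms(1,3)] by blast+
  then show "TL x [l] = Some False" "k_val (as_map x) l = kk l"
    using TL_single k_val_eqI by blast+
qed

text \<open>Codes constrain only bits up to \<open>cc l\<close>, which is below \<open>cc m\<close>.
  Hence a point and its flip at \<open>cc m\<close> both qualify.\<close>

lemma valid_in_Y:
  assumes d: "valid d m kk cc" "fst d \<subseteq>\<^sub>m TL x" and xy: "(x, y) \<in> topspace X_top"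
    and n: "n_val (as_map x) = enat m"
    and y: "\<And>i. i \<noteq> cc m \<Longrightarrow> i \<in> dom (snd d) \<Longrightarrow> snd d i = Some (y i)"
  shows "(x, y) \<in> Y"
proof -
  have "codes (k_val (as_map x) l) (map y [0..<c_val (as_map x) l + 1])" if l: "l < m" for l
  proof -
    have kc: "k_val (as_map x) l = kk l" "c_val (as_map x) l = cc l"
      using valid_k_val(2)[OF d l] validD(8)[OF d, of l] l by auto
    have "y i = M (kk l) i" if "i \<le> cc l" for i
    proof -
      have "snd d i = Some (M (kk l) i)" "cc l < cc m" using validD(6,7)[OF d(1) l] that by auto
      then show ?thesis using y[of i] that by auto
    qed
    then show ?thesis unfolding kc codes_def by (simp add: nth_append less_Suc_eq_le del: upt_Suc)
  qed
  then show ?thesis unfolding Y_def using xy n by simp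
qed

text \<open>The symmetry that exchanges the ends of an edge. It preserves conditions, extensions and
  density, so it transports genericity from one end to the other.\<close>

definition flip :: "nat \<Rightarrow> condition \<Rightarrow> condition" where
  "flip c d = (fst d, \<lambda>i. if i = c then map_option Not (snd d i) else snd d i)"

lemma flip_flip: "flip c (flip c d) = d"
  by (auto simp: flip_def prod_eq_iff fun_eq_iff option.map_comp o_def option.map_ident)

lemma cond_flip: "cond d \<Longrightarrow> cond (flip c d)"
proof -
  have "dom (snd (flip c d)) = dom (snd d)" by (auto simp: flip_def split: if_splits)
  then show "cond d \<Longrightarrow> cond (flip c d)" by (simp add: cond_def) (simp add: flip_def)
qed

lemma ext_flip: "ext d e \<Longrightarrow> ext (flip c d) (flip c e)"
  by (force simp: ext_def flip_def map_le_def split: if_splits)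

lemma sext_flip: "sext d e \<Longrightarrow> sext (flip c d) (flip c e)"
  using ext_flip by (simp add: sext_def) (simp add: flip_def)

lemma holds_flip: "holds d (x, y) \<Longrightarrow> holds (flip c d) (x, y(c := \<not> y c))"
  by (force simp: holds_def flip_def map_le_def split: if_splits)

lemma sdense_flip:
  assumes "sdense D" shows "sdense (flip c ` D)"
  unfolding sdense_def
proof (intro allI impI)
  fix d assume "cond d"
  then obtain e where "e \<in> D" "cond e" "sext (flip c d) e"
    using assms cond_flip unfolding sdense_def by blast
  then show "\<exists>e\<in>flip c ` D. cond e \<and> sext d e"
    using cond_flip[of e c] sext_flip[of "flip c d" e c] flip_flip[of c d] by (metis imageI)
qed

text \<open>If \<open>d\<close> had no such extension, a generic \<open>x\<close> with \<open>n\<^sup>x = m\<close>, with two values of \<open>y\<close> that differ at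
  \<open>c\<^sup>x(m)\<close> only, would give an edge outside \<open>A\<close>.\<close>

lemma extend_into:
  assumes d: "valid d m kk cc" and W: "\<And>w. w \<in> W \<Longrightarrow> cond w" and \<D>: "countable \<D>" "\<forall>D\<in>\<D>. sdense D"
    and dec: "\<And>z. z \<in> Y \<Longrightarrow> generic \<D> z \<Longrightarrow> z \<in> A \<longleftrightarrow> (\<exists>w\<in>W. holds w z)"
    and edge: "\<And>p q. (p, q) \<in> H \<Longrightarrow> p \<in> A \<or> q \<in> A"
  shows "\<exists>e w. cond e \<and> sext d e \<and> w \<in> W \<and> ext w e"
proof (rule ccontr)
  assume no: "\<nexists>e w. cond e \<and> sext d e \<and> w \<in> W \<and> ext w e"
  define c where "c = cc m"
  have cd: "cond d" by (rule validD(1)[OF d])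
  have cD: "c \<notin> dom (snd d)" using validD(5)[OF d] by (simp add: c_def)
  then have "snd d c = None" by blast
  then have fd: "flip c d = d" by (auto simp: flip_def prod_eq_iff fun_eq_iff)
  \<comment> \<open>Closing the family under the flip makes one choice of the point generic for \<D>
    at both ends of the edge.\<close>
  define \<E> where "\<E> = \<D> \<union> (\<lambda>D. flip c ` D) ` \<D>"
  have "countable \<E>" "\<And>D. D \<in> \<E> \<Longrightarrow> sdense D" using \<D> sdense_flip by (auto simp: \<E>_def)
  from generic_point[OF cd this] obtain x y where xy: "(x, y) \<in> topspace X_top" "holds d (x, y)"
    and gen: "generic \<E> (x, y)"
    and new: "\<And>m k. TL x [m, k] = Some True \<Longrightarrow> fst d [m, k] = Some True"
    and fin: "\<And>w. finite (dom (fst w)) \<Longrightarrow> finite (dom (snd w)) \<Longrightarrow> dom (fst w) \<subseteq> nodes_upto astar \<Longrightarrow>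
      holds w (x, y) \<Longrightarrow> \<exists>e. cond e \<and> sext d e \<and> ext w e \<and> holds e (x, y)"
    by blast
  have dx: "fst d \<subseteq>\<^sub>m TL x" using xy(2) by (simp add: holds_def)
  \<comment> \<open>A label 0 would require some \<open>[m, k]\<close> with label 1; the generic
    point has such labels only where \<open>d\<close> does, that is, at first entries below
    \<open>m\<close>.\<close>
  have "TL x [m] \<noteq> Some False"
    using TL_single new validD(4)[OF d] by blast
  then have n: "n_val (as_map x) = enat m" using n_val_eq valid_k_val(1)[OF d dx] by blast
  have c: "c_val (as_map x) m = c" using validD(8)[OF d dx] by (simp add: c_def)
  define y' where "y' = y(c := \<not> y c)"
  have y'y: "y = y'(c := \<not> y' c)" by (simp add: y'_def)
  have t': "(x, y') \<in> topspace X_top" using xy(1) by (simp add: X_top_def)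
  have yd: "snd d i = Some (y i)" if "i \<in> dom (snd d)" for i
    using xy(2) that unfolding holds_def map_le_def by auto
  have Y: "(x, y) \<in> Y" "(x, y') \<in> Y"
    using valid_in_Y[OF d dx xy(1) n] valid_in_Y[OF d dx t' n] yd by (auto simp: y'_def c_def)
  have cw: "finite (dom (fst w)) \<and> finite (dom (snd w)) \<and> dom (fst w) \<subseteq> nodes_upto astar" if "cond w" for w
    using that cond_node[OF that] by (auto simp: cond_def nodes_upto_def)
  have "(x, y) \<notin> A"
  proof
    assume "(x, y) \<in> A"
    moreover have "generic \<D> (x, y)" using generic_subset[OF gen] by (simp add: \<E>_def)
    ultimately obtain w where w: "w \<in> W" "holds w (x, y)" using dec Y by blast
    then show False using fin[of w] cw[OF W[OF w(1)]] no by blast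
  qed
  moreover have "(x, y') \<notin> A"
  proof
    assume "(x, y') \<in> A"
    moreover have "generic \<D> (x, y')"
      unfolding generic_def
    proof
      fix D assume "D \<in> \<D>"
      then have "flip c ` D \<in> \<E>" by (simp add: \<E>_def)
      then obtain e where e: "e \<in> D" "cond (flip c e)" "holds (flip c e) (x, y)"
        using gen unfolding generic_def by blast
      then have "cond e" "holds e (x, y')"
        using cond_flip[OF e(2), of c] holds_flip[OF e(3), of c] flip_flip by (auto simp: y'_def)
      then show "\<exists>d\<in>D. cond d \<and> holds d (x, y')" using e(1) by blast
    qed
    ultimately obtain w where w: "w \<in> W" "holds w (x, y')" using dec Y by blast
    \<comment> \<open>Pulling \<open>w\<close> back to the first end gives an extension of
      \<open>d\<close>, and flipping this extension again gives one below \<open>w\<close>. It still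
      extends \<open>d\<close>, which the flip fixes.\<close>
    have "holds (flip c w) (x, y)" using holds_flip[OF w(2), of c] y'y by simp
    then obtain e where e: "cond e" "sext d e" "ext (flip c w) e"
      using fin[of "flip c w"] cw[OF cond_flip[OF W[OF w(1)], of c]] by blast
    have "cond (flip c e)" "sext d (flip c e)" "ext w (flip c e)"
      using cond_flip[OF e(1)] sext_flip[OF e(2), of c] ext_flip[OF e(3), of c] fd flip_flip by auto
    then show False using no w(1) by blast
  qed
  moreover have "((x, y), (x, y')) \<in> H \<or> ((x, y'), (x, y)) \<in> H"
  proof -
    have "{i. y i \<noteq> y' i} = {c}" "{i. y' i \<noteq> y i} = {c}" by (auto simp: y'_def)
    moreover have "\<not> y c \<or> \<not> y' c" by (simp add: y'_def)
    ultimately show ?thesis using Y n c unfolding H_def by auto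
  qed
  ultimately show False using edge by blast
qed

section \<open>Passing from one state to the next\<close>

lemma sext_label_set:
  assumes "finite A" "A \<subseteq> nodes_upto astar" "cond d"
  shows "\<exists>e. cond e \<and> sext d e \<and> A \<subseteq> dom (fst e)"
  using assms(1,2)
proof (induction A rule: finite_induct)
  case empty then show ?case using assms(3) sext_refl by blast
next
  case (insert \<sigma> A)
  then obtain e where e: "cond e" "sext d e" "A \<subseteq> dom (fst e)" by auto
  obtain b where "node R fs \<sigma> b" "(b, astar) \<in> R" using insert.prems by (auto simp: nodes_upto_def)
  then obtain f where f: "\<sigma> \<in> dom (fst f)" "cond f" "sext e f"
    using sdense_label e(1) unfolding sdense_def by blast
  have "dom (fst e) \<subseteq> dom (fst f)"
    using f(3) by (intro map_le_implies_dom_le) (simp add: sext_def ext_def)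
  then show ?case using e f sext_trans[OF e(2) f(3)] by blast
qed

text \<open>The parent \<open>[m]\<close> is outside the domain of every condition, so only children
  of \<open>[m, k]\<close> could conflict with the new label 1, and they are unlabelled.\<close>

lemma cond_promise:
  assumes e: "cond e" and k: "fst e [m, k] = None" "\<And>j. fst e [m, k, j] = None"
  shows "cond ((fst e)([m, k] \<mapsto> True), snd e)"
proof -
  have coh: "coherent (fst e)" using e by (simp add: cond_def)
  have m: "fst e [m] = None"
  proof (rule ccontr)
    assume "fst e [m] \<noteq> None"
    then have "[m] \<in> nodes_below top_elt" using e by (auto simp: cond_def)
    then show False using nodes_below_iff[of "[m]" top_elt top_elt] node_single by (simp add: underS_iff)
  qed
  have "coherent ((fst e)([m, k] \<mapsto> True))" (is "coherent ?p")
    unfolding coherent_def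
  proof (intro allI impI conjI)
    fix \<sigma> c j assume \<sigma>: "node R fs \<sigma> c \<and> c \<noteq> least_elt" "?p \<sigma> = Some True"
    show "?p (\<sigma> @ [j]) \<noteq> Some True"
    proof (cases "\<sigma> = [m, k]")
      case True then show ?thesis using k(2)[of j] by simp
    next
      case False
      then have "fst e \<sigma> = Some True" using \<sigma>(2) by simp
      moreover from this have "\<sigma> @ [j] \<noteq> [m, k]" using m by auto
      ultimately show ?thesis using coherent_True[OF coh, of \<sigma> c j] \<sigma>(1) by simp
    qed
  next
    fix \<sigma> c assume \<sigma>: "node R fs \<sigma> c \<and> c \<noteq> least_elt" "?p \<sigma> = Some False"
    then have "fst e \<sigma> = Some False" by (auto split: if_splits)
    then obtain j where "fst e (\<sigma> @ [j]) = Some True" using coherent_False[OF coh] \<sigma>(1) by blast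
    moreover from this have "\<sigma> @ [j] \<noteq> [m, k]" using k(1) by auto
    ultimately show "\<exists>k. ?p (\<sigma> @ [k]) = Some True" by (intro exI[of _ j]) simp
  qed
  moreover have "[m, k] \<in> nodes_below top_elt"
    using node_pair astar_lt_top by (auto simp: nodes_below_def)
  ultimately show ?thesis using e by (auto simp: cond_def)
qed

text \<open>The new value \<open>k = k\<^sup>x(m)\<close> codes \<open>y\<close> up to \<open>c\<^sup>x(m)\<close>. Choosing it larger than all \<open>k\<^sup>s(m)\<close> for
  strings \<open>s\<close> of length at most \<open>N\<close> makes \<open>c\<^sup>x(m + 1)\<close> larger than \<open>N\<close>.\<close>

lemma valid_extend:
  assumes d: "valid d m kk cc" and e: "cond e" "sext d e"
  obtains d' kk' cc' where "valid d' (Suc m) kk' cc'" "ext e d'"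
    "\<And>l. l < m \<Longrightarrow> kk' l = kk l" "\<And>l. l \<le> m \<Longrightarrow> cc' l = cc l"
proof -
  have de: "fst d \<subseteq>\<^sub>m fst e" "snd d \<subseteq>\<^sub>m snd e" using e(2) by (auto simp: sext_def ext_def)
  \<comment> \<open>Undecided bits up to c^x(m) get the default value 0, so that there is a complete
    string for the new promise to code.\<close>
  define u where "u i = (if i \<in> dom (snd e) then snd e i else if i \<le> cc m then Some False else None)" for i
  have du: "dom u = dom (snd e) \<union> {..cc m}" by (auto simp: u_def split: if_splits)
  have eu: "snd e \<subseteq>\<^sub>m u" by (auto simp: u_def map_le_def)
  have finu: "finite (dom u)" using e(1) du by (simp add: cond_def)
  define N where "N = Suc (Max (dom u))"
  have N: "i < N" if "i \<in> dom u" for i using Max_ge[OF finu that] by (simp add: N_def)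
  \<comment> \<open>Two kinds of values are to be avoided: the guesses of short strings, and second
    entries of labelled nodes, which guarantees that \<open>[m, k]\<close> and its children are
    unlabelled.\<close>
  define A where "A = (\<lambda>s. k_fin s m) ` {s \<in> fin_strings. card (dom s) \<le> N} \<union> (\<lambda>\<rho>. \<rho> ! 1) ` dom (fst e)"
  have "finite A" using finite_fin_strings e(1) by (simp add: A_def cond_def)
  define K where "K = Max (insert 0 A)"
  have K: "a \<le> K" if "a \<in> A" for a using \<open>finite A\<close> that by (simp add: K_def)
  obtain k where k: "K < k" "\<And>i. i < Suc (cc m) \<Longrightarrow> M k i = the (u i)"
    using code_above[of K "Suc (cc m)" "\<lambda>i. the (u i)"] by blast
  have fresh: "fst e \<rho> = None" if "\<rho> ! 1 = k" for \<rho>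
  proof (rule ccontr)
    assume "fst e \<rho> \<noteq> None"
    then have "\<rho> ! 1 \<in> A" by (auto simp: A_def)
    then show False using K k(1) that by fastforce
  qed
  define e1 where "e1 = ((fst e)([m, k] \<mapsto> True), snd e)"
  have e1: "cond e1" unfolding e1_def using cond_promise[OF e(1)] fresh by simp
  have ee1: "fst e \<subseteq>\<^sub>m fst e1" using fresh[of "[m, k]"] by (auto simp: e1_def map_le_def)
  \<comment> \<open>To make \<open>k\<close> the least witness, all earlier siblings must be
    labelled. Doing this without new promises forces their labels to be 0.\<close>
  have "finite ((\<lambda>j. [m, j]) ` {..<k})" "(\<lambda>j. [m, j]) ` {..<k} \<subseteq> nodes_upto astar"
    using node_pair R_refl[OF astar_Field] by (auto simp: nodes_upto_def)
  then obtain e2 where e2: "cond e2" "sext e1 e2" "(\<lambda>j. [m, j]) ` {..<k} \<subseteq> dom (fst e2)"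
    using sext_label_set[OF _ _ e1] by blast
  have e12: "fst e1 \<subseteq>\<^sub>m fst e2" using e2(2) by (simp add: sext_def ext_def)
  have only: "(l < m \<and> j = kk l) \<or> (l = m \<and> j = k)" if "fst e2 [l, j] = Some True" for l j
  proof -
    have "fst e1 [l, j] = Some True" using e2(2) that by (simp add: sext_def)
    then have "(l = m \<and> j = k) \<or> fst e [l, j] = Some True" by (auto simp: e1_def split: if_splits)
    moreover have "l < m \<and> j = kk l" if "fst e [l, j] = Some True"
    proof -
      have "fst d [l, j] = Some True" using e(2) that by (simp add: sext_def)
      then show ?thesis by (rule validD(4)[OF d])
    qed
    ultimately show ?thesis by blast
  qed
  define kk' where "kk' = kk(m := k)"
  have d2: "fst d \<subseteq>\<^sub>m fst e2" using de(1) ee1 e12 by (meson map_le_trans)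
  have k2: "fst e2 [l, kk' l] = Some True \<and> (\<forall>j<kk' l. fst e2 [l, j] = Some False)" if l: "l < Suc m" for l
  proof (cases "l = m")
    case True
    have "fst e2 [m, k] = Some True" using map_leD[OF e12, of "[m, k]" True] by (simp add: e1_def)
    moreover have "fst e2 [m, j] = Some False" if j: "j < k" for j
    proof -
      have "[m, j] \<in> dom (fst e2)" using e2(3) j by auto
      then obtain i where i: "fst e2 [m, j] = Some i" by blast
      then have "i \<noteq> True" using only[of m j] j by auto
      then show ?thesis using i by simp
    qed
    ultimately show ?thesis using True by (simp add: kk'_def)
  next
    case False
    then have "fst d [l, kk l] = Some True \<and> (\<forall>j<kk l. fst d [l, j] = Some False)"
      using l validD(2,3)[OF d, of l] by simp
    then show ?thesis using False map_leD[OF d2] by (simp add: kk'_def)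
  qed
  have point: "enat (Suc m) \<le> n_val (as_map x) \<and> (\<forall>l<Suc m. k_val (as_map x) l = kk' l)"
    if x: "fst e2 \<subseteq>\<^sub>m TL x" for x
  proof -
    have t: "TL x [l, kk' l] = Some True \<and> (\<forall>j<kk' l. TL x [l, j] = Some False)" if l: "l < Suc m" for l
      using k2[OF l] map_leD[OF x] by blast
    then have "k_val (as_map x) l = kk' l" if "l < Suc m" for l using k_val_eqI that by blast
    moreover have "TL x [l] = Some False" if "l < Suc m" for l using t[OF that] TL_single by blast
    ultimately show ?thesis using n_val_ge by blast
  qed
  \<comment> \<open>An auxiliary point below \<open>e2\<close> shows which finitely many labels pin
    down c^x(m + 1); clause \<open>fin\<close> allows adding them without promises.\<close>
  from generic_point[OF e2(1), of "{}"] obtain x y where xy: "holds e2 (x, y)"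
    and fin: "\<And>w. finite (dom (fst w)) \<Longrightarrow> finite (dom (snd w)) \<Longrightarrow> dom (fst w) \<subseteq> nodes_upto astar \<Longrightarrow>
      holds w (x, y) \<Longrightarrow> \<exists>e. cond e \<and> sext e2 e \<and> ext w e \<and> holds e (x, y)"
    by (metis countable_empty empty_iff)
  have x2: "fst e2 \<subseteq>\<^sub>m TL x" using xy by (simp add: holds_def)
  note px = point[OF x2]
  obtain S where S: "finite S" "S \<subseteq> nodes_below astar"
    "\<And>x'. (\<And>\<sigma>. \<sigma> \<in> S \<Longrightarrow> TL x' \<sigma> = TL x \<sigma>) \<Longrightarrow> enat (Suc m) \<le> n_val (as_map x') \<Longrightarrow>
      (\<And>l. l < Suc m \<Longrightarrow> k_val (as_map x') l = k_val (as_map x) l) \<Longrightarrow>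
      c_val (as_map x') (Suc m) = c_val (as_map x) (Suc m)"
    using c_val_decide[OF conjunct1[OF px]] by blast
  define c' where "c' = c_val (as_map x) (Suc m)"
  \<comment> \<open>A string of length at most \<open>N\<close> that attains the minimum would guess
    the value \<open>k\<close> at \<open>m\<close>, but \<open>k\<close> exceeds all guesses of such
    strings.\<close>
  have "N < c'"
  proof (rule ccontr)
    assume "\<not> N < c'"
    obtain s where s: "s \<in> fin_strings" "card (dom s) = c'" "sq_le (Suc m) s (as_map x)"
      using c_val_attained[OF conjunct1[OF px]] unfolding c'_def by blast
    then have "k_fin s m = k_val (as_map x) m" using sq_le_iff[OF s(1)] by simp
    also have "\<dots> = k" using px by (simp add: kk'_def)
    finally have "k \<in> A" using s \<open>\<not> N < c'\<close> by (auto simp: A_def intro!: rev_image_eqI)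
    then show False using K k(1) by fastforce
  qed
  define p where "p = TL x |` S"
  have pT: "p \<subseteq>\<^sub>m TL x" by (auto simp: p_def map_le_def)
  have pS: "p \<sigma> = TL x \<sigma> \<and> TL x \<sigma> \<noteq> None" if "\<sigma> \<in> S" for \<sigma>
    using that S(2) TL_not_None by (auto simp: p_def nodes_below_def)
  have "dom p \<subseteq> S" by (auto simp: p_def restrict_map_def split: if_splits)
  then have "finite (dom p)" "dom p \<subseteq> nodes_upto astar"
    using S(1,2) nodes_below_upto[of astar] finite_subset by blast+
  then obtain e3 where e3: "cond e3" "sext e2 e3" "ext (p, Map.empty) e3"
    using fin[of "(p, Map.empty)"] pT by (auto simp: holds_def)
  have e23: "fst e2 \<subseteq>\<^sub>m fst e3" and pe3: "p \<subseteq>\<^sub>m fst e3" using e3 by (auto simp: sext_def ext_def)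
  \<comment> \<open>The bits are filled up with zeros below \<open>c'\<close> and no further,
    leaving position \<open>c'\<close> free for the next flip.\<close>
  define u' where "u' i = (if i \<in> dom u then u i else if i < c' then Some False else None)" for i
  have du': "dom u' = {..<c'}"
  proof -
    have "dom u' = dom u \<union> {..<c'}" by (auto simp: u'_def split: if_splits)
    moreover have "dom u \<subseteq> {..<c'}" using N \<open>N < c'\<close> by fastforce
    ultimately show ?thesis by blast
  qed
  have uu': "u' i = Some b" if "u i = Some b" for i b using that by (auto simp: u'_def)
  define d' where "d' = (fst e3, u')"
  define cc' where "cc' = cc(Suc m := c')"
  have "valid d' (Suc m) kk' cc'"
    unfolding valid_def
  proof (intro conjI allI impI)
    show "cond d'" unfolding d'_def by (rule cond_update_snd[OF e3(1)]) (simp add: du')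
    fix l assume l: "l < Suc m"
    show "fst d' [l, kk' l] = Some True" using k2[OF l] map_leD[OF e23] by (simp add: d'_def)
    show "fst d' [l, j] = Some False" if "j < kk' l" for j
      using k2[OF l] that map_leD[OF e23] by (simp add: d'_def)
    have "cc l \<le> cc m" using l validD(6)[OF d, of l] by (cases "l = m") auto
    moreover have "cc m < N" using N[of "cc m"] du by simp
    ultimately show "cc' l < cc' (Suc m)" using l \<open>N < c'\<close> by (simp add: cc'_def)
    fix i assume "i \<le> cc' l"
    then have i: "i \<le> cc l" using l by (simp add: cc'_def)
    have "u i = Some (M (kk' l) i)"
    proof (cases "l = m")
      case True
      then have "i \<in> dom u" "M k i = the (u i)" using i du k(2)[of i] by auto
      then show ?thesis using True by (auto simp: kk'_def)
    next
      case False
      then have "snd d i = Some (M (kk l) i)" using l i validD(7)[OF d, of l i] by simp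
      then show ?thesis using False map_leD[OF eu] map_leD[OF de(2)] by (simp add: kk'_def)
    qed
    then show "snd d' i = Some (M (kk' l) i)" using uu' by (simp add: d'_def)
  next
    fix l j assume "fst d' [l, j] = Some True"
    then have "fst e2 [l, j] = Some True" using e3(2) by (simp add: d'_def sext_def)
    then show "l < Suc m" "j = kk' l" using only[of l j] by (auto simp: kk'_def)
  next
    show "dom (snd d') = {..<cc' (Suc m)}" by (simp add: d'_def cc'_def du')
  next
    fix x' l assume x': "fst d' \<subseteq>\<^sub>m TL x'" and l: "l \<le> Suc m"
    have x'2: "fst e2 \<subseteq>\<^sub>m TL x'" using x' e23 unfolding d'_def by (metis fst_conv map_le_trans)
    show "c_val (as_map x') l = cc' l"
    proof (cases "l = Suc m")
      case True
      have "TL x' \<sigma> = TL x \<sigma>" if \<sigma>: "\<sigma> \<in> S" for \<sigma>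
      proof -
        obtain i where i: "p \<sigma> = Some i" "TL x \<sigma> = Some i" using pS[OF \<sigma>] by auto
        then have "fst d' \<sigma> = Some i" using map_leD[OF pe3] by (simp add: d'_def)
        then show ?thesis using i map_leD[OF x'] by simp
      qed
      then have "c_val (as_map x') (Suc m) = c'"
        unfolding c'_def using point[OF x'2] px by (intro S(3)) auto
      then show ?thesis using True by (simp add: cc'_def)
    next
      case False
      then have "l \<le> m" using l by simp
      moreover have "fst d \<subseteq>\<^sub>m TL x'" using d2 x'2 by (rule map_le_trans)
      ultimately have "c_val (as_map x') l = cc l" using validD(8)[OF d] by blast
      then show ?thesis using False by (simp add: cc'_def)
    qed
  qed
  moreover have "ext e d'"
  proof -
    have "fst e \<subseteq>\<^sub>m fst e3" using ee1 e12 e23 by (meson map_le_trans)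
    moreover have "snd e \<subseteq>\<^sub>m u'" by (rule map_leI) (intro uu' map_leD[OF eu])
    ultimately show ?thesis by (simp add: ext_def d'_def)
  qed
  ultimately show ?thesis by (rule that) (auto simp: kk'_def cc'_def)
qed

text \<open>Step n starts from a state with exactly n promises: it enters \<open>B n\<close>, meets
  the n-th dense set and makes one more promise. The enumeration contains the dense sets of every
  \<open>B n\<close> and those that make the labelling total. Thus the limit is generic, and the
  condition met in \<open>W n\<close> yields membership.\<close>

lemma common_point:
  fixes B :: "nat \<Rightarrow> point set"
  assumes B: "\<And>n. \<exists>b. SDec b (B n)" and edge: "\<And>n p q. (p, q) \<in> H \<Longrightarrow> p \<in> B n \<or> q \<in> B n"
  shows "\<exists>z\<in>Y. \<forall>n. z \<in> B n"
proof -
  define Q where "Q n W \<D> \<longleftrightarrow> (\<forall>w\<in>W. cond w) \<and> countable \<D> \<and> (\<forall>D\<in>\<D>. sdense D) \<and>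
    (\<forall>z\<in>Y. generic \<D> z \<longrightarrow> (z \<in> B n \<longleftrightarrow> (\<exists>w\<in>W. holds w z)))" for n W \<D>
  have "\<exists>W \<D>. Q n W \<D>" for n
  proof -
    obtain b where "SDec b (B n)" using B by blast
    then obtain W \<D> where *: "\<forall>w\<in>W. cond w \<and> dom (fst w) \<subseteq> nodes_below b" "countable \<D>"
      "\<forall>D\<in>\<D>. sdense D"
      "\<forall>z\<in>Y. generic \<D> z \<longrightarrow> (z \<in> B n \<longleftrightarrow> (\<exists>w\<in>W. holds w z))"
      unfolding SDec_def by blast
    have "\<forall>w\<in>W. cond w" using *(1) by blast
    then have "Q n W \<D>" unfolding Q_def using *(2-4) by (intro conjI)
    then show ?thesis by blast
  qed
  then obtain W \<D> where Q: "\<And>n. Q n (W n) (\<D> n)" by metis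
  obtain \<T> where \<T>: "countable \<T>" "\<And>D. D \<in> \<T> \<Longrightarrow> sdense D"
    "\<And>\<sigma>. \<sigma> \<in> nodes_upto astar \<Longrightarrow> {e. \<sigma> \<in> dom (fst e)} \<in> \<T>" "\<And>i. {e. i \<in> dom (snd e)} \<in> \<T>"
    using countable_total_sets by blast
  define \<G> where "\<G> = (\<Union>n. \<D> n) \<union> \<T>"
  have \<G>: "countable \<G>" "\<And>D. D \<in> \<G> \<Longrightarrow> sdense D"
    using Q \<T>(1,2) by (auto simp: \<G>_def Q_def)
  have "\<G> \<noteq> {}" using \<T>(4) by (auto simp: \<G>_def)
  define G where "G = from_nat_into \<G>"
  have G: "range G = \<G>" unfolding G_def using \<G>(1) \<open>\<G> \<noteq> {}\<close> by (rule range_from_nat_into[rotated])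
  define nxt where "nxt n s s' \<longleftrightarrow> (\<exists>w\<in>W n. ext w (fst s')) \<and> (\<exists>g\<in>G n. cond g \<and> ext g (fst s')) \<and>
    ext (fst s) (fst s') \<and> (\<forall>l<n. fst (snd s') l = fst (snd s) l) \<and> (\<forall>l\<le>n. snd (snd s') l = snd (snd s) l)"
    for n and s s' :: "condition \<times> (nat \<Rightarrow> nat) \<times> (nat \<Rightarrow> nat)"
  define val where "val n s \<longleftrightarrow> valid (fst s) n (fst (snd s)) (snd (snd s))"
    for n and s :: "condition \<times> (nat \<Rightarrow> nat) \<times> (nat \<Rightarrow> nat)"
  have "\<exists>f. \<forall>n. val n (f n) \<and> nxt n (f n) (f (Suc n))"
  proof (rule dependent_nat_choice)
    show "\<exists>s. val 0 s"
      using valid_empty by (intro exI[of _ "((Map.empty, Map.empty), \<lambda>_. 0, \<lambda>_. 0)"]) (simp add: val_def)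
    fix s n assume "val n s"
    then obtain d kk cc where s: "s = (d, kk, cc)" and d: "valid d n kk cc"
      unfolding val_def by (cases s) auto
    obtain e w where e: "cond e" "sext d e" and w: "w \<in> W n" "ext w e"
      using extend_into[OF d, of "W n" "\<D> n" "B n"] Q[of n] edge unfolding Q_def by blast
    have "sdense (G n)" using G \<G>(2) by blast
    then obtain g where g: "g \<in> G n" "cond g" "sext e g" using e(1) unfolding sdense_def by blast
    obtain d' kk' cc' where d': "valid d' (Suc n) kk' cc'" "ext g d'"
      "\<And>l. l < n \<Longrightarrow> kk' l = kk l" "\<And>l. l \<le> n \<Longrightarrow> cc' l = cc l"
      using valid_extend[OF d g(2) sext_trans[OF e(2) g(3)]] by blast
    have eg: "ext e g" "ext d g" using g(3) sext_trans[OF e(2) g(3)] by (auto intro: sext_ext)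
    have "ext w d'" using ext_trans[OF ext_trans[OF w(2) eg(1)] d'(2)] .
    then have "nxt n s (d', kk', cc')"
      unfolding nxt_def using w(1) g(1,2) d'(2-4) ext_trans[OF eg(2) d'(2)] s by auto
    moreover have "val (Suc n) (d', kk', cc')" using d'(1) by (simp add: val_def)
    ultimately show "\<exists>s'. val (Suc n) s' \<and> nxt n s s'" by blast
  qed
  then obtain f where f: "\<And>n. val n (f n)" "\<And>n. nxt n (f n) (f (Suc n))" by blast
  define d where "d n = fst (f n)" for n
  define kk where "kk n = fst (snd (f n))" for n
  define cc where "cc n = snd (snd (f n))" for n
  have v: "valid (d n) n (kk n) (cc n)" for n using f(1)[of n] by (simp add: val_def d_def kk_def cc_def)
  have step: "ext (d n) (d (Suc n))" for n using f(2)[of n] by (simp add: nxt_def d_def)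
  have meetW: "\<exists>w\<in>W n. ext w (d (Suc n))" for n using f(2)[of n] by (simp add: nxt_def d_def)
  have meet: "\<exists>n. \<exists>g\<in>D. cond g \<and> ext g (d n)" if D: "D \<in> \<G>" for D
  proof -
    obtain n where "D = G n" using G D by blast
    then have "\<exists>g\<in>D. cond g \<and> ext g (d (Suc n))" using f(2)[of n] by (simp add: nxt_def d_def)
    then show ?thesis by blast
  qed
  obtain x y where xy: "(x, y) \<in> topspace X_top" "\<And>n. holds (d n) (x, y)"
  proof (rule chain_point[of d])
    show "cond (d n)" "ext (d n) (d (Suc n))" for n using validD(1)[OF v] step by auto
    show "\<exists>n. \<sigma> \<in> dom (fst (d n))" if "node R fs \<sigma> c" "(c, astar) \<in> R" for \<sigma> c
    proof -
      have "{e. \<sigma> \<in> dom (fst e)} \<in> \<G>" using \<T>(3)[of \<sigma>] that by (auto simp: \<G>_def nodes_upto_def)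
      then obtain n g where "\<sigma> \<in> dom (fst g)" "ext g (d n)" using meet by blast
      then show ?thesis using map_le_implies_dom_le unfolding ext_def by blast
    qed
    show "\<exists>n. i \<in> dom (snd (d n))" for i
    proof -
      have "{e. i \<in> dom (snd e)} \<in> \<G>" using \<T>(4)[of i] by (simp add: \<G>_def)
      then obtain n g where "i \<in> dom (snd g)" "ext g (d n)" using meet by blast
      then show ?thesis using map_le_implies_dom_le unfolding ext_def by blast
    qed
  qed (rule that)
  have dx: "fst (d n) \<subseteq>\<^sub>m TL x" "snd (d n) \<subseteq>\<^sub>m Some \<circ> y" for n using xy(2)[of n] by (auto simp: holds_def)
  have "(x, y) \<in> Y"
  proof -
    have "codes (k_val (as_map x) m) (map y [0..<c_val (as_map x) m + 1])" for m
    proof -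
      have k: "k_val (as_map x) m = kk (Suc m) m" using valid_k_val(2)[OF v dx(1) lessI] .
      have c: "c_val (as_map x) m = cc (Suc m) m" using validD(8)[OF v dx(1), of m "Suc m"] by simp
      have "y i = M (kk (Suc m) m) i" if "i \<le> cc (Suc m) m" for i
        using map_leD[OF dx(2)[of "Suc m"] validD(7)[OF v lessI that]] by simp
      then show ?thesis unfolding k c codes_def by (simp add: nth_append less_Suc_eq_le del: upt_Suc)
    qed
    then show ?thesis unfolding Y_def using xy(1) by simp
  qed
  moreover have "(x, y) \<in> B n" for n
  proof -
    have "generic (\<D> n) (x, y)"
      unfolding generic_def
    proof
      fix D assume "D \<in> \<D> n"
      then have "D \<in> \<G>" by (auto simp: \<G>_def)
      then obtain n g where g: "g \<in> D" "cond g" "ext g (d n)" using meet by blast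
      then show "\<exists>g\<in>D. cond g \<and> holds g (x, y)" using holds_ext[OF g(3) xy(2)] by blast
    qed
    moreover have "\<exists>w\<in>W n. holds w (x, y)" using meetW[of n] holds_ext xy(2) by blast
    ultimately show ?thesis using Q[of n] \<open>(x, y) \<in> Y\<close> unfolding Q_def by blast
  qed
  ultimately show ?thesis by blast
qed

text \<open>The order has at least the two elements \<open>astar\<close> and \<open>top_elt\<close>,
  so the open case is excluded and \<open>A\<close> is a union of complements of sets at levels in
  \<open>Field R\<close>.\<close>

lemma Sigma0_cases:
  assumes "Sigma0 Y_top R A"
  obtains S where "A = (\<Union>i::nat. Y - S i)" "\<And>i. \<exists>b. SDec b (S i)"
  using assms
proof (cases rule: Sigma0.cases)
  case open_set
  obtain a where "Field R = {a}" using open_set(1) by (auto simp: card_1_singleton_iff)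
  then have "astar = top_elt" using astar_Field top_Field by auto
  then show ?thesis using astar_lt_top by (simp add: underS_iff)
next
  case (union b S)
  have "SDec (b i) (S i)" for i
    using union(2)[of i] Sigma0_SDec by blast
  then have "\<exists>b. SDec b (S i)" for i by blast
  with that[of S] union(1) show ?thesis unfolding topspace_Y_top by blast
qed

text \<open>If a colour A is the union of the sets \<open>Y - S A i\<close>, each
  \<open>S A i\<close> contains an end of every edge, since otherwise A would contain both. A point
  common to all these sets, for all colours, would have no colour.\<close>

lemma no_colouring: "\<not> countable_Sigma0_colouring Y_top H R P"
proof
  assume P: "countable_Sigma0_colouring Y_top H R P"
  then have P': "partition_on Y P" "countable P" "\<And>A. A \<in> P \<Longrightarrow> Sigma0 Y_top R A"
    "\<And>A p q. A \<in> P \<Longrightarrow> (p, q) \<in> H \<Longrightarrow> \<not> (p \<in> A \<and> q \<in> A)"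
    unfolding countable_Sigma0_colouring_def topspace_Y_top by blast+
  have "\<exists>S. A = (\<Union>i::nat. Y - S i) \<and> (\<forall>i. \<exists>b. SDec b (S i))" if "A \<in> P" for A
    using Sigma0_cases[OF P'(3)[OF that]] by metis
  then obtain S where S: "\<And>A. A \<in> P \<Longrightarrow> A = (\<Union>i::nat. Y - S A i) \<and> (\<forall>i. \<exists>b. SDec b (S A i))"
    by metis
  \<comment> \<open>Adding \<open>Y\<close> makes the family nonempty, as its enumeration requires,
    and trivially satisfies the demand on edges.\<close>
  define \<A> where "\<A> = insert Y (\<Union>A\<in>P. range (S A))"
  have \<A>: "countable \<A>" "\<A> \<noteq> {}" using P'(2) by (auto simp: \<A>_def)
  define B where "B = from_nat_into \<A>"
  have B: "range B = \<A>" unfolding B_def using \<A> by (simp add: range_from_nat_into)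
  have HY: "p \<in> Y \<and> q \<in> Y" if "(p, q) \<in> H" for p q using that by (auto simp: H_def)
  have BX: "(\<exists>b. SDec b X) \<and> (\<forall>p q. (p, q) \<in> H \<longrightarrow> p \<in> X \<or> q \<in> X)" if X: "X \<in> \<A>" for X
  proof (cases "X = Y")
    case True
    then show ?thesis using SDec_topspace HY by blast
  next
    case False
    then obtain A i where A: "A \<in> P" "X = S A i" using X by (auto simp: \<A>_def)
    have "Y - X \<subseteq> A" using S[OF A(1)] A(2) by blast
    then have "p \<in> X \<or> q \<in> X" if "(p, q) \<in> H" for p q
      using P'(4)[OF A(1) that] HY[OF that] by blast
    moreover have "\<exists>b. SDec b X" using S[OF A(1)] A(2) by simp
    ultimately show ?thesis by blast
  qed
  have "\<exists>b. SDec b (B n)" "(p, q) \<in> H \<Longrightarrow> p \<in> B n \<or> q \<in> B n" for n p q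
    using BX[of "B n"] rangeI[of B n] unfolding B by blast+
  then obtain z where z: "z \<in> Y" "\<And>n. z \<in> B n" using common_point[of B] by blast
  obtain A where A: "A \<in> P" "z \<in> A" using P'(1) z(1) by (auto simp: partition_on_def)
  then obtain i where "z \<notin> S A i" using S[OF A(1)] by blast
  moreover have "S A i \<in> range B" unfolding B \<A>_def using A(1) by blast
  ultimately show False using z(2) by blast
qed

end

theorem theorem5p31:
  fixes R :: "nat rel"
    and fs :: "nat \<Rightarrow> nat \<Rightarrow> nat"
    and lo :: "nat \<Rightarrow> nat list rel"
    and M :: "nat \<Rightarrow> nat \<Rightarrow> bool"
  assumes "computable_presentation R"
    and "(natLeq_on 3, R) \<in> ordLeq"
    and "succ_of_succ R"
    and "fundamental_sequences R fs"
    and "node_orders R fs lo"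
    and "computable_dense_list M"
  shows "\<not> (\<exists>P. countable_Sigma0_colouring
    (alpha_tree.Y_top R fs lo M) (alpha_tree.H R fs lo M) R P)"
proof -
  interpret alpha_tree R fs lo M
    by unfold_locales (fact assms)+
  show ?thesis using no_colouring by blast
qed

end
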